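(* There is a single-valued $\mathsf{F\Sigma_2P}$ algorithm $A$: for every $n$ and every circuit $C:\{0,1\}^n\to\{0,1\}^{2n}$ given as input, $A(C)$ outputs some $y_C\in\{0,1\}^{2n}$ with $y_C\notin\mathrm{Im}(C)$.
   Context: A single-valued $\mathsf{F\Sigma_2P}$ algorithm $A$ is specified by a polynomial $\ell(\cdot)$ and a deterministic polynomial-time algorithm $V_A(x,\pi_1,\pi_2)$. On input $x$, $A$ outputs $y_x$ if (1) there is $\pi_1\in\{0,1\}^{\ell(|x|)}$ such that for every $\pi_2\in\{0,1\}^{\ell(|x|)}$, $V_A(x,\pi_1,\pi_2)=y_x$, and (2) for every $\pi_1\in\{0,1\}^{\ell(|x|)}$ there is $\pi_2\in\{0,1\}^{\ell(|x|)}$ such that $V_A(x,\pi_1,\pi_2)\in\{y_x,\bot\}$. *)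

theory Defs
  imports Main
begin

definition poly_fun :: "(nat \<Rightarrow> nat) \<Rightarrow> bool" where
  "poly_fun p \<longleftrightarrow> (\<exists>cs :: nat list. \<forall>n. p n = (\<Sum>i<length cs. cs ! i * n ^ i))"

datatype sym = Blank | Zero | One | Sep
datatype dir = Lft | Rgt | Stay

text \<open>A machine: number of states and a transition table.  State 0 is the
start state, state 1 is the accepting halt state (output = maximal bit string
starting at the head), state 2 is the rejecting halt state (output bottom).\<close>
type_synonym tm = "nat \<times> (nat \<Rightarrow> sym \<Rightarrow> nat \<times> sym \<times> dir)"

definition tm_wf :: "tm \<Rightarrow> bool" where
  "tm_wf M \<longleftrightarrow> 3 \<le> fst M \<and>
     (\<forall>q s. q < fst M \<longrightarrow> fst (snd M q s) < fst M)"

type_synonym config = "nat \<times> (int \<Rightarrow> sym) \<times> int"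

definition is_halt :: "nat \<Rightarrow> bool" where
  "is_halt q \<longleftrightarrow> q = 1 \<or> q = 2"

definition mv :: "dir \<Rightarrow> int \<Rightarrow> int" where
  "mv d h = (case d of Lft \<Rightarrow> h - 1 | Rgt \<Rightarrow> h + 1 | Stay \<Rightarrow> h)"

definition tm_step :: "tm \<Rightarrow> config \<Rightarrow> config" where
  "tm_step M c = (case c of (q, tape, h) \<Rightarrow>
     if is_halt q then c else
     (case snd M q (tape h) of (q', s', d) \<Rightarrow> (q', tape(h := s'), mv d h)))"

definition sym_of_bool :: "bool \<Rightarrow> sym" where
  "sym_of_bool b = (if b then One else Zero)"

definition tm_init :: "sym list \<Rightarrow> config" where
  "tm_init w = (0, (\<lambda>i. if 0 \<le> i \<and> i < int (length w) then w ! nat i else Blank), 0)"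

definition tm_run :: "tm \<Rightarrow> sym list \<Rightarrow> nat \<Rightarrow> config" where
  "tm_run M w t = (tm_step M ^^ t) (tm_init w)"

definition halts_within :: "tm \<Rightarrow> sym list \<Rightarrow> nat \<Rightarrow> bool" where
  "halts_within M w t \<longleftrightarrow> is_halt (fst (tm_run M w t))"

definition read_bits :: "(int \<Rightarrow> sym) \<Rightarrow> int \<Rightarrow> bool list" where
  "read_bits tape h =
     map (\<lambda>i. tape (h + int i) = One) [0..<(LEAST k. tape (h + int k) \<notin> {Zero, One})]"

definition cfg_output :: "config \<Rightarrow> bool list option" where
  "cfg_output c = (case c of (q, tape, h) \<Rightarrow>
     if q = 1 then Some (read_bits tape h) else None)"

definition tm_result :: "tm \<Rightarrow> sym list \<Rightarrow> bool list option" where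
  "tm_result M w = cfg_output (tm_run M w (LEAST t. halts_within M w t))"

definition tm_poly_time :: "tm \<Rightarrow> bool" where
  "tm_poly_time M \<longleftrightarrow> (\<exists>p. poly_fun p \<and> (\<forall>w. halts_within M w (p (length w))))"

definition enc3 :: "bool list \<Rightarrow> bool list \<Rightarrow> bool list \<Rightarrow> sym list" where
  "enc3 x a b = map sym_of_bool x @ [Sep] @ map sym_of_bool a @ [Sep] @ map sym_of_bool b"

definition ptime3 :: "(bool list \<Rightarrow> bool list \<Rightarrow> bool list \<Rightarrow> bool list option) \<Rightarrow> bool" where
  "ptime3 V \<longleftrightarrow> (\<exists>M. tm_wf M \<and> tm_poly_time M \<and>
      (\<forall>x a b. tm_result M (enc3 x a b) = V x a b))"

definition fs2p_outputs ::
  "(nat \<Rightarrow> nat) \<Rightarrow> (bool list \<Rightarrow> bool list \<Rightarrow> bool list \<Rightarrow> bool list option)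
     \<Rightarrow> bool list \<Rightarrow> bool list \<Rightarrow> bool" where
  "fs2p_outputs l V x y \<longleftrightarrow>
     (\<exists>p1. length p1 = l (length x) \<and>
        (\<forall>p2. length p2 = l (length x) \<longrightarrow> V x p1 p2 = Some y)) \<and>
     (\<forall>p1. length p1 = l (length x) \<longrightarrow>
        (\<exists>p2. length p2 = l (length x) \<and> V x p1 p2 \<in> {Some y, None}))"

datatype gate = GInput nat | GConst bool | GNot nat | GAnd nat nat | GOr nat nat

record circuit =
  c_inputs :: nat
  c_gates :: "gate list"
  c_outputs :: "nat list"

definition gate_wf :: "nat \<Rightarrow> nat \<Rightarrow> gate \<Rightarrow> bool" where
  "gate_wf n i g = (case g of
      GInput k \<Rightarrow> k < n
    | GConst b \<Rightarrow> True
    | GNot j \<Rightarrow> j < i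
    | GAnd j k \<Rightarrow> j < i \<and> k < i
    | GOr j k \<Rightarrow> j < i \<and> k < i)"

definition circuit_wf :: "circuit \<Rightarrow> bool" where
  "circuit_wf C \<longleftrightarrow>
     (\<forall>i < length (c_gates C). gate_wf (c_inputs C) i (c_gates C ! i)) \<and>
     (\<forall>j \<in> set (c_outputs C). j < length (c_gates C))"

definition gate_val :: "bool list \<Rightarrow> bool list \<Rightarrow> gate \<Rightarrow> bool" where
  "gate_val x vs g = (case g of
      GInput k \<Rightarrow> x ! k
    | GConst b \<Rightarrow> b
    | GNot j \<Rightarrow> \<not> vs ! j
    | GAnd j k \<Rightarrow> vs ! j \<and> vs ! k
    | GOr j k \<Rightarrow> vs ! j \<or> vs ! k)"

definition gate_vals :: "bool list \<Rightarrow> gate list \<Rightarrow> bool list" where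
  "gate_vals x gs = foldl (\<lambda>vs g. vs @ [gate_val x vs g]) [] gs"

definition circuit_eval :: "circuit \<Rightarrow> bool list \<Rightarrow> bool list" where
  "circuit_eval C x = map (\<lambda>j. gate_vals x (c_gates C) ! j) (c_outputs C)"

definition circuit_image :: "circuit \<Rightarrow> bool list set" where
  "circuit_image C = circuit_eval C ` {x. length x = c_inputs C}"

fun bin :: "nat \<Rightarrow> bool list" where
  "bin n = (if n = 0 then [] else odd n # bin (n div 2))"

text \<open>Self-delimiting: each binary digit doubled, terminated by 01.\<close>
definition enc_nat :: "nat \<Rightarrow> bool list" where
  "enc_nat n = concat (map (\<lambda>b. [b, b]) (bin n)) @ [False, True]"

fun enc_gate :: "gate \<Rightarrow> bool list" where
  "enc_gate (GInput k) = enc_nat 0 @ enc_nat k"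
| "enc_gate (GConst b) = enc_nat 1 @ enc_nat (if b then 1 else 0)"
| "enc_gate (GNot j) = enc_nat 2 @ enc_nat j"
| "enc_gate (GAnd j k) = enc_nat 3 @ enc_nat j @ enc_nat k"
| "enc_gate (GOr j k) = enc_nat 4 @ enc_nat j @ enc_nat k"

definition enc_circuit :: "circuit \<Rightarrow> bool list" where
  "enc_circuit C = enc_nat (c_inputs C) @
     enc_nat (length (c_gates C)) @ concat (map enc_gate (c_gates C)) @
     enc_nat (length (c_outputs C)) @ concat (map enc_nat (c_outputs C))"

end

theory Submission
  imports Defs
begin

text \<open>Label the complete binary tree of depth \<open>2 * N\<close> as follows. The content of a leaf is its path from the
root, the content of an inner node is the concatenation of the labels of its two children, and the
label of a node is the least preimage of its content under \<open>C\<close>. As \<open>C\<close> is not onto, some leaf has no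
label, and therefore the root has none. Descending from the root to the leftmost unlabelled child as
long as there is one ends at a node whose content \<open>y\<close> is defined but has no preimage.

The label of a node determines the labels of all its descendants by iterating \<open>C\<close>. Hence \<open>y\<close> is certified by the
path to that node together with the labels of the left siblings at the right turns of the path. A
wrong certificate is refuted by a path \<open>t\<close> and a string \<open>x'\<close>: walking along \<open>t\<close> one reaches a leaf whose claimed
content is not its path, or a claimed label that is larger than another preimage \<open>x'\<close> of the same content, or the
end of the certified path, with \<open>C x' = y\<close>. So \<open>y\<close> is the only string with an irrefutable certificate.

The verifier is written in a language in which every loop runs as often as the input has bits, so
that its running time is a polynomial that can be read off the syntax.\<close>

section \<open>Labelled trees\<close>

text \<open>That a string has no preimage is a universal statement, so guessing one and checking it
  is easy; the obstacle is that all guesses have to agree. Asking for the least avoided string does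
  not help: one would have to certify that every smaller string, of which there may be exponentially
  many, has a preimage. The tree compresses exponentially many such facts. Applying \<open>C\<close>
  to a label and cutting the result in two is the Goldreich-Goldwasser-Micali expansion, so
  \<open>N\<close> bits stand for a whole subtree, and \<open>2 * N * (N + 2)\<close> bits besides
  \<open>y\<close> certify the descent. A false claim about a subtree is already false at a single
  node, which is why one universally quantified path can expose it. Taking least preimages makes a
  label a function of its node, hence \<open>y\<close> unique, and a label that is not least is
  exposed by a single string. The depth is \<open>2 * N\<close> because the paths to the leaves then
  run through all \<open>2 * N\<close>-bit strings, more than \<open>C\<close> can reach. The two
  conditions on an output become: the honest certificate survives every refuter, and every
  certificate that survives all refuters claims the same \<open>y\<close>.\<close>

fun num :: "bool list \<Rightarrow> nat" where
  "num [] = 0"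
| "num (b # bs) = of_bool b + 2 * num bs"

lemma num_inj: "length a = length b \<Longrightarrow> num a = num b \<Longrightarrow> a = b"
proof (induction a b rule: list_induct2)
  case (Cons x xs y ys)
  from Cons.prems have eq: "of_bool x + 2 * num xs = of_bool y + 2 * num ys" by simp
  then have "odd (of_bool x + 2 * num xs) = odd (of_bool y + 2 * num ys)" by (rule arg_cong)
  then have "x = y" by (cases x; cases y) simp_all
  with eq Cons.IH show ?case by simp
qed simp

locale stretch =
  fixes N :: nat and F :: "bool list \<Rightarrow> bool list"
  assumes N_pos: "1 \<le> N" and length_F: "length x = N \<Longrightarrow> length (F x) = 2 * N"
begin

text \<open>\<open>num\<close> counts its first bit as the least significant one, so
  \<open>num (rev x)\<close> is lexicographic order. The verifier keeps \<open>x\<close> reversed on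
  a stack, where this is \<open>num\<close> of the stack.\<close>

definition minpre :: "bool list \<Rightarrow> bool list option" where
  "minpre y = (if \<exists>x. length x = N \<and> F x = y
     then Some (ARG_MIN (\<lambda>x. num (rev x)) x. length x = N \<and> F x = y) else None)"

lemma minpre_None: "minpre y = None \<longleftrightarrow> (\<forall>x. length x = N \<longrightarrow> F x \<noteq> y)"
  by (auto simp: minpre_def)

text \<open>Uniqueness comes from the injectivity of \<open>num\<close> on lists of equal length.
  Minimality is phrased negatively because this is what surviving all refuters \<open>x'\<close>
  yields.\<close>

lemma minpre_Some:
  "minpre y = Some x \<longleftrightarrow> length x = N \<and> F x = y \<and>
     (\<forall>x'. length x' = N \<longrightarrow> F x' = y \<longrightarrow> \<not> num (rev x') < num (rev x))"
  (is "_ \<longleftrightarrow> ?R x")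
proof -
  have R: "?R (ARG_MIN (\<lambda>x. num (rev x)) x. length x = N \<and> F x = y)"
    if "length z = N \<and> F z = y" for z
    using arg_min_nat_lemma[of "\<lambda>x. length x = N \<and> F x = y" z "\<lambda>x. num (rev x)"] that
    by (simp add: not_less)
  have uniq: "a = b" if "?R a" "?R b" for a b
  proof -
    have le: "num (rev c) \<le> num (rev d)" if "?R c" "length d = N" "F d = y" for c d
      using that not_less by blast
    have "num (rev a) = num (rev b)"
      by (rule antisym; rule le) (use \<open>?R a\<close> \<open>?R b\<close> in simp_all)
    moreover have "length a = N" "length b = N" using that by auto
    ultimately show ?thesis using num_inj[of "rev a" "rev b"] by simp
  qed
  show ?thesis
  proof (cases "\<exists>z. length z = N \<and> F z = y")
    case True
    then obtain z where z: "length z = N \<and> F z = y" by blast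
    have "minpre y = Some x \<longleftrightarrow> (ARG_MIN (\<lambda>x. num (rev x)) x. length x = N \<and> F x = y) = x"
      using True by (simp add: minpre_def)
    also have "\<dots> \<longleftrightarrow> ?R x" using R[OF z] uniq by blast
    finally show ?thesis .
  next
    case False
    then show ?thesis by (auto simp: minpre_def)
  qed
qed

fun lab :: "nat \<Rightarrow> bool list \<Rightarrow> bool list option" where
  "lab 0 q = minpre q"
| "lab (Suc d) q = (case lab d (q @ [False]) of None \<Rightarrow> None
     | Some a \<Rightarrow> (case lab d (q @ [True]) of None \<Rightarrow> None | Some b \<Rightarrow> minpre (a @ b)))"

text \<open>Meaningful only if \<open>lab d q = None\<close>. This persists along the descent, and
  \<open>a @ b\<close> then has no preimage, since otherwise the node would be labelled.\<close>

fun gap :: "nat \<Rightarrow> bool list \<Rightarrow> bool list" where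
  "gap 0 q = q"
| "gap (Suc d) q = (case lab d (q @ [False]) of None \<Rightarrow> gap d (q @ [False])
     | Some a \<Rightarrow> (case lab d (q @ [True]) of None \<Rightarrow> gap d (q @ [True]) | Some b \<Rightarrow> a @ b))"

lemma length_lab: "lab d q = Some x \<Longrightarrow> length x = N"
  by (cases d) (auto simp: minpre_Some split: option.splits)

lemma gap_avoid:
  "lab d q = None \<Longrightarrow> length q + d = 2 * N \<Longrightarrow>
     length (gap d q) = 2 * N \<and> (\<forall>x. length x = N \<longrightarrow> F x \<noteq> gap d q)"
  by (induction d arbitrary: q) (auto simp: minpre_None length_lab split: option.splits)

text \<open>A node is labelled only if both children are, so all leaves below a labelled node are
  labelled, and the content of a leaf is its path.\<close>

lemma lab_leaf:
  "lab d q \<noteq> None \<Longrightarrow> length r = d \<Longrightarrow> \<exists>x. length x = N \<and> F x = q @ r"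
proof (induction d arbitrary: q r)
  case 0
  then show ?case by (auto simp: minpre_Some)
next
  case (Suc d)
  then obtain b r' where r: "r = b # r'" "length r' = d" by (cases r) auto
  have "lab d (q @ [b]) \<noteq> None" using Suc.prems(1) by (cases b) (auto split: option.splits)
  from Suc.IH[OF this r(2)] show ?case using r by simp
qed

text \<open>By counting: a labelled root would make all \<open>2 ^ (2 * N)\<close> leaf paths images
  of only \<open>2 ^ N\<close> strings.\<close>

lemma lab_root: "lab (2 * N) [] = None"
proof (rule ccontr)
  assume "lab (2 * N) [] \<noteq> None"
  from lab_leaf[OF this] have sub: "{y. length y = 2 * N} \<subseteq> F ` {x. length x = N}" by force
  have c: "card {x :: bool list. length x = m} = 2 ^ m" "finite {x :: bool list. length x = m}" for m
    using card_lists_length_eq[of "UNIV :: bool set" m] finite_lists_length_eq[of "UNIV :: bool set" m]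
    by simp_all
  have "(2::nat) ^ (2 * N) \<le> 2 ^ N"
    using surj_card_le[OF c(2) sub] by (simp add: c)
  with N_pos show False by simp
qed

section \<open>Certificates and refuters: soundness and completeness\<close>

definition half :: "bool \<Rightarrow> bool list \<Rightarrow> bool list" where
  "half b y = (if b then drop N y else take N y)"

lemma half_F: "length x = N \<Longrightarrow> length (half b (F x)) = N"
  by (simp add: half_def length_F)

text \<open>\<open>refin d q cur t x'\<close>: the refuter \<open>(t, x')\<close> rejects the claim that the node with path \<open>q\<close> and height \<open>d\<close> has
label \<open>cur\<close>.\<close>

fun refin :: "nat \<Rightarrow> bool list \<Rightarrow> bool list \<Rightarrow> bool list \<Rightarrow> bool list \<Rightarrow> bool" where
  "refin (Suc d) q cur (b # t) x' = refin d (q @ [b]) (half b (F cur)) t x'"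
| "refin d q cur t x' =
     ((F x' = F cur \<and> num (rev x') < num (rev cur)) \<or> (d = 0 \<and> F cur \<noteq> q))"

text \<open>The certificate \<open>p\<close> is a sequence of records \<open>True # u # L\<close> with a direction \<open>u\<close> and a string \<open>L\<close> of \<open>N\<close> bits,
which matters only for \<open>u = True\<close> and is then the label of the left sibling. The sequence ends with \<open>False\<close> or
at the depth of the leaves; the content of the node reached is claimed to be \<open>y\<close>.\<close>

fun ref :: "nat \<Rightarrow> bool list \<Rightarrow> bool list \<Rightarrow> bool list \<Rightarrow> bool list \<Rightarrow> bool list \<Rightarrow> bool" where
  "ref 0 q p y t x' = (F x' = y \<or> y \<noteq> q)"
| "ref (Suc d) q p y [] x' = ((p = [] \<or> \<not> hd p) \<and> F x' = y)"
| "ref (Suc d) q p y (b # t) x' =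
     (if p = [] \<or> \<not> hd p then refin d (q @ [b]) (half b y) t x'
      else if b = p ! 1 then ref d (q @ [b]) (drop (N + 2) p) y t x'
      else p ! 1 \<and> refin d (q @ [b]) (take N (drop 2 p)) t x')"

text \<open>A refuter against a child refutes the node once the direction is put in front, and the
  empty path tests minimality. Paths of length at most \<open>d\<close> suffice, which keeps
  refuters short.\<close>

lemma lab_if_not_refin:
  "length cur = N \<Longrightarrow> (\<And>t x'. length t \<le> d \<Longrightarrow> length x' = N \<Longrightarrow> \<not> refin d q cur t x')
    \<Longrightarrow> lab d q = Some cur"
proof (induction d arbitrary: q cur)
  case 0
  have "\<not> refin 0 q cur [] x'" if "length x' = N" for x' using 0 that by blast
  then show ?case using 0(1) by (auto simp: minpre_Some)
next
  case (Suc d)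
  have sub: "lab d (q @ [b]) = Some (half b (F cur))" for b
  proof (rule Suc.IH)
    fix t x' :: "bool list" assume "length t \<le> d" "length x' = N"
    then show "\<not> refin d (q @ [b]) (half b (F cur)) t x'" using Suc.prems(2)[of "b # t" x'] by simp
  qed (simp add: half_F Suc.prems)
  have "\<not> refin (Suc d) q cur [] x'" if "length x' = N" for x' using Suc.prems(2)[of "[]"] that by simp
  then have "minpre (F cur) = Some cur" using Suc.prems(1) by (auto simp: minpre_Some)
  then show ?case using sub by (simp add: half_def)
qed

text \<open>Expanding a true label gives true labels: \<open>F cur\<close> is the concatenation of
  the labels of the children, so its halves are these labels and the walk never meets a false
  claim.\<close>

lemma not_refin_if_lab:
  "lab d q = Some cur \<Longrightarrow> length x' = N \<Longrightarrow> \<not> refin d q cur t x'"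
proof (induction d arbitrary: q cur t)
  case 0
  then show ?case by (auto simp: minpre_Some)
next
  case (Suc d)
  then obtain a b where ab: "lab d (q @ [False]) = Some a" "lab d (q @ [True]) = Some b"
    "minpre (a @ b) = Some cur" by (auto split: option.splits)
  then have "F cur = a @ b" by (simp add: minpre_Some)
  then have h: "half c (F cur) = (if c then b else a)" for c
    using length_lab[OF ab(1)] by (simp add: half_def)
  show ?case
  proof (cases t)
    case Nil
    then show ?thesis using ab(3) Suc.prems(2) by (auto simp: minpre_Some)
  next
    case (Cons c t')
    then show ?thesis using Suc.IH ab h Suc.prems(2) by (cases c) auto
  qed
qed

text \<open>Soundness. That the node is unlabelled is part of the conclusion because at a turn it is
  inherited from the child; at a right turn the recorded label proves the left child labelled, so
  \<open>gap\<close> turns right as well. The bound on \<open>length p\<close> makes every record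
  complete.\<close>

lemma gap_if_not_ref:
  "length y = 2 * N \<Longrightarrow> d * (N + 2) \<le> length p \<Longrightarrow>
   (\<And>t x'. length t \<le> d \<Longrightarrow> length x' = N \<Longrightarrow> \<not> ref d q p y t x') \<Longrightarrow>
   lab d q = None \<and> y = gap d q"
proof (induction d arbitrary: q p)
  case 0
  have "\<not> ref 0 q p y [] x'" if "length x' = N" for x' using 0 that by blast
  \<comment> \<open>Some refuter string has to exist before \<open>y = q\<close> can be drawn from
    the failure of all of them.\<close>
  moreover obtain x' :: "bool list" where "length x' = N" using Ex_list_of_length by blast
  ultimately show ?case by (auto simp: minpre_None)
next
  case (Suc d)
  show ?case
  proof (cases "p = [] \<or> \<not> hd p")
    case True
    have "lab d (q @ [b]) = Some (half b y)" for b
    proof (rule lab_if_not_refin)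
      fix t x' :: "bool list" assume "length t \<le> d" "length x' = N"
      then show "\<not> refin d (q @ [b]) (half b y) t x'" using Suc.prems(3)[of "b # t" x'] True by simp
    qed (simp add: half_def Suc.prems)
    moreover have "minpre y = None" unfolding minpre_None
      using Suc.prems(3)[of "[]"] True by auto
    ultimately show ?thesis by (simp add: half_def)
  next
    case False
    define u where "u = p ! 1"
    have same: "lab d (q @ [u]) = None \<and> y = gap d (q @ [u])"
    proof (rule Suc.IH)
      fix t x' :: "bool list" assume "length t \<le> d" "length x' = N"
      then show "\<not> ref d (q @ [u]) (drop (N + 2) p) y t x'"
        using Suc.prems(3)[of "u # t" x'] False by (simp add: u_def)
    qed (use Suc.prems in auto)
    show ?thesis
    proof (cases u)
      case True
      have "lab d (q @ [False]) = Some (take N (drop 2 p))"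
      proof (rule lab_if_not_refin)
        fix t x' :: "bool list" assume "length t \<le> d" "length x' = N"
        then show "\<not> refin d (q @ [False]) (take N (drop 2 p)) t x'"
          using Suc.prems(3)[of "False # t" x'] False True by (simp add: u_def)
      qed (use Suc.prems(2) in simp)
      then show ?thesis using same True by simp
    next
      case u: False
      then show ?thesis using same by simp
    qed
  qed
qed

text \<open>Completeness: \<open>p\<close> records the turns of \<open>gap\<close> and the true
  labels of the left siblings at right turns. Its length is always that of a descent to a leaf, an
  early end being filled with \<open>False\<close>, and \<open>z\<close> leaves room for
  padding.\<close>

lemma ex_not_ref:
  "lab d q = None \<Longrightarrow> length q + d = 2 * N \<Longrightarrow>
   \<exists>p. length p = d * (N + 2) \<and> (\<forall>t x' z. length x' = N \<longrightarrow> \<not> ref d q (p @ z) (gap d q) t x')"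
proof (induction d arbitrary: q)
  case 0
  then show ?case by (auto simp: minpre_None)
next
  case (Suc d)
  note av = gap_avoid[OF Suc.prems]
  consider (l) "lab d (q @ [False]) = None"
    | (r) a where "lab d (q @ [False]) = Some a" "lab d (q @ [True]) = None"
    | (e) a b where "lab d (q @ [False]) = Some a" "lab d (q @ [True]) = Some b"
    by (cases "lab d (q @ [False])"; cases "lab d (q @ [True])") auto
  then show ?case
  proof cases
    case l
    from Suc.IH[OF l] Suc.prems obtain p where p: "length p = d * (N + 2)"
      "\<And>t x' z. length x' = N \<Longrightarrow> \<not> ref d (q @ [False]) (p @ z) (gap d (q @ [False])) t x'" by auto
    have "\<not> ref (Suc d) q ((True # False # replicate N False @ p) @ z) (gap (Suc d) q) t x'"
      if "length x' = N" for t x' z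
      using p(2)[OF that] l that av by (cases t) (auto)
    moreover have "length (True # False # replicate N False @ p) = Suc d * (N + 2)" by (simp add: p)
    ultimately show ?thesis by blast
  next
    case r
    from Suc.IH[OF r(2)] Suc.prems obtain p where p: "length p = d * (N + 2)"
      "\<And>t x' z. length x' = N \<Longrightarrow> \<not> ref d (q @ [True]) (p @ z) (gap d (q @ [True])) t x'" by auto
    have la: "length a = N" using length_lab[OF r(1)] .
    have "\<not> ref (Suc d) q ((True # True # a @ p) @ z) (gap (Suc d) q) t x'"
      if "length x' = N" for t x' z
      using p(2)[OF that] r that av not_refin_if_lab[OF r(1) that] la by (cases t) (auto)
    moreover have "length (True # True # a @ p) = Suc d * (N + 2)" by (simp add: p la)
    ultimately show ?thesis by blast
  next
    case e
    have la: "length a = N" using length_lab[OF e(1)] .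
    have "\<not> ref (Suc d) q (replicate (Suc d * (N + 2)) False @ z) (gap (Suc d) q) t x'"
      if "length x' = N" for t x' z
    proof (cases t)
      case Nil
      then show ?thesis using av that by auto
    next
      case (Cons c t')
      then show ?thesis using e la not_refin_if_lab[OF e(1) that] not_refin_if_lab[OF e(2) that]
        by (cases c) (auto simp: half_def)
    qed
    then show ?thesis by (intro exI[of _ "replicate (Suc d * (N + 2)) False"]) auto
  qed
qed

end

section \<open>Turing machines\<close>

subsection \<open>Polynomials\<close>

text \<open>In this form sums and products of polynomials are recursions on the coefficient
  lists.\<close>

fun horner :: "nat list \<Rightarrow> nat \<Rightarrow> nat" where
  "horner [] n = 0"
| "horner (c # cs) n = c + n * horner cs n"

lemma horner_sum: "horner cs n = (\<Sum>i<length cs. cs ! i * n ^ i)"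
proof (induction cs)
  case (Cons c cs)
  have "(\<Sum>i<length (c # cs). (c # cs) ! i * n ^ i) = c + (\<Sum>i<length cs. cs ! i * n ^ Suc i)"
    by (simp only: length_Cons sum.lessThan_Suc_shift) simp
  also have "(\<Sum>i<length cs. cs ! i * n ^ Suc i) = n * (\<Sum>i<length cs. cs ! i * n ^ i)"
    by (simp add: sum_distrib_left mult.left_commute)
  finally show ?case using Cons by simp
qed simp

lemma poly_fun_horner: "poly_fun p \<longleftrightarrow> (\<exists>cs. p = horner cs)"
  by (auto simp: poly_fun_def horner_sum fun_eq_iff)

lemma horner_scale: "horner (map ((*) a) cs) n = a * horner cs n"
  by (induction cs) (auto simp: algebra_simps)

lemma horner_add: "\<exists>es. \<forall>n. horner es n = horner cs n + horner ds n"
proof (induction cs arbitrary: ds)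
  case Nil
  then show ?case by auto
next
  case (Cons c cs)
  show ?case
  proof (cases ds)
    case Nil
    then show ?thesis by (intro exI[of _ "c # cs"]) simp
  next
    case D: (Cons d ds')
    obtain es where "\<forall>n. horner es n = horner cs n + horner ds' n" using Cons.IH by blast
    then show ?thesis by (intro exI[of _ "(c + d) # es"]) (simp add: D algebra_simps)
  qed
qed

lemma horner_mult: "\<exists>es. \<forall>n. horner es n = horner cs n * horner ds n"
proof (induction cs)
  case Nil
  show ?case by (intro exI[of _ "[]"]) simp
next
  case (Cons c cs)
  then obtain es where es: "\<forall>n. horner es n = horner cs n * horner ds n" by blast
  obtain fs where "\<forall>n. horner fs n = horner (map ((*) c) ds) n + horner (0 # es) n"
    using horner_add by blast
  then show ?case by (intro exI[of _ fs]) (simp add: es horner_scale algebra_simps)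
qed

lemma poly_fun_const: "poly_fun (\<lambda>n. c)"
  unfolding poly_fun_horner by (rule exI[of _ "[c]"]) auto

lemma poly_fun_id: "poly_fun (\<lambda>n. n)"
  unfolding poly_fun_horner by (rule exI[of _ "[0, 1]"]) auto

lemma poly_fun_add: "poly_fun p \<Longrightarrow> poly_fun q \<Longrightarrow> poly_fun (\<lambda>n. p n + q n)"
  unfolding poly_fun_horner fun_eq_iff using horner_add by metis

lemma poly_fun_mult: "poly_fun p \<Longrightarrow> poly_fun q \<Longrightarrow> poly_fun (\<lambda>n. p n * q n)"
  unfolding poly_fun_horner fun_eq_iff using horner_mult by metis

lemmas poly_fun_intros = poly_fun_const poly_fun_id poly_fun_add poly_fun_mult

lemma poly_fun_mono: "poly_fun p \<Longrightarrow> m \<le> n \<Longrightarrow> p m \<le> p n"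
proof -
  assume mn: "m \<le> n"
  have "horner cs m \<le> horner cs n" for cs
    by (induction cs) (auto intro: add_mono mult_mono mn)
  then show "poly_fun p \<Longrightarrow> p m \<le> p n" by (auto simp: poly_fun_horner)
qed

subsection \<open>Runs on a two-sided tape\<close>

text \<open>The list \<open>l\<close> holds the cells to the left of the head, nearest first, followed by blanks
only; \<open>r\<close> holds an initial part of the cells from the head rightwards.\<close>

definition tape_is :: "(int \<Rightarrow> sym) \<Rightarrow> int \<Rightarrow> sym list \<Rightarrow> sym list \<Rightarrow> bool" where
  "tape_is tape h l r \<longleftrightarrow>
     (\<forall>i. tape (h - 1 - int i) = (if i < length l then l ! i else Blank)) \<and>
     (\<forall>i<length r. tape (h + int i) = r ! i)"

lemma tape_is_read: "tape_is tape h l (x # r) \<Longrightarrow> tape h = x"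
  by (force simp: tape_is_def)

lemma tape_is_write: "tape_is tape h l (x # r) \<Longrightarrow> tape_is (tape(h := y)) h l (y # r)"
  by (auto simp: tape_is_def nth_Cons split: nat.splits)

lemma tape_is_shift_left: "tape_is tape h (a # l) r \<Longrightarrow> tape_is tape (h - 1) l (a # r)"
  unfolding tape_is_def
proof (intro conjI allI impI; elim conjE)
  fix i
  assume a: "\<forall>i. tape (h - 1 - int i) = (if i < length (a # l) then (a # l) ! i else Blank)"
  show "tape (h - 1 - 1 - int i) = (if i < length l then l ! i else Blank)"
    using a[rule_format, of "Suc i"] by (simp add: algebra_simps)
next
  fix i
  assume a: "\<forall>i. tape (h - 1 - int i) = (if i < length (a # l) then (a # l) ! i else Blank)"
    and r: "\<forall>i<length r. tape (h + int i) = r ! i" and i: "i < length (a # r)"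
  show "tape (h - 1 + int i) = (a # r) ! i"
    using a[rule_format, of 0] r[rule_format, of "i - 1"] i
    by (cases i) (auto simp: algebra_simps)
qed

lemma tape_is_shift_right: "tape_is tape h l (a # r) \<Longrightarrow> tape_is tape (h + 1) (a # l) r"
  unfolding tape_is_def
proof (intro conjI allI impI; elim conjE)
  fix i
  assume a: "\<forall>i. tape (h - 1 - int i) = (if i < length l then l ! i else Blank)"
    and r: "\<forall>i<length (a # r). tape (h + int i) = (a # r) ! i"
  show "tape (h + 1 - 1 - int i) = (if i < length (a # l) then (a # l) ! i else Blank)"
    using a[rule_format, of "i - 1"] r[rule_format, of 0] by (cases i) (auto simp: algebra_simps)
next
  fix i
  assume r: "\<forall>i<length (a # r). tape (h + int i) = (a # r) ! i" and i: "i < length r"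
  show "tape (h + 1 + int i) = r ! i"
    using r[rule_format, of "Suc i"] i by (auto simp: algebra_simps)
qed

lemma tape_is_blank: "tape_is tape h (l @ [Blank]) r \<longleftrightarrow> tape_is tape h l r"
proof -
  have "(if i < length (l @ [Blank]) then (l @ [Blank]) ! i else Blank) =
    (if i < length l then l ! i else Blank)" for i
    by (auto simp: nth_append)
  then show ?thesis unfolding tape_is_def by simp
qed

lemma tape_is_nil: "tape_is tape h [] r \<longleftrightarrow> tape_is tape h [Blank] r"
  using tape_is_blank[of tape h "[]" r] by simp

type_synonym 'q delta = "'q \<Rightarrow> sym \<Rightarrow> 'q \<times> sym \<times> dir"

text \<open>No state halts here; accepting and rejecting states are fixed points of the transition
  function instead, which spares a case distinction in composing runs.\<close>

definition tstep :: "'q delta \<Rightarrow> 'q \<times> (int \<Rightarrow> sym) \<times> int \<Rightarrow> 'q \<times> (int \<Rightarrow> sym) \<times> int" where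
  "tstep \<delta> c = (case c of (q, tape, h) \<Rightarrow>
     (case \<delta> q (tape h) of (q', s', d) \<Rightarrow> (q', tape(h := s'), mv d h)))"

text \<open>The claim covers every tape fitting the description and only bounds the number of steps,
  so runs compose by adding bounds.\<close>

definition reach :: "'q delta \<Rightarrow> 'q \<times> sym list \<times> sym list \<Rightarrow> nat \<Rightarrow> 'q \<times> sym list \<times> sym list \<Rightarrow> bool" where
  "reach \<delta> c T c' \<longleftrightarrow> (\<forall>tape h. tape_is tape h (fst (snd c)) (snd (snd c)) \<longrightarrow>
     (\<exists>t\<le>T. \<exists>tape' h'. tape_is tape' h' (fst (snd c')) (snd (snd c')) \<and>
        (tstep \<delta> ^^ t) (fst c, tape, h) = (fst c', tape', h')))"

lemma reach_refl: "reach \<delta> c T c"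
  unfolding reach_def by (intro allI impI exI[of _ 0]) auto

lemma reach_trans:
  assumes "reach \<delta> a T b" "reach \<delta> b U c" shows "reach \<delta> a (T + U) c"
  unfolding reach_def
proof (intro allI impI)
  fix tape h assume "tape_is tape h (fst (snd a)) (snd (snd a))"
  then obtain t tape' h' where 1: "t \<le> T" "tape_is tape' h' (fst (snd b)) (snd (snd b))"
    "(tstep \<delta> ^^ t) (fst a, tape, h) = (fst b, tape', h')"
    using assms(1) unfolding reach_def by blast
  then obtain u tape'' h'' where 2: "u \<le> U" "tape_is tape'' h'' (fst (snd c)) (snd (snd c))"
    "(tstep \<delta> ^^ u) (fst b, tape', h') = (fst c, tape'', h'')"
    using assms(2) unfolding reach_def by blast
  have "(tstep \<delta> ^^ (u + t)) (fst a, tape, h) = (fst c, tape'', h'')"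
    by (simp only: funpow_add comp_def 1 2)
  then show "\<exists>t\<le>T + U. \<exists>tape' h'. tape_is tape' h' (fst (snd c)) (snd (snd c)) \<and>
      (tstep \<delta> ^^ t) (fst a, tape, h) = (fst c, tape', h')"
    using 1 2 by (intro exI[of _ "u + t"]) auto
qed

lemma reach_mono: "reach \<delta> a T b \<Longrightarrow> T \<le> U \<Longrightarrow> reach \<delta> a U b"
  unfolding reach_def by (meson le_trans)

lemma reach_step:
  assumes "reach \<delta> a 1 b" "reach \<delta> b T c" "Suc T \<le> U" shows "reach \<delta> a U c"
  by (rule reach_mono[OF reach_trans[OF assms(1,2)]]) (use assms(3) in simp)

lemma reach_one:
  assumes "\<delta> q x = (q', y, d)"
    and "\<And>tape h. tape_is tape h l (y # r) \<Longrightarrow> tape_is tape (mv d h) l' r'"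
  shows "reach \<delta> (q, l, x # r) 1 (q', l', r')"
  unfolding reach_def
proof (intro allI impI)
  fix tape h assume a: "tape_is tape h (fst (snd (q, l, x # r))) (snd (snd (q, l, x # r)))"
  then have "tape h = x" by (simp add: tape_is_read)
  moreover have "tape_is (tape(h := y)) (mv d h) l' r'"
    using a by (auto intro: assms(2) tape_is_write)
  ultimately show "\<exists>t\<le>1. \<exists>tape' h'. tape_is tape' h' (fst (snd (q', l', r'))) (snd (snd (q', l', r'))) \<and>
      (tstep \<delta> ^^ t) (fst (q, l, x # r), tape, h) = (fst (q', l', r'), tape', h')"
    by (intro exI[of _ 1]) (simp add: tstep_def assms(1))
qed

lemma reach_Lft: "\<delta> q x = (q', y, Lft) \<Longrightarrow> reach \<delta> (q, a # l, x # r) 1 (q', l, a # y # r)"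
  by (rule reach_one) (auto simp: mv_def intro: tape_is_shift_left)

lemma reach_Lft_nil: "\<delta> q x = (q', y, Lft) \<Longrightarrow> reach \<delta> (q, [], x # r) 1 (q', [], Blank # y # r)"
  by (rule reach_one) (auto simp: mv_def tape_is_nil[of _ _ "y # r"] intro: tape_is_shift_left)

lemma reach_Rgt: "\<delta> q x = (q', y, Rgt) \<Longrightarrow> reach \<delta> (q, l, x # r) 1 (q', y # l, r)"
  by (rule reach_one) (auto simp: mv_def intro: tape_is_shift_right)

lemma reach_Stay: "\<delta> q x = (q', y, Stay) \<Longrightarrow> reach \<delta> (q, l, x # r) 1 (q', l, y # r)"
  by (rule reach_one) (auto simp: mv_def)

lemma reach_blank: "reach \<delta> (q, l @ [Blank], r) T c \<longleftrightarrow> reach \<delta> (q, l, r) T c"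
  by (simp add: reach_def tape_is_blank)

lemma reach_blank': "reach \<delta> c T (q, l @ [Blank], r) \<longleftrightarrow> reach \<delta> c T (q, l, r)"
  by (simp add: reach_def tape_is_blank)

subsection \<open>Renaming states by natural numbers\<close>

text \<open>The machine model wants states below a number, with 0, 1, 2 reserved; all other states
  are numbered from 3 on. \<open>Q\<close> is a finite closed subset because the state type used
  below is infinite.\<close>

lemma ex_tm:
  fixes \<delta> :: "'q delta"
  assumes fin: "finite Q" and in_Q: "a \<in> Q" "b \<in> Q" "c \<in> Q" and ne: "a \<noteq> b" "a \<noteq> c" "b \<noteq> c"
    and closed: "\<And>q s. q \<in> Q \<Longrightarrow> fst (\<delta> q s) \<in> Q"
  shows "\<exists>M f. tm_wf M \<and> inj_on f Q \<and> f a = 0 \<and> f b = 1 \<and> f c = 2 \<and>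
    (\<forall>q\<in>Q. \<forall>s. snd M (f q) s = (f (fst (\<delta> q s)), snd (\<delta> q s)))"
proof -
  obtain g where g: "bij_betw g (Q - {a, b, c}) {0..<card (Q - {a, b, c})}"
    using ex_bij_betw_finite_nat fin by blast
  let ?n = "card (Q - {a, b, c})"
  define f where "f q = (if q = a then 0 else if q = b then 1 else if q = c then 2 else g q + 3)" for q
  have inj: "inj_on f Q"
  proof (rule inj_onI)
    fix x y assume "x \<in> Q" "y \<in> Q" "f x = f y"
    then have "(x \<notin> {a, b, c} \<and> y \<notin> {a, b, c} \<and> g x = g y) \<or> x = y"
      by (simp add: f_def split: if_splits)
    then show "x = y"
      using inj_on_eq_iff[OF bij_betw_imp_inj_on[OF g], of x y] \<open>x \<in> Q\<close> \<open>y \<in> Q\<close> by blast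
  qed
  have lt: "f q < ?n + 3" if "q \<in> Q" for q
  proof (cases "q \<in> {a, b, c}")
    case False
    then have "g q \<in> {0..<?n}" using bij_betw_apply[OF g] that by blast
    with False show ?thesis by (simp add: f_def)
  qed (auto simp: f_def)
  \<comment> \<open>Numbers that name no state of \<open>Q\<close> go to state 0, which keeps the
    table well formed.\<close>
  define D where "D m s = (if m \<in> f ` Q then (f (fst (\<delta> (inv_into Q f m) s)), snd (\<delta> (inv_into Q f m) s))
    else (0, s, Stay))" for m s
  have "fst (D m s) < ?n + 3" for m s
  proof (cases "m \<in> f ` Q")
    case True
    then show ?thesis using lt[OF closed[OF inv_into_into[OF True]]] by (simp add: D_def)
  qed (simp add: D_def)
  then have 1: "tm_wf (?n + 3, D)" by (simp add: tm_wf_def)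
  have 2: "\<forall>q\<in>Q. \<forall>s. snd (?n + 3, D) (f q) s = (f (fst (\<delta> q s)), snd (\<delta> q s))"
    using inv_into_f_f[OF inj] by (simp add: D_def)
  have 3: "f a = 0" "f b = 1" "f c = 2" using ne by (simp_all add: f_def)
  show ?thesis
    by (rule exI[of _ "(?n + 3, D)"], rule exI[of _ f]) (intro conjI 1 2 3 inj)
qed

subsection \<open>A while language over stacks of bits\<close>

datatype mcmd = MNop | MPush nat bool | MCase nat mcmd mcmd mcmd | MSeq mcmd mcmd
  | MWhile nat mcmd mcmd

fun regs_below :: "nat \<Rightarrow> mcmd \<Rightarrow> bool" where
  "regs_below k MNop = True"
| "regs_below k (MPush i b) = (i < k)"
| "regs_below k (MCase i e z u) = (i < k \<and> regs_below k e \<and> regs_below k z \<and> regs_below k u)"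
| "regs_below k (MSeq a b) = (regs_below k a \<and> regs_below k b)"
| "regs_below k (MWhile i z u) = (i < k \<and> regs_below k z \<and> regs_below k u)"

type_synonym store = "nat \<Rightarrow> bool list"

text \<open>One unit per instruction, so that the time also bounds the growth of the store
  (\<open>store_size_exec\<close>) and thereby the length of the tape.\<close>

inductive exec :: "mcmd \<Rightarrow> store \<Rightarrow> nat \<Rightarrow> store \<Rightarrow> bool" where
  exec_Nop: "exec MNop s 1 s"
| exec_Push: "exec (MPush i b) s 1 (s(i := b # s i))"
| exec_Seq: "exec a s t s' \<Longrightarrow> exec b s' u s'' \<Longrightarrow> exec (MSeq a b) s (t + u + 1) s''"
| exec_Case_Nil: "s i = [] \<Longrightarrow> exec e s t s' \<Longrightarrow> exec (MCase i e z u) s (t + 1) s'"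
| exec_Case_Cons: "s i = b # r \<Longrightarrow> exec (if b then u else z) (s(i := r)) t s' \<Longrightarrow>
    exec (MCase i e z u) s (t + 1) s'"
| exec_While_Nil: "s i = [] \<Longrightarrow> exec (MWhile i z u) s 1 s"
| exec_While_Cons: "s i = b # r \<Longrightarrow> exec (if b then u else z) (s(i := r)) t s' \<Longrightarrow>
    exec (MWhile i z u) s' t' s'' \<Longrightarrow> exec (MWhile i z u) s (t + t' + 1) s''"

definition store_size :: "nat \<Rightarrow> store \<Rightarrow> nat" where
  "store_size k s = (\<Sum>i<k. length (s i))"

lemma store_size_upd:
  assumes "i < k" shows "store_size k (s(i := r)) + length (s i) = store_size k s + length r"
proof -
  have "store_size k s' = length (s' i) + (\<Sum>j\<in>{..<k} - {i}. length (s' j))" for s' :: store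
    using assms by (simp add: store_size_def sum.remove)
  from this[of s] this[of "s(i := r)"] show ?thesis by simp
qed

lemma store_size_exec: "exec c s t s' \<Longrightarrow> regs_below k c \<Longrightarrow> store_size k s' \<le> store_size k s + t"
proof (induction rule: exec.induct)
  case (exec_Push i b s)
  then show ?case using store_size_upd[of i k s "b # s i"] by (simp del: fun_upd_apply)
next
  case (exec_Case_Cons s i b r u z t s' e)
  then show ?case using store_size_upd[of i k s r] by (cases b) (auto simp del: fun_upd_apply)
next
  case (exec_While_Cons s i b r u z t s' t' s'')
  then show ?case using store_size_upd[of i k s r] by (cases b) (auto simp del: fun_upd_apply)
qed auto

subsection \<open>The machine of a while program\<close>

text \<open>Between two instructions the head is on the blank to the right of the stacks, which extend
leftwards from there (top first) and are each closed by a separator; the tape grows to the left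
only, so that whatever the input contains beyond its first blank is never visited.
\<open>Cmd K\<close> first returns to that position and then executes the list \<open>K\<close> of commands.\<close>

datatype mstate = Start | Pre nat | Scan nat | Cmd "mcmd list" | Push nat bool "mcmd list"
  | Ins sym "mcmd list" | Pop nat "mcmd list" "mcmd list" "mcmd list"
  | Del1 "mcmd list" | Del2 "mcmd list" | Del3 sym "mcmd list" | Fin1 | Fin2 | Acc | Rej

text \<open>\<open>Pre\<close> writes \<open>k - 2\<close> separators to the left of the input; with
  the two of a well-formed input they close \<open>k\<close> stacks, and \<open>Scan\<close> rejects
  any other count. \<open>Push\<close> and \<open>Ins\<close> insert a bit by shifting the deeper
  cells left, \<open>Pop\<close> and \<open>Del1\<close> to \<open>Del3\<close> remove one by
  shifting them right. \<open>Fin1\<close> rejects if stack 0 is empty; \<open>Fin2\<close> walks to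
  its bottom, where the output starts.\<close>

fun mdelta :: "nat \<Rightarrow> mcmd \<Rightarrow> mstate delta" where
  "mdelta k p Start s = (Pre (k - 2), s, Lft)"
| "mdelta k p (Pre 0) s = (Scan 0, Blank, Rgt)"
| "mdelta k p (Pre (Suc j)) s = (Pre j, Sep, Lft)"
| "mdelta k p (Scan j) s = (case s of
      Blank \<Rightarrow> (if j = k then (Cmd [p], Blank, Stay) else (Rej, Blank, Stay))
    | Sep \<Rightarrow> (if j < k then (Scan (Suc j), Sep, Rgt) else (Rej, Sep, Stay))
    | _ \<Rightarrow> (Scan j, s, Rgt))"
| "mdelta k p (Cmd K) s = (if s \<noteq> Blank then (Cmd K, s, Rgt) else (case K of
      [] \<Rightarrow> (Fin1, Blank, Lft)
    | MNop # K' \<Rightarrow> (Cmd K', Blank, Stay)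
    | MPush i b # K' \<Rightarrow> (Push i b K', Blank, Lft)
    | MCase i e z u # K' \<Rightarrow> (Pop i (e # K') (z # K') (u # K'), Blank, Lft)
    | MSeq a b # K' \<Rightarrow> (Cmd (a # b # K'), Blank, Stay)
    | MWhile i z u # K' \<Rightarrow> (Pop i K' (z # K) (u # K), Blank, Lft)))"
| "mdelta k p (Push (Suc j) b K) s = (Push (if s = Sep then j else Suc j) b K, s, Lft)"
| "mdelta k p (Push 0 b K) s =
    (if s = Blank then (Cmd K, sym_of_bool b, Stay) else (Ins s K, sym_of_bool b, Lft))"
| "mdelta k p (Ins c K) s = (if s = Blank then (Cmd K, c, Stay) else (Ins s K, c, Lft))"
| "mdelta k p (Pop (Suc j) E Z U) s = (Pop (if s = Sep then j else Suc j) E Z U, s, Lft)"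
| "mdelta k p (Pop 0 E Z U) s = (case s of Zero \<Rightarrow> (Del1 Z, s, Stay) | One \<Rightarrow> (Del1 U, s, Stay)
    | _ \<Rightarrow> (Cmd E, s, Rgt))"
| "mdelta k p (Del1 K) s = (Del2 K, s, Lft)"
| "mdelta k p (Del2 K) s = (Del3 s K, s, Rgt)"
| "mdelta k p (Del3 c K) s = (if c = Blank then (Cmd K, Blank, Rgt) else (Del1 K, c, Lft))"
| "mdelta k p Fin1 s = (if s \<in> {Zero, One} then (Fin2, s, Lft) else (Rej, s, Stay))"
| "mdelta k p Fin2 s = (if s \<in> {Zero, One} then (Fin2, s, Lft) else (Acc, s, Rgt))"
| "mdelta k p Acc s = (Acc, s, Stay)"
| "mdelta k p Rej s = (Rej, s, Stay)"

lemma sym_of_bool_simps [simp]: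
  "sym_of_bool b \<noteq> Blank" "sym_of_bool b \<noteq> Sep" "Blank \<noteq> sym_of_bool b" "Sep \<noteq> sym_of_bool b"
  "sym_of_bool b = One \<longleftrightarrow> b" "sym_of_bool b = Zero \<longleftrightarrow> \<not> b"
  by (auto simp: sym_of_bool_def)

definition blocks :: "bool list list \<Rightarrow> sym list" where
  "blocks rs = concat (map (\<lambda>r. map sym_of_bool r @ [Sep]) rs)"

lemma blocks_simps [simp]: "blocks [] = []" "blocks (r # rs) = map sym_of_bool r @ Sep # blocks rs"
  "blocks (rs @ ts) = blocks rs @ blocks ts"
  by (simp_all add: blocks_def)

lemma blocks_nonblank: "Blank \<notin> set (blocks rs)"
  by (induction rs) auto

definition cells :: "nat \<Rightarrow> store \<Rightarrow> sym list" where
  "cells k s = blocks (map s [0..<k])"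

lemma length_cells: "length (cells k s) = store_size k s + k"
  by (induction k) (auto simp: cells_def store_size_def)

lemma cells_split:
  assumes "i < k"
  shows "\<exists>B. cells k (s(i := r)) = blocks (map s [0..<i]) @ map sym_of_bool r @ Sep # B \<and>
    cells k s = blocks (map s [0..<i]) @ map sym_of_bool (s i) @ Sep # B"
proof -
  have k: "[0..<k] = [0..<i] @ i # [Suc i..<k]"
    using assms by (metis le_add_diff_inverse less_imp_le upt_add_eq_append upt_conv_Cons zero_le)
  have "map (s(i := r)) [0..<i] = map s [0..<i]" "map (s(i := r)) [Suc i..<k] = map s [Suc i..<k]"
    by auto
  then show ?thesis by (simp add: cells_def k)
qed

lemma reach_return:
  "Blank \<notin> set R \<Longrightarrow> reach (mdelta k p) (Cmd K, l, R @ Blank # r) (length R) (Cmd K, rev R @ l, Blank # r)"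
proof (induction R arbitrary: l)
  case Nil
  then show ?case by (simp add: reach_refl)
next
  case (Cons x R)
  have "reach (mdelta k p) (Cmd K, l, x # R @ Blank # r) 1 (Cmd K, x # l, R @ Blank # r)"
    using Cons.prems by (intro reach_Rgt) auto
  from reach_step[OF this Cons.IH] Cons.prems show ?case by simp
qed

text \<open>Here and below a configuration \<open>(q, tl M, hd M # R)\<close> has the cells \<open>M\<close> from the head leftwards.\<close>

lemma reach_skip_block:
  assumes "\<And>s. \<delta> q s = (if s = Sep then q' else q, s, Lft)" and "M \<noteq> []"
  shows "reach \<delta> (q, tl (map sym_of_bool xs @ Sep # M), hd (map sym_of_bool xs @ Sep # M) # R)
    (length xs + 1) (q', tl M, hd M # Sep # rev (map sym_of_bool xs) @ R)"
proof (induction xs arbitrary: R)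
  case Nil
  obtain m M' where "M = m # M'" using assms(2) by (cases M) auto
  then show ?case using reach_Lft[of \<delta> q Sep q' Sep m M' R] assms(1) by simp
next
  case (Cons b xs)
  obtain m M' where m: "map sym_of_bool xs @ Sep # M = m # M'" by (cases xs) auto
  have "reach \<delta> (q, m # M', sym_of_bool b # R) 1 (q, M', m # sym_of_bool b # R)"
    using assms(1) by (intro reach_Lft) simp
  from reach_step[OF this, of "length xs + 1"] Cons.IH[of "sym_of_bool b # R"] show ?case
    by (simp add: m)
qed

lemma reach_skip_blocks:
  assumes "\<And>j s. \<delta> (Q (Suc j)) s = (if s = Sep then Q j else Q (Suc j), s, Lft)" and "M \<noteq> []"
  shows "reach \<delta> (Q (length rs), tl (blocks rs @ M), hd (blocks rs @ M) # R) (length (blocks rs))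
    (Q 0, tl M, hd M # rev (blocks rs) @ R)"
proof (induction rs arbitrary: R)
  case Nil
  then show ?case by (simp add: reach_refl)
next
  case (Cons r rs)
  have "blocks rs @ M \<noteq> []" using assms(2) by simp
  from reach_trans[OF reach_skip_block[where \<delta> = \<delta> and q = "Q (Suc (length rs))" and q' = "Q (length rs)", OF assms(1) this, of r R] Cons.IH] show ?case
    by simp
qed

text \<open>The state carries the displaced symbol. The state \<open>q\<close> is general so that
  \<open>Push 0 b K\<close>, which inserts the new bit, can start the shift.\<close>

lemma reach_Ins:
  assumes "\<And>s. \<delta> q s = (if s = Blank then (Cmd K, c, Stay) else (Ins s K, c, Lft))"
    "\<And>c s. \<delta> (Ins c K) s = (if s = Blank then (Cmd K, c, Stay) else (Ins s K, c, Lft))"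
    "Blank \<notin> set M"
  shows "reach \<delta> (q, tl (M @ [Blank]), hd (M @ [Blank]) # R) (length M + 1) (Cmd K, [], rev (c # M) @ R)"
  using assms(1,3)
proof (induction M arbitrary: q c R)
  case Nil
  then show ?case using reach_Stay[of \<delta> q Blank "Cmd K" c "[]" R] by simp
next
  case (Cons a M)
  obtain m M' where m: "M @ [Blank] = m # M'" by (cases M) auto
  have "reach \<delta> (q, m # M', a # R) 1 (Ins a K, M', m # c # R)"
    using Cons.prems by (intro reach_Lft) auto
  moreover have "reach \<delta> (Ins a K, M', m # c # R) (length M + 1) (Cmd K, [], rev (a # M) @ c # R)"
    using Cons.IH[of "Ins a K" a "c # R"] Cons.prems assms(2) m by simp
  ultimately show ?case using reach_step[of \<delta> _ _ "length M + 1"] m by simp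
qed

text \<open>Each cell fetches its left neighbour by a step left, a step right and a step on to the
  left, hence three moves per cell; fetching a blank ends the shift.\<close>

lemma reach_Del:
  "Blank \<notin> set l \<Longrightarrow> reach (mdelta k p) (Del1 K, l, x # R) (3 * (length l + 1)) (Cmd K, [], rev l @ R)"
proof (induction l arbitrary: x R)
  case Nil
  have "reach (mdelta k p) (Del1 K, [], x # R) 1 (Del2 K, [], Blank # x # R)"
    by (rule reach_Lft_nil) simp
  from reach_trans[OF this reach_Rgt[of _ _ _ "Del3 Blank K"]]
  have "reach (mdelta k p) (Del1 K, [], x # R) (1 + 1) (Del3 Blank K, [Blank], x # R)"
    by simp
  from reach_trans[OF this reach_Rgt[of _ _ _ "Cmd K" Blank]]
  have "reach (mdelta k p) (Del1 K, [], x # R) (1 + 1 + 1) (Cmd K, [Blank, Blank], R)"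
    by simp
  then show ?case
    using reach_blank'[of _ _ _ "Cmd K" "[Blank]" R] reach_blank'[of _ _ _ "Cmd K" "[]" R]
    by (simp add: eval_nat_numeral)
next
  case (Cons a l)
  have "reach (mdelta k p) (Del1 K, a # l, x # R) 1 (Del2 K, l, a # x # R)"
    by (rule reach_Lft) simp
  from reach_trans[OF this reach_Rgt[of _ _ _ "Del3 a K"]]
  have "reach (mdelta k p) (Del1 K, a # l, x # R) (1 + 1) (Del3 a K, a # l, x # R)"
    by simp
  from reach_trans[OF this reach_Lft[of "mdelta k p" _ _ "Del1 K" a]] Cons.prems
  have "reach (mdelta k p) (Del1 K, a # l, x # R) (1 + 1 + 1) (Del1 K, l, a # a # R)"
    by fastforce
  from reach_trans[OF this Cons.IH] Cons.prems show ?case by simp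
qed

lemma reach_Push:
  assumes "i < k"
  shows "reach (mdelta k p) (Cmd (MPush i b # K), cells k s, [Blank]) (2 * length (cells k s) + 3)
    (Cmd K, cells k (s(i := b # s i)), [Blank])"
proof -
  obtain B where B: "cells k (s(i := b # s i)) = blocks (map s [0..<i]) @ map sym_of_bool (b # s i) @ Sep # B"
    "cells k s = blocks (map s [0..<i]) @ map sym_of_bool (s i) @ Sep # B"
    using cells_split[OF assms] by blast
  define A M where "A = blocks (map s [0..<i])" and "M = map sym_of_bool (s i) @ Sep # B"
  have AM: "cells k s = A @ M" "M \<noteq> []" by (simp_all add: B A_def M_def)
  have nb: "Blank \<notin> set (A @ M)" using blocks_nonblank[of "map s [0..<k]"] AM(1) by (simp add: cells_def)
  obtain m L where m: "A @ M = m # L" using AM(2) by (cases "A @ M") auto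
  have 1: "reach (mdelta k p) (Cmd (MPush i b # K), cells k s, [Blank]) 1
      (Push i b K, tl (A @ M), hd (A @ M) # [Blank])"
    unfolding AM(1) m list.sel by (rule reach_Lft) simp
  have 2: "reach (mdelta k p) (Push i b K, tl (A @ M), hd (A @ M) # [Blank]) (length A)
      (Push 0 b K, tl M, hd M # rev A @ [Blank])"
    using reach_skip_blocks[of "mdelta k p" "\<lambda>j. Push j b K" M "map s [0..<i]" "[Blank]"] AM(2)
    by (simp add: A_def)
  have "reach (mdelta k p) (Push 0 b K, tl (M @ [Blank]), hd (M @ [Blank]) # rev A @ [Blank]) (length M + 1)
      (Cmd K, [], rev (sym_of_bool b # M) @ rev A @ [Blank])"
    by (rule reach_Ins) (use nb in simp_all)
  then have 3: "reach (mdelta k p) (Push 0 b K, tl M, hd M # rev A @ [Blank]) (length M + 1)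
      (Cmd K, [], rev (sym_of_bool b # M) @ rev A @ [Blank])"
    using AM(2) by (simp add: reach_blank)
  have 4: "reach (mdelta k p) (Cmd K, [], rev (sym_of_bool b # M) @ rev A @ [Blank])
     (length A + length M + 1) (Cmd K, A @ sym_of_bool b # M, [Blank])"
    using reach_return[of "rev (sym_of_bool b # M) @ rev A" k p K "[]" "[]"] nb by (simp add: add.commute)
  have "A @ sym_of_bool b # M = cells k (s(i := b # s i))" by (simp add: B A_def M_def)
  with reach_trans[OF reach_trans[OF reach_trans[OF 1 2] 3] 4]
  have "reach (mdelta k p) (Cmd (MPush i b # K), cells k s, [Blank])
      (1 + length A + (length M + 1) + (length A + length M + 1))
      (Cmd K, cells k (s(i := b # s i)), [Blank])" by simp
  then show ?thesis by (rule reach_mono) (simp add: AM)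
qed

text \<open>The command list \<open>C\<close> is constrained only by its first step, so that
  \<open>MCase\<close> and \<open>MWhile\<close> share this lemma.\<close>

lemma reach_Pop:
  assumes "i < k" and step: "mdelta k p (Cmd C) Blank = (Pop i E Z U, Blank, Lft)"
  shows "s i = [] \<Longrightarrow> reach (mdelta k p) (Cmd C, cells k s, [Blank]) (4 * length (cells k s) + 6)
      (Cmd E, cells k s, [Blank])"
    and "s i = b # r \<Longrightarrow> reach (mdelta k p) (Cmd C, cells k s, [Blank]) (4 * length (cells k s) + 6)
      (Cmd (if b then U else Z), cells k (s(i := r)), [Blank])"
proof -
  obtain B where B: "cells k (s(i := r)) = blocks (map s [0..<i]) @ map sym_of_bool r @ Sep # B"
    "cells k s = blocks (map s [0..<i]) @ map sym_of_bool (s i) @ Sep # B"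
    using cells_split[OF assms(1)] by blast
  define A M where "A = blocks (map s [0..<i])" and "M = map sym_of_bool (s i) @ Sep # B"
  have AM: "cells k s = A @ M" "M \<noteq> []" by (simp_all add: B A_def M_def)
  have nb: "Blank \<notin> set (A @ M)" using blocks_nonblank[of "map s [0..<k]"] AM(1) by (simp add: cells_def)
  obtain m L where m: "A @ M = m # L" using AM(2) by (cases "A @ M") auto
  have 1: "reach (mdelta k p) (Cmd C, cells k s, [Blank]) 1
      (Pop i E Z U, tl (A @ M), hd (A @ M) # [Blank])"
    unfolding AM(1) m list.sel by (rule reach_Lft) (rule step)
  have 2: "reach (mdelta k p) (Pop i E Z U, tl (A @ M), hd (A @ M) # [Blank]) (length A)
      (Pop 0 E Z U, tl M, hd M # rev A @ [Blank])"
    using reach_skip_blocks[of "mdelta k p" "\<lambda>j. Pop j E Z U" M "map s [0..<i]" "[Blank]"] AM(2)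
    by (simp add: A_def)
  note 12 = reach_trans[OF 1 2]
  {
    assume "s i = []"
    then have M: "M = Sep # B" by (simp add: M_def)
    have 3: "reach (mdelta k p) (Pop 0 E Z U, tl M, hd M # rev A @ [Blank]) 1 (Cmd E, M, rev A @ [Blank])"
      unfolding M list.sel by (rule reach_Rgt) simp
    have 4: "reach (mdelta k p) (Cmd E, M, rev A @ [Blank]) (length A) (Cmd E, cells k s, [Blank])"
      using reach_return[of "rev A" k p E M "[]"] nb AM by simp
    show "reach (mdelta k p) (Cmd C, cells k s, [Blank]) (4 * length (cells k s) + 6)
      (Cmd E, cells k s, [Blank])"
      using reach_trans[OF reach_trans[OF 12 3] 4] by (rule reach_mono) (simp add: AM)
  next
    assume si: "s i = b # r"
    then have M: "M = sym_of_bool b # map sym_of_bool r @ Sep # B" by (simp add: M_def)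
    define l where "l = map sym_of_bool r @ Sep # B"
    let ?K = "if b then U else Z"
    have M': "M = sym_of_bool b # l" by (simp add: M l_def)
    have 3: "reach (mdelta k p) (Pop 0 E Z U, tl M, hd M # rev A @ [Blank]) 1
        (Del1 ?K, l, sym_of_bool b # rev A @ [Blank])"
      unfolding M' list.sel by (rule reach_Stay) (simp add: sym_of_bool_def)
    have 4: "reach (mdelta k p) (Del1 ?K, l, sym_of_bool b # rev A @ [Blank]) (3 * (length l + 1))
        (Cmd ?K, [], rev l @ rev A @ [Blank])"
      by (rule reach_Del) (use nb M' in simp)
    have 5: "reach (mdelta k p) (Cmd ?K, [], rev l @ rev A @ [Blank]) (length l + length A)
        (Cmd ?K, A @ l, [Blank])"
      using reach_return[of "rev l @ rev A" k p ?K "[]" "[]"] nb M' by simp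
    have "A @ l = cells k (s(i := r))" by (simp add: B A_def l_def)
    with reach_trans[OF reach_trans[OF reach_trans[OF 12 3] 4] 5]
    have "reach (mdelta k p) (Cmd C, cells k s, [Blank])
       (1 + length A + 1 + 3 * (length l + 1) + (length l + length A))
       (Cmd ?K, cells k (s(i := r)), [Blank])" by simp
    then show "reach (mdelta k p) (Cmd C, cells k s, [Blank]) (4 * length (cells k s) + 6)
      (Cmd ?K, cells k (s(i := r)), [Blank])"
      by (rule reach_mono) (simp add: AM M')
  }
qed

text \<open>\<open>S\<close> bounds the bits on the stacks throughout the run, since each unit of
  time adds at most one. The tape then has at most \<open>S + k\<close> cells, and one instruction
  costs at most the \<open>4 * (S + k) + 6\<close> steps of a pop.\<close>

lemma reach_exec:
  "exec c s t s' \<Longrightarrow> regs_below k c \<Longrightarrow> store_size k s + t \<le> S \<Longrightarrow>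
   reach (mdelta k p) (Cmd (c # K), cells k s, [Blank]) (t * (4 * (S + k) + 6)) (Cmd K, cells k s', [Blank])"
proof (induction arbitrary: K rule: exec.induct)
  case (exec_Nop s)
  have "reach (mdelta k p) (Cmd (MNop # K), cells k s, [Blank]) 1 (Cmd K, cells k s, [Blank])"
    by (rule reach_Stay) simp
  then show ?case by (rule reach_mono) simp
next
  case (exec_Push i b s)
  show ?case
    by (rule reach_mono[OF reach_Push]) (use exec_Push in \<open>simp_all add: length_cells\<close>)
next
  case (exec_Seq a s t s' b u s'')
  have size: "store_size k s' \<le> store_size k s + t" using store_size_exec exec_Seq by auto
  have "reach (mdelta k p) (Cmd (MSeq a b # K), cells k s, [Blank]) 1 (Cmd (a # b # K), cells k s, [Blank])"
    by (rule reach_Stay) simp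
  from reach_trans[OF this reach_trans[OF exec_Seq.IH(1) exec_Seq.IH(2)]] exec_Seq.prems size
  show ?case by (auto elim!: reach_mono simp: algebra_simps simp del: fun_upd_apply)
next
  case (exec_Case_Nil s i e t s' z u)
  have "reach (mdelta k p) (Cmd (MCase i e z u # K), cells k s, [Blank]) (4 * length (cells k s) + 6)
     (Cmd (e # K), cells k s, [Blank])"
    by (rule reach_Pop(1)) (use exec_Case_Nil in auto)
  from reach_trans[OF this exec_Case_Nil.IH] exec_Case_Nil.prems
  show ?case by (auto elim!: reach_mono simp: algebra_simps length_cells simp del: fun_upd_apply)
next
  case (exec_Case_Cons s i b r u z t s' e)
  have below: "regs_below k (if b then u else z)" using exec_Case_Cons.prems by simp
  have size: "store_size k (s(i := r)) \<le> store_size k s"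
    using store_size_upd[of i k s r] exec_Case_Cons by simp
  have "reach (mdelta k p) (Cmd (MCase i e z u # K), cells k s, [Blank]) (4 * length (cells k s) + 6)
     (Cmd ((if b then u # K else z # K)), cells k (s(i := r)), [Blank])"
    by (rule reach_Pop(2)) (use exec_Case_Cons in auto)
  then have "reach (mdelta k p) (Cmd (MCase i e z u # K), cells k s, [Blank]) (4 * length (cells k s) + 6)
     (Cmd ((if b then u else z) # K), cells k (s(i := r)), [Blank])"
    by (simp split: if_splits)
  from reach_trans[OF this exec_Case_Cons.IH] exec_Case_Cons.prems size below
  show ?case by (auto elim!: reach_mono simp: algebra_simps length_cells simp del: fun_upd_apply)
next
  case (exec_While_Nil s i z u)
  have "reach (mdelta k p) (Cmd (MWhile i z u # K), cells k s, [Blank]) (4 * length (cells k s) + 6)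
     (Cmd K, cells k s, [Blank])"
    by (rule reach_Pop(1)) (use exec_While_Nil in auto)
  then show ?case using exec_While_Nil.prems by (auto elim!: reach_mono simp: algebra_simps length_cells simp del: fun_upd_apply)
next
  case (exec_While_Cons s i b r u z t s' t' s'')
  let ?W = "MWhile i z u"
  have below: "regs_below k (if b then u else z)" using exec_While_Cons.prems by simp
  have size: "store_size k (s(i := r)) \<le> store_size k s"
    using store_size_upd[of i k s r] exec_While_Cons by simp
  have size': "store_size k s' \<le> store_size k (s(i := r)) + t"
    using store_size_exec[OF exec_While_Cons.hyps(2)] exec_While_Cons.prems by simp
  have "reach (mdelta k p) (Cmd (?W # K), cells k s, [Blank]) (4 * length (cells k s) + 6)
     (Cmd ((if b then u # ?W # K else z # ?W # K)), cells k (s(i := r)), [Blank])"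
    by (rule reach_Pop(2)) (use exec_While_Cons in auto)
  then have "reach (mdelta k p) (Cmd (?W # K), cells k s, [Blank]) (4 * length (cells k s) + 6)
     (Cmd ((if b then u else z) # ?W # K), cells k (s(i := r)), [Blank])"
    by (simp split: if_splits)
  from reach_trans[OF this reach_trans[OF exec_While_Cons.IH(1) exec_While_Cons.IH(2)]]
    exec_While_Cons.prems size size' below
  show ?case by (auto elim!: reach_mono simp: algebra_simps length_cells simp del: fun_upd_apply)
qed

section \<open>Start-up, input check and output of the machine\<close>

definition init_store :: "bool list \<Rightarrow> bool list \<Rightarrow> bool list \<Rightarrow> store" where
  "init_store x a b = (\<lambda>_. [])(0 := rev b, 1 := rev a, 2 := rev x)"

lemma reach_Fin_Rej:
  assumes "0 < k" "s 0 = []"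
  shows "\<exists>l r. reach (mdelta k p) (Cmd [], cells k s, [Blank]) 2 (Rej, l, r)"
proof -
  obtain B where B: "cells k s = Sep # B"
    using cells_split[OF assms(1), of s "[]"] assms(2) by auto
  have "reach (mdelta k p) (Cmd [], cells k s, [Blank]) 1 (Fin1, B, [Sep, Blank])"
    unfolding B by (rule reach_Lft) simp
  moreover have "reach (mdelta k p) (Fin1, B, [Sep, Blank]) 1 (Rej, B, [Sep, Blank])"
    by (rule reach_Stay) simp
  ultimately show ?thesis using reach_step by (metis One_nat_def order_refl numeral_2_eq_2)
qed

lemma reach_Fin2:
  "reach (mdelta k p) (Fin2, tl (map sym_of_bool bs @ Sep # B), hd (map sym_of_bool bs @ Sep # B) # R)
    (length bs + 1) (Acc, Sep # B, rev (map sym_of_bool bs) @ R)"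
proof (induction bs arbitrary: R)
  case Nil
  show ?case using reach_Rgt[of "mdelta k p" Fin2 Sep Acc Sep B R] by simp
next
  case (Cons b bs)
  obtain m M' where m: "map sym_of_bool bs @ Sep # B = m # M'" by (cases bs) auto
  have "reach (mdelta k p) (Fin2, m # M', sym_of_bool b # R) 1 (Fin2, M', m # sym_of_bool b # R)"
    by (rule reach_Lft) (simp add: sym_of_bool_def)
  from reach_step[OF this, of "length bs + 1"] Cons.IH[of "sym_of_bool b # R"] show ?case
    by (simp add: m)
qed

text \<open>The stack grows rightwards on the tape as its top is next to the blank, so reading from
  the bottom gives the reversed stack, ended by that blank.\<close>

lemma reach_Fin_Acc:
  assumes "0 < k" "s 0 \<noteq> []"
  shows "\<exists>l. reach (mdelta k p) (Cmd [], cells k s, [Blank]) (length (s 0) + 2)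
    (Acc, l, map sym_of_bool (rev (s 0)) @ [Blank])"
proof -
  obtain b r where s0: "s 0 = b # r" using assms(2) by (cases "s 0") auto
  obtain B where B: "cells k s = sym_of_bool b # map sym_of_bool r @ Sep # B"
    using cells_split[OF assms(1), of s "[]"] s0 by auto
  obtain m M' where m: "map sym_of_bool r @ Sep # B = m # M'" by (cases r) auto
  have "reach (mdelta k p) (Cmd [], cells k s, [Blank]) 1 (Fin1, m # M', [sym_of_bool b, Blank])"
    unfolding B m by (rule reach_Lft) simp
  moreover have "reach (mdelta k p) (Fin1, m # M', [sym_of_bool b, Blank]) 1
      (Fin2, M', [m, sym_of_bool b, Blank])"
    by (rule reach_Lft) (simp add: sym_of_bool_def)
  moreover have "reach (mdelta k p) (Fin2, M', [m, sym_of_bool b, Blank]) (length r + 1)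
      (Acc, Sep # B, map sym_of_bool (rev (s 0)) @ [Blank])"
    using reach_Fin2[of k p r B "[sym_of_bool b, Blank]"] by (simp add: m s0 rev_map)
  ultimately have "reach (mdelta k p) (Cmd [], cells k s, [Blank]) (1 + 1 + (length r + 1))
     (Acc, Sep # B, map sym_of_bool (rev (s 0)) @ [Blank])"
    by (blast intro: reach_trans)
  then show ?thesis by (intro exI) (erule reach_mono, simp add: s0)
qed

lemma reach_Pre: "reach (mdelta k p) (Pre j, [], Blank # R) (j + 1) (Scan 0, [], replicate j Sep @ R)"
proof (induction j arbitrary: R)
  case 0
  have "reach (mdelta k p) (Pre 0, [], Blank # R) 1 (Scan 0, [Blank], R)" by (rule reach_Rgt) simp
  then show ?case using reach_blank'[of _ _ _ "Scan 0" "[]" R] by simp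
next
  case (Suc j)
  have "reach (mdelta k p) (Pre (Suc j), [], Blank # R) 1 (Pre j, [], Blank # Sep # R)"
    by (rule reach_Lft_nil) simp
  from reach_step[OF this Suc.IH] show ?case by (simp add: replicate_app_Cons_same)
qed

lemma reach_Start:
  assumes "V \<noteq> []"
  shows "reach (mdelta k p) (Start, [], V) (k - 2 + 2) (Scan 0, [], replicate (k - 2) Sep @ V)"
proof -
  obtain v V' where V: "V = v # V'" using assms by (cases V) auto
  have "reach (mdelta k p) (Start, [], V) 1 (Pre (k - 2), [], Blank # V)"
    unfolding V by (rule reach_Lft_nil) simp
  from reach_step[OF this reach_Pre] show ?thesis by simp
qed

lemma reach_Scan:
  "Blank \<notin> set V \<Longrightarrow> j + count_list V Sep = k \<Longrightarrow>
    reach (mdelta k p) (Scan j, l, V @ [Blank]) (length V + 1) (Cmd [p], rev V @ l, [Blank])"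
proof (induction V arbitrary: j l)
  case Nil
  then show ?case using reach_Stay[of "mdelta k p" "Scan j" Blank "Cmd [p]" Blank l "[]"] by simp
next
  case (Cons v V)
  have "reach (mdelta k p) (Scan j, l, v # V @ [Blank]) 1
      (Scan (if v = Sep then Suc j else j), v # l, V @ [Blank])"
    by (rule reach_Rgt) (use Cons.prems in \<open>cases v; auto\<close>)
  from reach_step[OF this Cons.IH] Cons.prems show ?case by (simp split: if_splits)
qed

text \<open>Polynomial time is demanded on every word, whereas the program is only known to
  terminate on encoded triples; malformed words are therefore rejected before it starts.\<close>

lemma reach_Scan_Rej:
  "Blank \<notin> set V \<Longrightarrow> j + count_list V Sep \<noteq> k \<Longrightarrow> j \<le> k \<Longrightarrow>
    \<exists>l' r'. reach (mdelta k p) (Scan j, l, V @ [Blank]) (length V + 1) (Rej, l', r')"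
proof (induction V arbitrary: j l)
  case Nil
  then show ?case using reach_Stay[of "mdelta k p" "Scan j" Blank Rej Blank l "[]"] by auto
next
  case (Cons v V)
  show ?case
  proof (cases "v = Sep \<and> j = k")
    case True
    have "reach (mdelta k p) (Scan j, l, v # V @ [Blank]) 1 (Rej, l, v # V @ [Blank])"
      by (rule reach_Stay) (use True in simp)
    then show ?thesis by (auto intro: reach_mono)
  next
    case False
    have 1: "reach (mdelta k p) (Scan j, l, v # V @ [Blank]) 1
        (Scan (if v = Sep then Suc j else j), v # l, V @ [Blank])"
      by (rule reach_Rgt) (use Cons.prems False in \<open>cases v; auto\<close>)
    have "\<exists>l' r'. reach (mdelta k p) (Scan (if v = Sep then Suc j else j), v # l, V @ [Blank])
        (length V + 1) (Rej, l', r')"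
      by (rule Cons.IH) (use Cons.prems False in \<open>auto split: if_splits\<close>)
    then obtain l' r' where "reach (mdelta k p) (Scan (if v = Sep then Suc j else j), v # l, V @ [Blank])
        (length V + 1) (Rej, l', r')" by blast
    from reach_step[OF 1 this, of "length (v # V) + 1"] show ?thesis by auto
  qed
qed

lemma count_Sep_bits: "count_list (map sym_of_bool xs) Sep = 0"
  by (induction xs) auto

lemma enc3_nonblank: "Blank \<notin> set (enc3 x a b)" and count_enc3: "count_list (enc3 x a b) Sep = 2"
  by (auto simp: enc3_def count_Sep_bits)

lemma bits_or_Sep:
  "Blank \<notin> set V \<Longrightarrow> (\<exists>x. V = map sym_of_bool x) \<or> (\<exists>x V'. V = map sym_of_bool x @ Sep # V')"
proof (induction V)
  case (Cons v V)
  then have IH: "(\<exists>x. V = map sym_of_bool x) \<or> (\<exists>x V'. V = map sym_of_bool x @ Sep # V')" by auto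
  show ?case
  proof (cases "v = Sep")
    case True
    then show ?thesis by (metis append_Nil list.map(1))
  next
    case False
    then obtain b where b: "v = sym_of_bool b"
      using Cons.prems by (cases v) (auto simp: sym_of_bool_def split: if_splits)
    from IH show ?thesis
    proof (elim disjE exE)
      fix x assume "V = map sym_of_bool x"
      then show ?thesis by (intro disjI1 exI[of _ "b # x"]) (simp add: b)
    next
      fix x V' assume "V = map sym_of_bool x @ Sep # V'"
      then show ?thesis by (intro disjI2 exI[of _ "b # x"] exI[of _ V']) (simp add: b)
    qed
  qed
qed auto

lemma ex_enc3:
  assumes "Blank \<notin> set V" "count_list V Sep = 2" shows "\<exists>x a b. V = enc3 x a b"
proof -
  obtain x V1 where 1: "V = map sym_of_bool x @ Sep # V1"
    using bits_or_Sep[OF assms(1)] assms(2) by (auto simp: count_Sep_bits)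
  then obtain a V2 where 2: "V1 = map sym_of_bool a @ Sep # V2"
    using bits_or_Sep[of V1] assms by (auto simp: count_Sep_bits)
  then obtain b where 3: "V2 = map sym_of_bool b"
    using bits_or_Sep[of V2] assms 1 by (auto simp: count_Sep_bits)
  show ?thesis unfolding enc3_def 1 2 3 by auto
qed

text \<open>Seen from the blank at its right end, the input already is a store: \<open>b\<close>,
  \<open>a\<close>, \<open>x\<close> are stacks with their last bits on top, and the separators
  written in front close \<open>x\<close> and the empty stacks.\<close>

lemma cells_init:
  assumes "3 \<le> k" shows "rev (replicate (k - 2) Sep @ enc3 x a b) = cells k (init_store x a b)"
proof -
  have u: "[0..<k] = 0 # 1 # 2 # [3..<k]"
    using assms upt_conv_Cons[of 0 k] upt_conv_Cons[of 1 k] upt_conv_Cons[of 2 k]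
    by (simp add: numeral_2_eq_2 numeral_3_eq_3)
  have "map (init_store x a b) [3..<k] = replicate (k - 3) []"
    by (rule nth_equalityI) (auto simp: init_store_def)
  moreover have "blocks (replicate n []) = replicate n Sep" for n by (induction n) auto
  moreover have "replicate (k - 2) Sep = Sep # replicate (k - 3) Sep"
    using assms by (simp flip: replicate_Suc)
  ultimately have "cells k (init_store x a b) =
     blocks [rev b, rev a, rev x] @ replicate (k - 3) Sep"
    unfolding cells_def u by (simp add: init_store_def)
  moreover have "replicate (k - 2) Sep = Sep # replicate (k - 3) Sep"
    using assms by (simp flip: replicate_Suc)
  ultimately show ?thesis by (simp add: enc3_def rev_map replicate_append_same)
qed

lemma store_size_init: "3 \<le> k \<Longrightarrow> store_size k (init_store x a b) = length x + length a + length b"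
  using length_cells[of k "init_store x a b"] cells_init[of k x a b, symmetric]
  by (simp add: enc3_def)

lemma reach_program:
  assumes below: "regs_below k p" and k: "3 \<le> k" and ex: "exec p (init_store x a b) t s'"
    and S: "length x + length a + length b + t \<le> S"
    and T: "k + (S + k + 3) + t * (4 * (S + k) + 6) + (S + 2) \<le> T"
  shows "if s' 0 = [] then \<exists>l r. reach (mdelta k p) (Start, [], enc3 x a b @ [Blank]) T (Rej, l, r)
    else \<exists>l. reach (mdelta k p) (Start, [], enc3 x a b @ [Blank]) T
      (Acc, l, map sym_of_bool (rev (s' 0)) @ [Blank])"
proof -
  let ?s = "init_store x a b" and ?V = "replicate (k - 2) Sep @ enc3 x a b"
  have size: "store_size k ?s + t \<le> S" using S by (simp add: store_size_init k)
  have nb: "Blank \<notin> set ?V" by (simp add: enc3_nonblank)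
  have cnt: "count_list (replicate m Sep) Sep = m" for m by (induction m) auto
  have "reach (mdelta k p) (Start, [], enc3 x a b @ [Blank]) (k - 2 + 2) (Scan 0, [], ?V @ [Blank])"
    using reach_Start[of "enc3 x a b @ [Blank]"] by simp
  moreover have "reach (mdelta k p) (Scan 0, [], ?V @ [Blank]) (length ?V + 1) (Cmd [p], cells k ?s, [Blank])"
    using reach_Scan[OF nb, of 0 k p "[]"] k by (simp add: count_enc3 cnt cells_init[OF k, symmetric])
  moreover have "reach (mdelta k p) (Cmd [p], cells k ?s, [Blank]) (t * (4 * (S + k) + 6))
     (Cmd [], cells k s', [Blank])"
    by (rule reach_exec[OF ex below size])
  ultimately have 1: "reach (mdelta k p) (Start, [], enc3 x a b @ [Blank])
     (k - 2 + 2 + (length ?V + 1) + t * (4 * (S + k) + 6)) (Cmd [], cells k s', [Blank])"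
    by (blast intro: reach_trans)
  have "length (s' 0) \<le> store_size k s'"
    unfolding store_size_def using k by (intro member_le_sum) auto
  then have s0: "length (s' 0) \<le> S" using store_size_exec[OF ex below] size by simp
  have V: "length ?V + 1 \<le> S + k + 3" using S by (simp add: enc3_def)
  have TT: "k - 2 + 2 + (length ?V + 1) + t * (4 * (S + k) + 6) + (S + 2) \<le> T"
    using V T k by linarith
  show ?thesis
  proof (cases "s' 0 = []")
    case True
    then obtain l r where "reach (mdelta k p) (Cmd [], cells k s', [Blank]) 2 (Rej, l, r)"
      using reach_Fin_Rej[of k s' p] k by auto
    from reach_mono[OF reach_trans[OF 1 this] le_trans[OF _ TT]] show ?thesis using True by auto
  next
    case False
    then obtain l where "reach (mdelta k p) (Cmd [], cells k s', [Blank]) (length (s' 0) + 2)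
      (Acc, l, map sym_of_bool (rev (s' 0)) @ [Blank])"
      using reach_Fin_Acc[of k s' p] k by auto
    from reach_mono[OF reach_trans[OF 1 this] le_trans[OF _ TT]] show ?thesis using False s0 by auto
  qed
qed

subsection \<open>The state space\<close>

text \<open>The continuations that can arise while \<open>c # K\<close> runs. A loop body ends in
  the very list the loop started from, so the set is finite, and with it the set of states.\<close>

fun conts :: "mcmd \<Rightarrow> mcmd list \<Rightarrow> mcmd list set" where
  "conts (MSeq a b) K = {MSeq a b # K} \<union> conts a (b # K) \<union> conts b K"
| "conts (MCase i e z u) K = {MCase i e z u # K} \<union> conts e K \<union> conts z K \<union> conts u K"
| "conts (MWhile i z u) K = {MWhile i z u # K, K} \<union> conts z (MWhile i z u # K) \<union> conts u (MWhile i z u # K)"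
| "conts c K = {c # K, K}"

fun next_conts :: "mcmd list \<Rightarrow> mcmd list set" where
  "next_conts [] = {}"
| "next_conts (MSeq a b # K) = {a # b # K}"
| "next_conts (MCase i e z u # K) = {e # K, z # K, u # K}"
| "next_conts (MWhile i z u # K) = {K, z # MWhile i z u # K, u # MWhile i z u # K}"
| "next_conts (c # K) = {K}"

lemma finite_conts: "finite (conts c K)"
  by (induction c arbitrary: K) auto

lemma conts_self: "c # K \<in> conts c K" "K \<in> conts c K"
proof -
  show "c # K \<in> conts c K" by (cases c) auto
  show "K \<in> conts c K" by (induction c arbitrary: K) auto
qed

text \<open>The successors of \<open>K\<close> itself belong to the surrounding program, hence the
  exception; for the whole program \<open>K\<close> is empty and has none.\<close>

lemma next_conts_subset: "L \<in> conts c K \<Longrightarrow> L = K \<or> next_conts L \<subseteq> conts c K"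
proof (induction c arbitrary: K L)
  case (MSeq a b)
  then consider "L = MSeq a b # K" | "L \<in> conts a (b # K)" | "L \<in> conts b K" by auto
  then show ?case
  proof cases
    case 1
    then show ?thesis by (simp add: conts_self)
  next
    case 2
    from MSeq.IH(1)[OF 2] MSeq.IH(2)[of "b # K" K] show ?thesis by (auto simp: conts_self)
  next
    case 3
    from MSeq.IH(2)[OF 3] show ?thesis by auto
  qed
next
  case (MCase i e z u)
  then consider "L = MCase i e z u # K" | "L \<in> conts e K" | "L \<in> conts z K" | "L \<in> conts u K" by auto
  then show ?case
  proof cases
    case 1
    then show ?thesis by (simp add: conts_self)
  next
    case 2
    from MCase.IH(1)[OF 2] show ?thesis by auto
  next
    case 3
    from MCase.IH(2)[OF 3] show ?thesis by auto
  next
    case 4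
    from MCase.IH(3)[OF 4] show ?thesis by auto
  qed
next
  case (MWhile i z u)
  let ?W = "MWhile i z u # K"
  from MWhile.prems consider "L = K" | "L = ?W" | "L \<in> conts z ?W" | "L \<in> conts u ?W" by auto
  then show ?case
  proof cases
    case 3
    from MWhile.IH(1)[OF 3] show ?thesis by (auto simp: conts_self)
  next
    case 4
    from MWhile.IH(2)[OF 4] show ?thesis by (auto simp: conts_self)
  qed (auto simp: conts_self)
qed auto

lemma regs_below_conts:
  "L \<in> conts c K \<Longrightarrow> regs_below k c \<Longrightarrow> list_all (regs_below k) K \<Longrightarrow> list_all (regs_below k) L"
  by (induction c arbitrary: K) fastforce+

fun valid_state :: "nat \<Rightarrow> mcmd list set \<Rightarrow> mstate \<Rightarrow> bool" where
  "valid_state k C (Pre j) = (j \<le> k)"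
| "valid_state k C (Scan j) = (j \<le> k)"
| "valid_state k C (Cmd K) = (K \<in> C)"
| "valid_state k C (Push i b K) = (i \<le> k \<and> K \<in> C)"
| "valid_state k C (Ins c K) = (K \<in> C)"
| "valid_state k C (Pop i E Z U) = (i \<le> k \<and> E \<in> C \<and> Z \<in> C \<and> U \<in> C)"
| "valid_state k C (Del1 K) = (K \<in> C)"
| "valid_state k C (Del2 K) = (K \<in> C)"
| "valid_state k C (Del3 c K) = (K \<in> C)"
| "valid_state k C _ = True"

lemma finite_valid_states:
  assumes "finite C" shows "finite {q. valid_state k C q}"
proof -
  have "UNIV = {Blank, Zero, One, Sep}" using sym.exhaust by auto
  then have sym: "finite (UNIV :: sym set)" by (metis finite.simps)
  let ?Q = "{Start, Fin1, Fin2, Acc, Rej} \<union> (\<Union>i\<in>{..k}. {Pre i, Scan i}) \<union>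
    (\<Union>K\<in>C. {Cmd K, Del1 K, Del2 K} \<union> (\<Union>c. {Ins c K, Del3 c K}) \<union>
      (\<Union>i\<in>{..k}. (\<Union>b. {Push i b K}) \<union> (\<Union>Z\<in>C. \<Union>U\<in>C. {Pop i K Z U})))"
  have "q \<in> ?Q" if "valid_state k C q" for q using that by (cases q) simp_all
  then have "{q. valid_state k C q} \<subseteq> ?Q" by blast
  moreover have "finite ?Q" using assms sym by simp
  ultimately show ?thesis by (rule finite_subset)
qed

lemma valid_state_mdelta:
  assumes C: "C = conts p []" and p: "regs_below k p" and q: "valid_state k C q"
  shows "valid_state k C (fst (mdelta k p q s))"
proof (cases "\<exists>K. q = Cmd K")
  case True
  then obtain K where K: "q = Cmd K" "K \<in> C" using q by auto
  have n: "next_conts K \<subseteq> C" using next_conts_subset[of K p "[]"] K(2) by (auto simp: C)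
  have b: "list_all (regs_below k) K" using regs_below_conts[of K p "[]" k] K(2) p by (simp add: C)
  show ?thesis
  proof (cases K)
    case Nil
    then show ?thesis using K by simp
  next
    case (Cons c K')
    then show ?thesis using K n b by (cases c) auto
  qed
next
  case False
  have "[p] \<in> C" by (simp add: C conts_self)
  then show ?thesis using q False
    by (cases "(k, p, q, s)" rule: mdelta.cases) (auto split: sym.splits)
qed

section \<open>Transfer to the given machine model\<close>

lemma halted_stable: "is_halt (fst c) \<Longrightarrow> (tm_step M ^^ t) c = c"
  by (induction t) (auto simp: tm_step_def split: prod.splits)

lemma halts_within_mono:
  assumes "halts_within M w t" "t \<le> u" shows "tm_run M w u = tm_run M w t" "halts_within M w u"
proof -
  have "tm_run M w u = (tm_step M ^^ (u - t)) (tm_run M w t)"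
    using assms(2) funpow_add[of "u - t" t "tm_step M"] by (simp add: tm_run_def)
  then show "tm_run M w u = tm_run M w t"
    using halted_stable assms(1) by (simp add: halts_within_def)
  then show "halts_within M w u" using assms(1) by (simp add: halts_within_def)
qed

lemma tm_result_halted:
  assumes "halts_within M w t" shows "tm_result M w = cfg_output (tm_run M w t)"
proof -
  let ?L = "LEAST t. halts_within M w t"
  have "halts_within M w ?L" "?L \<le> t" using assms by (auto intro: LeastI Least_le)
  from halts_within_mono(1)[OF this] show ?thesis by (simp add: tm_result_def)
qed

lemma read_bits_tape:
  assumes "tape_is tape h l (map sym_of_bool xs @ [Blank])" shows "read_bits tape h = xs"
proof -
  have cell: "i \<le> length xs \<Longrightarrow> tape (h + int i) = (map sym_of_bool xs @ [Blank]) ! i" for i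
    using assms by (simp add: tape_is_def)
  have "(LEAST k. tape (h + int k) \<notin> {Zero, One}) = length xs"
  proof (rule Least_equality)
    show "tape (h + int (length xs)) \<notin> {Zero, One}" using cell[of "length xs"] by (simp add: nth_append)
    fix k assume k: "tape (h + int k) \<notin> {Zero, One}"
    show "length xs \<le> k"
    proof (rule ccontr)
      assume "\<not> length xs \<le> k"
      then show False using k cell[of k] by (auto simp: nth_append sym_of_bool_def split: if_splits)
    qed
  qed
  then show ?thesis
    using cell by (auto simp: read_bits_def nth_append intro!: nth_equalityI)
qed

text \<open>Arbitrary words may contain blanks. The machine does not go past the first one, so this
  part alone decides its behaviour.\<close>

definition prefix :: "sym list \<Rightarrow> sym list" where
  "prefix w = takeWhile (\<lambda>s. s \<noteq> Blank) w"

lemma prefix_nonblank: "Blank \<notin> set (prefix w)"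
  unfolding prefix_def using set_takeWhileD by metis

lemma length_prefix: "length (prefix w) \<le> length w"
  by (simp add: prefix_def length_takeWhile_le)

lemma prefix_enc3: "prefix (enc3 x a b) = enc3 x a b"
  using enc3_nonblank[of x a b] unfolding prefix_def takeWhile_eq_all_conv by metis

lemma tape_is_init:
  "tape_is (\<lambda>i. if 0 \<le> i \<and> i < int (length w) then w ! nat i else Blank) 0 [] (prefix w @ [Blank])"
proof -
  have "(if i < length w then w ! i else Blank) = (prefix w @ [Blank]) ! i" if "i \<le> length (prefix w)" for i
  proof (cases "i < length (prefix w)")
    case True
    then show ?thesis using length_prefix[of w] by (simp add: nth_append prefix_def takeWhile_nth)
  next
    case False
    then have "i = length (prefix w)" using that by simp
    then show ?thesis
      using nth_length_takeWhile[of "\<lambda>s. s \<noteq> Blank" w] by (auto simp: prefix_def)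
  qed
  then show ?thesis by (simp add: tape_is_def less_Suc_eq_le cong: if_cong split del: if_split)
qed

text \<open>The two step functions differ only in halting states; there \<open>tm_step\<close>
  freezes the configuration and \<delta> stays in place without changing it.\<close>

lemma funpow_tm_step:
  assumes step: "\<forall>q\<in>Q. \<forall>s. snd M (f q) s = (f (fst (\<delta> q s)), snd (\<delta> q s))"
    and closed: "\<And>q s. q \<in> Q \<Longrightarrow> fst (\<delta> q s) \<in> Q"
    and halt: "\<And>q s. q \<in> Q \<Longrightarrow> is_halt (f q) \<Longrightarrow> \<delta> q s = (q, s, Stay)"
    and q: "q \<in> Q"
    and run: "(tstep \<delta> ^^ t) (q, tape, h) = (q', tape', h')"
  shows "q' \<in> Q \<and> (tm_step M ^^ t) (f q, tape, h) = (f q', tape', h')"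
  using run
proof (induction t arbitrary: q' tape' h')
  case 0
  then show ?case using q by simp
next
  case (Suc t)
  obtain q1 tape1 h1 where 1: "(tstep \<delta> ^^ t) (q, tape, h) = (q1, tape1, h1)" by (metis prod_cases3)
  obtain q2 y d where 2: "\<delta> q1 (tape1 h1) = (q2, y, d)" by (metis prod_cases3)
  from Suc.IH[OF 1] have IH: "q1 \<in> Q" "(tm_step M ^^ t) (f q, tape, h) = (f q1, tape1, h1)" by auto
  have 3: "q' = q2" "tape' = tape1(h1 := y)" "h' = mv d h1"
  proof -
    have "tstep \<delta> (q1, tape1, h1) = (q', tape', h')" using Suc.prems 1 by simp
    then show "q' = q2" "tape' = tape1(h1 := y)" "h' = mv d h1" using 2 by (auto simp: tstep_def)
  qed
  have "tm_step M (f q1, tape1, h1) = (f q', tape', h')"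
  proof (cases "is_halt (f q1)")
    case True
    then have "q2 = q1" "y = tape1 h1" "d = Stay" using halt[OF IH(1) True, of "tape1 h1"] 2 by auto
    then show ?thesis using True 3 by (simp add: tm_step_def mv_def)
  next
    case False
    then show ?thesis using step IH(1) 2 3 by (simp add: tm_step_def)
  qed
  then show ?case using IH closed[OF IH(1), of "tape1 h1"] 2 3 by (simp del: fun_upd_apply)
qed

text \<open>The time bound uses some run of length at most \<open>T\<close> for each input, while
  the result is read off any run, whatever its length.\<close>

theorem ex_machine:
  assumes below: "regs_below k p" and k: "3 \<le> k" and T: "poly_fun T"
    and ex: "\<And>x a b. \<exists>t s'. t \<le> T (length x + length a + length b) \<and> exec p (init_store x a b) t s'"
  shows "\<exists>M. tm_wf M \<and> tm_poly_time M \<and>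
    (\<forall>x a b t s'. exec p (init_store x a b) t s' \<longrightarrow>
       tm_result M (enc3 x a b) = (if s' 0 = [] then None else Some (rev (s' 0))))"
proof -
  define C where "C = conts p []"
  let ?Q = "{q. valid_state k C q}"
  let ?\<delta> = "mdelta k p"
  have closed: "fst (?\<delta> q s) \<in> ?Q" if "q \<in> ?Q" for q s
    using valid_state_mdelta[OF C_def below] that by simp
  have "finite ?Q" by (intro finite_valid_states) (simp add: C_def finite_conts)
  then have "\<exists>M f. tm_wf M \<and> inj_on f ?Q \<and> f Start = 0 \<and> f Acc = 1 \<and> f Rej = 2 \<and>
      (\<forall>q\<in>?Q. \<forall>s. snd M (f q) s = (f (fst (?\<delta> q s)), snd (?\<delta> q s)))"
    by (rule ex_tm) (use closed in simp_all)
  then obtain M f where wf: "tm_wf M" and inj: "inj_on f ?Q" and f: "f Start = 0" "f Acc = 1" "f Rej = 2"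
    and step: "\<forall>q\<in>?Q. \<forall>s. snd M (f q) s = (f (fst (?\<delta> q s)), snd (?\<delta> q s))"
    by blast
  have halt: "?\<delta> q s = (q, s, Stay)" if "q \<in> ?Q" "is_halt (f q)" for q s
  proof -
    have "f q = f Acc \<or> f q = f Rej" using that(2) f by (auto simp: is_halt_def)
    then have "q = Acc \<or> q = Rej" using inj_on_eq_iff[OF inj that(1)] by auto
    then show ?thesis by auto
  qed
  have run: "\<exists>t\<le>U. \<exists>tape h. tm_run M w t = (f q, tape, h) \<and> tape_is tape h l r"
    if reach: "reach ?\<delta> (Start, [], prefix w @ [Blank]) U (q, l, r)" for w U q l r
  proof -
    let ?tape = "\<lambda>i. if 0 \<le> i \<and> i < int (length w) then w ! nat i else Blank"
    obtain t tape' h' where t: "t \<le> U" "tape_is tape' h' l r"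
      "(tstep ?\<delta> ^^ t) (Start, ?tape, 0) = (q, tape', h')"
      using reach tape_is_init[of w] unfolding reach_def fst_conv snd_conv by blast
    have "(tm_step M ^^ t) (f Start, ?tape, 0) = (f q, tape', h')"
      using funpow_tm_step[OF step closed halt _ t(3)] by simp
    then show ?thesis using t f by (auto simp: tm_run_def tm_init_def)
  qed
  define S where "S m = m + T m" for m
  \<comment> \<open>The bound of \<open>reach_program\<close> with the time replaced by
    \<open>T m\<close>; \<open>S m\<close> accounts for the input bits and the growth of the
    store.\<close>
  define P where "P m = k + (S m + k + 3) + T m * (4 * (S m + k) + 6) + (S m + 2)" for m
  have S_poly: "poly_fun S" unfolding S_def by (intro poly_fun_intros T)
  have P_poly: "poly_fun P" unfolding P_def by (intro poly_fun_intros T S_poly)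
  have rej: "\<exists>l r. reach ?\<delta> (Start, [], prefix w @ [Blank]) (P (length w)) (Rej, l, r)"
    if c: "count_list (prefix w) Sep \<noteq> 2" for w
  proof -
    let ?V = "replicate (k - 2) Sep @ prefix w"
    have cnt: "count_list (replicate m Sep) Sep = m" for m by (induction m) auto
    have 1: "reach ?\<delta> (Start, [], prefix w @ [Blank]) (k - 2 + 2) (Scan 0, [], ?V @ [Blank])"
      using reach_Start[of "prefix w @ [Blank]"] by simp
    have "\<exists>l r. reach ?\<delta> (Scan 0, [], ?V @ [Blank]) (length ?V + 1) (Rej, l, r)"
      by (rule reach_Scan_Rej) (use c k prefix_nonblank[of w] in \<open>simp_all add: cnt\<close>)
    then obtain l r where 2: "reach ?\<delta> (Scan 0, [], ?V @ [Blank]) (length ?V + 1) (Rej, l, r)"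
      by blast
    have "length ?V + 1 \<le> S (length w) + k + 3" using length_prefix[of w] by (simp add: S_def)
    then have "k - 2 + 2 + (length ?V + 1) \<le> P (length w)" using k unfolding P_def by linarith
    from reach_mono[OF reach_trans[OF 1 2] this] show ?thesis by blast
  qed
  have good: "if s' 0 = [] then \<exists>l r. reach ?\<delta> (Start, [], enc3 x a b @ [Blank]) (P m) (Rej, l, r)
      else \<exists>l. reach ?\<delta> (Start, [], enc3 x a b @ [Blank]) (P m)
        (Acc, l, map sym_of_bool (rev (s' 0)) @ [Blank])"
    if "t \<le> T (length x + length a + length b)" "exec p (init_store x a b) t s'"
      "length x + length a + length b \<le> m" for x a b t s' m
  proof (rule reach_program[OF below k that(2)])
    have tm: "t \<le> T m" using that(1) poly_fun_mono[OF T that(3)] by simp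
    then show "length x + length a + length b + t \<le> S m" using that(3) by (simp add: S_def)
    show "k + (S m + k + 3) + t * (4 * (S m + k) + 6) + (S m + 2) \<le> P m"
      using tm by (simp add: P_def)
  qed
  have "halts_within M w (P (length w))" for w
  proof -
    have "\<exists>q l r. (q = Acc \<or> q = Rej) \<and> reach ?\<delta> (Start, [], prefix w @ [Blank]) (P (length w)) (q, l, r)"
    proof (cases "count_list (prefix w) Sep = 2")
      case True
      then obtain x a b where w: "prefix w = enc3 x a b" using ex_enc3 prefix_nonblank by blast
      have len: "length x + length a + length b \<le> length w"
        using length_prefix[of w] unfolding w by (simp add: enc3_def)
      obtain t s' where "t \<le> T (length x + length a + length b)" "exec p (init_store x a b) t s'"
        using ex by blast
      from good[OF this len] show ?thesis unfolding w by (cases "s' 0 = []") auto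
    next
      case False
      with rej show ?thesis by blast
    qed
    then obtain q l r where q: "q = Acc \<or> q = Rej"
      and r: "reach ?\<delta> (Start, [], prefix w @ [Blank]) (P (length w)) (q, l, r)" by blast
    obtain t tape h where t: "t \<le> P (length w)" "tm_run M w t = (f q, tape, h)"
      using run[OF r] by blast
    have "is_halt (f q)" using q f by (auto simp: is_halt_def)
    then have "halts_within M w t" by (simp add: halts_within_def t(2))
    with t(1) have "\<exists>t\<le>P (length w). halts_within M w t" by blast
    then show ?thesis using halts_within_mono(2) by blast
  qed
  with P_poly have "tm_poly_time M" by (auto simp: tm_poly_time_def)
  moreover have "tm_result M (enc3 x a b) = (if s' 0 = [] then None else Some (rev (s' 0)))"
    if e: "exec p (init_store x a b) t s'" for x a b t s'
  proof -
    let ?w = "enc3 x a b"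
    obtain U where U: "k + (length x + length a + length b + t + k + 3) +
        t * (4 * (length x + length a + length b + t + k) + 6) + (length x + length a + length b + t + 2) = U"
      by blast
    have R: "if s' 0 = [] then \<exists>l r. reach ?\<delta> (Start, [], ?w @ [Blank]) U (Rej, l, r)
      else \<exists>l. reach ?\<delta> (Start, [], ?w @ [Blank]) U (Acc, l, map sym_of_bool (rev (s' 0)) @ [Blank])"
      by (rule reach_program[OF below k e order_refl]) (simp only: U)
    show ?thesis
    proof (cases "s' 0 = []")
      case True
      then obtain l r where "reach ?\<delta> (Start, [], prefix ?w @ [Blank]) U (Rej, l, r)"
        using R by (auto simp: prefix_enc3)
      from run[OF this] obtain t tape h where t: "tm_run M ?w t = (2, tape, h)" using f by auto
      then have "halts_within M ?w t" by (simp add: halts_within_def is_halt_def)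
      from tm_result_halted[OF this] show ?thesis using True t by (simp add: cfg_output_def)
    next
      case False
      then obtain l where "reach ?\<delta> (Start, [], prefix ?w @ [Blank]) U
          (Acc, l, map sym_of_bool (rev (s' 0)) @ [Blank])"
        using R by (auto simp: prefix_enc3)
      from run[OF this] obtain t tape h where t: "tm_run M ?w t = (1, tape, h)"
        "tape_is tape h l (map sym_of_bool (rev (s' 0)) @ [Blank])" using f by auto
      then have "halts_within M ?w t" by (simp add: halts_within_def is_halt_def)
      from tm_result_halted[OF this] show ?thesis
        using False t read_bits_tape[OF t(2)] by (simp add: cfg_output_def)
    qed
  qed
  ultimately show ?thesis using wf by blast
qed

declare fun_upd_apply [simp del] fun_upd_same [simp] fun_upd_other [simp]

subsection \<open>A loop language whose programs run in polynomial time\<close>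

datatype cmd = Nop | Put nat bool | Case nat cmd cmd cmd | Seq cmd cmd (infixr ";;" 60) | Loop cmd

fun sem :: "nat \<Rightarrow> cmd \<Rightarrow> store \<Rightarrow> store" where
  "sem n Nop s = s"
| "sem n (Put i b) s = s(i := b # s i)"
| "sem n (Case i e z u) s = (case s i of [] \<Rightarrow> sem n e s
     | b # r \<Rightarrow> if b then sem n u (s(i := r)) else sem n z (s(i := r)))"
| "sem n (a ;; b) s = sem n b (sem n a s)"
| "sem n (Loop c) s = (sem n c ^^ n) s"

fun uses :: "cmd \<Rightarrow> nat set" where
  "uses Nop = {}"
| "uses (Put i b) = {i}"
| "uses (Case i e z u) = {i} \<union> uses e \<union> uses z \<union> uses u"
| "uses (a ;; b) = uses a \<union> uses b"
| "uses (Loop c) = uses c"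

fun depth :: "cmd \<Rightarrow> nat" where
  "depth (Case i e z u) = max (depth e) (max (depth z) (depth u))"
| "depth (a ;; b) = max (depth a) (depth b)"
| "depth (Loop c) = Suc (depth c)"
| "depth _ = 0"

text \<open>The branches of a case are added up rather than compared, which keeps the bound a
  polynomial in \<open>n\<close>. A loop pays for its rounds and for refilling its counter.\<close>

fun cost :: "nat \<Rightarrow> cmd \<Rightarrow> nat" where
  "cost n (Case i e z u) = 1 + cost n e + cost n z + cost n u"
| "cost n (a ;; b) = cost n a + cost n b + 1"
| "cost n (Loop c) = n * (cost n c + 3) + 1 + (2 * n + 1) + 1"
| "cost n _ = 1"

lemma poly_fun_cost: "poly_fun (\<lambda>n. cost n c)"
  by (induction c; simp only: cost.simps; intro poly_fun_intros; assumption?)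

text \<open>The frame property behind both the hidden loop counters and the draining of stacks: a
  program commutes with changes to stacks it does not mention.\<close>

lemma sem_upd: "i \<notin> uses c \<Longrightarrow> sem n c (s(i := v)) = (sem n c s)(i := v)"
proof (induction c arbitrary: s)
  case (Case j e z u)
  then show ?case by (auto simp: fun_upd_twist[of i j] split: list.split)
next
  case (Loop c)
  have "(sem n c ^^ m) (s(i := v)) = ((sem n c ^^ m) s)(i := v)" for m
    using Loop by (induction m) auto
  then show ?case by simp
qed (auto simp: fun_upd_twist)

lemma funpow_sem_upd: "i \<notin> uses c \<Longrightarrow> (sem n c ^^ m) (s(i := v)) = ((sem n c ^^ m) s)(i := v)"
  by (induction m) (auto simp: sem_upd)

lemma sem_other: "i \<notin> uses c \<Longrightarrow> sem n c s i = s i"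
  using sem_upd[of i c n s "s i"] by (metis fun_upd_same fun_upd_triv)

lemma funpow_sem_other: "i \<notin> uses c \<Longrightarrow> (sem n c ^^ m) s i = s i"
  by (induction m) (auto simp: sem_other)

lemma sem_agree: "\<forall>i\<in>R. s i = s' i \<Longrightarrow> uses c \<subseteq> R \<Longrightarrow> \<forall>i\<in>R. sem n c s i = sem n c s' i"
proof (induction c arbitrary: s s')
  case (Case j e z u)
  then have j: "s j = s' j" by auto
  show ?case
  proof (cases "s' j")
    case Nil
    then show ?thesis using Case j by simp
  next
    case (Cons b r)
    have "\<forall>i\<in>R. (s(j := r)) i = (s'(j := r)) i" using Case.prems by (simp add: fun_upd_apply)
    from Case.IH(2)[OF this] Case.IH(3)[OF this] show ?thesis using Cons j Case.prems(2) by simp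
  qed
next
  case (Loop c)
  have "\<forall>i\<in>R. (sem n c ^^ m) s i = (sem n c ^^ m) s' i" for m
    using Loop by (induction m) auto
  then show ?case by simp
next
  case (Seq a b)
  show ?case using Seq.IH(2)[OF Seq.IH(1)[OF Seq.prems(1)]] Seq.prems(2) by simp
qed (auto simp: fun_upd_apply)

text \<open>A loop of nesting depth \<open>d\<close> counts with the two stacks \<open>r + 2 * d\<close> and \<open>r + 2 * d + 1\<close>,
which hold \<open>n\<close> and \<open>0\<close> bits before and after the loop.\<close>

fun compile :: "nat \<Rightarrow> cmd \<Rightarrow> mcmd" where
  "compile r Nop = MNop"
| "compile r (Put i b) = MPush i b"
| "compile r (Case i e z u) = MCase i (compile r e) (compile r z) (compile r u)"
| "compile r (a ;; b) = MSeq (compile r a) (compile r b)"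
| "compile r (Loop c) = (let A = r + 2 * depth c; B = A + 1; body = MSeq (MPush B True) (compile r c)
     in MSeq (MWhile A body body) (MWhile B (MPush A True) (MPush A True)))"

definition ready :: "nat \<Rightarrow> nat \<Rightarrow> nat \<Rightarrow> store \<Rightarrow> bool" where
  "ready r n D s \<longleftrightarrow> (\<forall>d<D. s (r + 2 * d) = replicate n True \<and> s (r + 2 * d + 1) = [])"

lemma ready_mono: "ready r n D s \<Longrightarrow> d \<le> D \<Longrightarrow> ready r n d s"
  by (auto simp: ready_def)

lemma ready_sem: "uses c \<subseteq> {..<r} \<Longrightarrow> ready r n D (sem m c s) = ready r n D s"
  unfolding ready_def by (subst sem_other, force)+ simp

lemma ready_upd: "i \<ge> r + 2 * D \<or> i < r \<Longrightarrow> ready r n D (s(i := v)) = ready r n D s"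
  by (auto simp: ready_def)

lemma regs_below_compile:
  "uses c \<subseteq> {..<r} \<Longrightarrow> depth c \<le> D \<Longrightarrow> regs_below (r + 2 * D) (compile r c)"
  by (induction c) (auto simp: Let_def)

lemma exec_refill:
  "s B = replicate b True \<Longrightarrow> s A = replicate a True \<Longrightarrow> A \<noteq> B \<Longrightarrow>
   exec (MWhile B (MPush A True) (MPush A True)) s (2 * b + 1) (s(B := [], A := replicate (a + b) True))"
proof (induction b arbitrary: s a)
  case 0
  then have "s(B := [], A := replicate (a + 0) True) = s" by (auto simp: fun_eq_iff fun_upd_apply)
  then show ?case using exec_While_Nil[of s B] 0 by simp
next
  case (Suc b)
  let ?s = "s(B := replicate b True, A := True # s A)"
  have "exec (MPush A True) (s(B := replicate b True)) 1 ?s"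
    using exec_Push[of A True "s(B := replicate b True)"] Suc.prems by simp
  moreover have "exec (MWhile B (MPush A True) (MPush A True)) ?s (2 * b + 1)
      (?s(B := [], A := replicate (Suc a + b) True))"
    by (rule Suc.IH) (use Suc.prems in auto)
  moreover have "?s(B := [], A := replicate (Suc a + b) True) = s(B := [], A := replicate (a + Suc b) True)"
    by (auto simp: fun_eq_iff fun_upd_apply)
  ultimately show ?case
    using exec_While_Cons[of s B True "replicate b True" "MPush A True" "MPush A True" 1 ?s "2 * b + 1"] Suc.prems
    by simp
qed

lemma exec_compile:
  "uses c \<subseteq> {..<r} \<Longrightarrow> ready r n (depth c) s \<Longrightarrow> \<exists>t\<le>cost n c. exec (compile r c) s t (sem n c s)"
proof (induction c arbitrary: s)
  case Nop
  then show ?case using exec_Nop by auto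
next
  case (Put i b)
  then show ?case using exec_Push[of i b s] by auto
next
  case (Seq a b)
  obtain t where t: "t \<le> cost n a" "exec (compile r a) s t (sem n a s)"
    using Seq.IH(1)[of s] Seq.prems ready_mono[of r n "max (depth a) (depth b)"] by auto
  obtain u where u: "u \<le> cost n b" "exec (compile r b) (sem n a s) u (sem n b (sem n a s))"
    using Seq.IH(2)[of "sem n a s"] Seq.prems ready_mono[of r n "max (depth a) (depth b)"]
    by (auto simp: ready_sem)
  show ?case using exec_Seq[OF t(2) u(2)] t(1) u(1) by (intro exI[of _ "t + u + 1"]) simp
next
  case (Case i e z u)
  have d: "ready r n (depth e) s" "ready r n (depth z) (s(i := v))" "ready r n (depth u) (s(i := v))" for v
    using Case.prems ready_mono[of r n "depth (Case i e z u)"] by (auto simp: ready_upd)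
  show ?case
  proof (cases "s i")
    case Nil
    obtain t where t: "t \<le> cost n e" "exec (compile r e) s t (sem n e s)"
      using Case.IH(1)[OF _ d(1)] Case.prems by auto
    show ?thesis using exec_Case_Nil[OF Nil t(2)] t(1) Nil by (intro exI[of _ "t + 1"]) simp
  next
    case (Cons b v)
    let ?c = "if b then u else z"
    obtain t where t: "t \<le> cost n ?c" "exec (compile r ?c) (s(i := v)) t (sem n ?c (s(i := v)))"
      using Case.IH(2)[OF _ d(2)[of v]] Case.IH(3)[OF _ d(3)[of v]] Case.prems by (cases b) auto
    then have "exec (if b then compile r u else compile r z) (s(i := v)) t (sem n ?c (s(i := v)))"
      by (simp split: if_splits)
    from exec_Case_Cons[OF Cons this, of "compile r e"] show ?thesis
      using t(1) Cons by (intro exI[of _ "t + 1"]) (auto split: if_splits)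
  qed
next
  case (Loop c)
  define A B where "A = r + 2 * depth c" and "B = A + 1"
  let ?body = "MSeq (MPush B True) (compile r c)"
  have AB: "A \<notin> uses c" "B \<notin> uses c" "A \<noteq> B" using Loop.prems by (auto simp: A_def B_def)
  \<comment> \<open>\<open>A\<close> holds the rounds to come and \<open>B\<close> the rounds done.
    Neither occurs in the body, so both updates can be pulled out of the iteration.\<close>
  have loop: "\<exists>t\<le>j * (cost n c + 3) + 1. exec (MWhile A ?body ?body) s t
      (((sem n c ^^ j) s)(A := [], B := replicate (m + j) True))"
    if "s A = replicate j True" "s B = replicate m True" "ready r n (depth c) s" for j m s
    using that
  proof (induction j arbitrary: s m)
    case 0
    then have "s(A := [], B := replicate (m + 0) True) = s" by (auto simp: fun_eq_iff fun_upd_apply)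
    then show ?case using exec_While_Nil[of s A] 0 by auto
  next
    case (Suc j)
    let ?s = "s(A := replicate j True, B := True # s B)"
    have 1: "exec (MPush B True) (s(A := replicate j True)) 1 ?s"
      using exec_Push[of B True "s(A := replicate j True)"] AB by simp
    have "ready r n (depth c) ?s"
      using Suc.prems(3) by (simp add: ready_upd A_def B_def)
    then obtain t where t: "t \<le> cost n c" "exec (compile r c) ?s t (sem n c ?s)"
      using Loop.IH[of ?s] Loop.prems by auto
    let ?s1 = "sem n c ?s"
    have s1: "?s1 = (sem n c s)(A := replicate j True, B := True # s B)" using AB by (simp add: sem_upd)
    have "\<exists>t\<le>j * (cost n c + 3) + 1. exec (MWhile A ?body ?body) ?s1 t
        (((sem n c ^^ j) ?s1)(A := [], B := replicate (Suc m + j) True))"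
    proof (rule Suc.IH)
      show "?s1 A = replicate j True" "?s1 B = replicate (Suc m) True"
        unfolding s1 using AB Suc.prems by simp_all
      show "ready r n (depth c) ?s1"
        using Suc.prems(3) Loop.prems by (simp add: ready_sem ready_upd A_def B_def)
    qed
    then obtain u where u: "u \<le> j * (cost n c + 3) + 1" "exec (MWhile A ?body ?body) ?s1 u
        (((sem n c ^^ j) ?s1)(A := [], B := replicate (Suc m + j) True))" by blast
    have eq: "((sem n c ^^ j) ?s1)(A := [], B := replicate (Suc m + j) True) =
        ((sem n c ^^ Suc j) s)(A := [], B := replicate (m + Suc j) True)"
      unfolding s1 using AB
      by (simp add: funpow_sem_upd funpow_Suc_right fun_upd_twist del: funpow.simps(2))
    have "exec (MWhile A ?body ?body) s (1 + t + 1 + u + 1)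
        (((sem n c ^^ Suc j) s)(A := [], B := replicate (m + Suc j) True))"
      using exec_While_Cons[of s A True "replicate j True" ?body ?body "1 + t + 1" ?s1 u]
        exec_Seq[OF 1 t(2)] u(2) Suc.prems(1) unfolding eq by simp
    moreover have "1 + t + 1 + u + 1 \<le> Suc j * (cost n c + 3) + 1" using t(1) u(1) by simp
    ultimately show ?case by blast
  qed
  have s: "s A = replicate n True" "s B = []" "ready r n (depth c) s"
    using Loop.prems ready_mono[of r n _ s "depth c"] by (auto simp: ready_def A_def B_def)
  obtain t where t: "t \<le> n * (cost n c + 3) + 1"
    "exec (MWhile A ?body ?body) s t (((sem n c ^^ n) s)(A := [], B := replicate n True))"
    using loop[of s n 0] s by auto
  let ?s = "((sem n c ^^ n) s)(A := [], B := replicate n True)"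
  have 1: "exec (MWhile B (MPush A True) (MPush A True)) ?s (2 * n + 1) (?s(B := [], A := replicate (0 + n) True))"
    by (rule exec_refill) (use AB in auto)
  have 2: "?s(B := [], A := replicate (0 + n) True) = (sem n c ^^ n) s"
    using AB s by (auto simp: fun_eq_iff fun_upd_apply funpow_sem_other)
  have 3: "compile r (Loop c) = MSeq (MWhile A ?body ?body) (MWhile B (MPush A True) (MPush A True))"
    by (simp add: Let_def A_def B_def)
  have "exec (compile r (Loop c)) s (t + (2 * n + 1) + 1) (sem n (Loop c) s)"
    using exec_Seq[OF t(2) 1[unfolded 2]] unfolding 3 by simp
  then show ?case using t(1) by (intro exI[of _ "t + (2 * n + 1) + 1"]) simp
qed

subsection \<open>Loading the input\<close>

definition fill :: "nat \<Rightarrow> nat \<Rightarrow> nat \<Rightarrow> store \<Rightarrow> store" where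
  "fill r D m s = (\<lambda>i. if \<exists>d<D. i = r + 2 * d then replicate m True @ s i else s i)"

fun push_all :: "nat \<Rightarrow> nat \<Rightarrow> mcmd" where
  "push_all r 0 = MNop"
| "push_all r (Suc d) = MSeq (MPush (r + 2 * d) True) (push_all r d)"

lemma exec_push_all: "exec (push_all r D) s (2 * D + 1) (fill r D 1 s)"
proof (induction D arbitrary: s)
  case 0
  have "fill r 0 1 s = s" by (simp add: fill_def)
  then show ?case using exec_Nop[of s] by simp
next
  case (Suc D)
  let ?s = "s(r + 2 * D := True # s (r + 2 * D))"
  have "fill r D 1 ?s = fill r (Suc D) 1 s"
    by (auto simp: fill_def fun_eq_iff fun_upd_apply less_Suc_eq)
  then show ?case using exec_Seq[OF exec_Push[of "r + 2 * D" True s] Suc.IH[of ?s]] by (simp)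
qed

text \<open>Each bit moved also adds one \<open>True\<close> to every counter, so after loading all
  inputs the counters hold the input length in unary. The move undoes the reversal of the string
  too.\<close>

definition load :: "nat \<Rightarrow> nat \<Rightarrow> nat \<Rightarrow> nat \<Rightarrow> mcmd" where
  "load r D i j = MWhile i (MSeq (MPush j False) (push_all r D)) (MSeq (MPush j True) (push_all r D))"

lemma exec_load:
  assumes "i < r" "j < r" "i \<noteq> j" "s i = xs"
  shows "exec (load r D i j) s (length xs * (2 * D + 4) + 1)
    ((fill r D (length xs) s)(i := [], j := rev xs @ s j))"
  using assms(4)
proof (induction xs arbitrary: s)
  case Nil
  then have "(fill r D (length []) s)(i := [], j := rev [] @ s j) = s" by (auto simp: fill_def fun_eq_iff fun_upd_apply)
  then show ?case using exec_While_Nil[of s i] Nil by (simp add: load_def)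
next
  case (Cons b xs)
  let ?body = "\<lambda>b. MSeq (MPush j b) (push_all r D)"
  let ?s = "s(i := xs, j := b # s j)"
  have 1: "exec (?body b) (s(i := xs)) (2 * D + 3) (fill r D 1 ?s)"
    using exec_Seq[OF exec_Push[of j b "s(i := xs)"] exec_push_all[of r D]] assms(3)
    by (simp add: numeral_3_eq_3)
  have "fill r D 1 ?s i = xs" using assms(1,3) by (auto simp: fill_def)
  from Cons.IH[of "fill r D 1 ?s", OF this] have 2: "exec (load r D i j) (fill r D 1 ?s) (length xs * (2 * D + 4) + 1)
    ((fill r D (length xs) (fill r D 1 ?s))(i := [], j := rev xs @ fill r D 1 ?s j))" .
  have "(fill r D (length xs) (fill r D 1 ?s))(i := [], j := rev xs @ fill r D 1 ?s j) =
      (fill r D (length (b # xs)) s)(i := [], j := rev (b # xs) @ s j)"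
    using assms(1-3) by (auto simp: fill_def fun_eq_iff fun_upd_apply replicate_app_Cons_same)
  with 2 have 3: "exec (load r D i j) (fill r D 1 ?s) (length xs * (2 * D + 4) + 1)
    ((fill r D (length (b # xs)) s)(i := [], j := rev (b # xs) @ s j))" by simp
  have "exec (load r D i j) s (2 * D + 3 + (length xs * (2 * D + 4) + 1) + 1)
    ((fill r D (length (b # xs)) s)(i := [], j := rev (b # xs) @ s j))"
    using exec_While_Cons[of s i b xs "?body True" "?body False" "2 * D + 3" "fill r D 1 ?s"
        "length xs * (2 * D + 4) + 1"] Cons.prems 1 3 by (cases b) (simp_all add: load_def)
  then show ?case by (simp add: algebra_simps)
qed

definition load_all :: "nat \<Rightarrow> nat \<Rightarrow> mcmd" where
  "load_all r D = MSeq (load r D 0 3) (MSeq (load r D 1 4) (load r D 2 5))"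

definition input :: "bool list \<Rightarrow> bool list \<Rightarrow> bool list \<Rightarrow> store" where
  "input x a b = (\<lambda>_. [])(3 := b, 4 := a, 5 := x)"

lemma exec_load_all:
  assumes "6 \<le> r"
  shows "exec (load_all r D) (init_store x a b) ((length x + length a + length b) * (2 * D + 4) + 5)
    (fill r D (length x + length a + length b) (input x a b))"
proof -
  let ?s = "init_store x a b"
  let ?s1 = "(fill r D (length b) ?s)(0 := [], 3 := b)"
  let ?s2 = "(fill r D (length a) ?s1)(1 := [], 4 := a)"
  let ?s3 = "(fill r D (length x) ?s2)(2 := [], 5 := x)"
  have 1: "exec (load r D 0 3) ?s (length b * (2 * D + 4) + 1) ?s1"
    using exec_load[of 0 r 3 ?s "rev b" D] assms by (simp add: init_store_def)
  have 2: "exec (load r D 1 4) ?s1 (length a * (2 * D + 4) + 1) ?s2"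
    using exec_load[of 1 r 4 ?s1 "rev a" D] assms by (simp add: init_store_def fill_def)
  have 3: "exec (load r D 2 5) ?s2 (length x * (2 * D + 4) + 1) ?s3"
    using exec_load[of 2 r 5 ?s2 "rev x" D] assms by (simp add: init_store_def fill_def)
  have "?s3 = fill r D (length x + length a + length b) (input x a b)"
    using assms by (auto simp: fun_eq_iff fun_upd_apply fill_def init_store_def input_def replicate_add)
  moreover have "length b * (2 * D + 4) + 1 + (length a * (2 * D + 4) + 1 + (length x * (2 * D + 4) + 1) + 1) + 1 =
      (length x + length a + length b) * (2 * D + 4) + 5" by (simp add: algebra_simps)
  ultimately show ?thesis using exec_Seq[OF 1 exec_Seq[OF 2 3]] unfolding load_all_def by (simp only:)
qed

text \<open>After loading, the store differs from \<open>input\<close> only in the counters at or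
  above \<open>r\<close>, out of reach of \<open>c\<close>; \<open>sem_agree\<close> removes them
  from the result.\<close>

theorem ptime3_sem:
  assumes c: "uses c \<subseteq> {..<r}" and r: "6 \<le> r"
  shows "ptime3 (\<lambda>x a b. let s = sem (length x + length a + length b) c (input x a b)
    in if s 0 = [] then None else Some (rev (s 0)))"
proof -
  let ?D = "depth c"
  let ?p = "MSeq (load_all r ?D) (compile r c)"
  let ?T = "\<lambda>n. n * (2 * ?D + 4) + 5 + cost n c + 1"
  have ex: "\<exists>t s'. t \<le> ?T (length x + length a + length b) \<and> exec ?p (init_store x a b) t s' \<and>
     s' 0 = sem (length x + length a + length b) c (input x a b) 0" for x a b
  proof -
    let ?n = "length x + length a + length b"
    let ?s = "fill r ?D ?n (input x a b)"
    have "input x a b i = []" if "i \<ge> r" for i using that r by (simp add: input_def)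
    moreover have "r + 2 * d + 1 \<noteq> r + 2 * d'" for d d' by presburger
    ultimately have "ready r ?n ?D ?s" unfolding ready_def fill_def by auto
    from exec_compile[OF c this] obtain t where
      t: "t \<le> cost ?n c" "exec (compile r c) ?s t (sem ?n c ?s)" by blast
    have "\<forall>i\<in>{..<r}. ?s i = input x a b i" by (auto simp: fill_def)
    from sem_agree[OF this c] r have "sem ?n c ?s 0 = sem ?n c (input x a b) 0" by auto
    with exec_Seq[OF exec_load_all[OF r] t(2)] t(1) show ?thesis
      by (intro exI[of _ "?n * (2 * ?D + 4) + 5 + t + 1"] exI[of _ "sem ?n c ?s"]) simp
  qed
  have "regs_below (r + 2 * ?D) (push_all r d)" if "d \<le> ?D" for d
    using that by (induction d) auto
  then have below: "regs_below (r + 2 * ?D) ?p"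
    using regs_below_compile[OF c] r by (simp add: load_all_def load_def)
  have T: "poly_fun ?T" by (intro poly_fun_intros poly_fun_cost)
  have "\<exists>t s'. t \<le> ?T (length x + length a + length b) \<and> exec ?p (init_store x a b) t s'" for x a b
    using ex by blast
  from ex_machine[OF below _ T this] r obtain M where M: "tm_wf M" "tm_poly_time M"
    "\<forall>x a b t s'. exec ?p (init_store x a b) t s' \<longrightarrow>
       tm_result M (enc3 x a b) = (if s' 0 = [] then None else Some (rev (s' 0)))" by auto
  have "tm_result M (enc3 x a b) = (let s = sem (length x + length a + length b) c (input x a b)
    in if s 0 = [] then None else Some (rev (s 0)))" for x a b
  proof -
    obtain t s' where "exec ?p (init_store x a b) t s'"
      "s' 0 = sem (length x + length a + length b) c (input x a b) 0" using ex[of x a b] by blast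
    with M(3) show ?thesis by (simp add: Let_def)
  qed
  with M(1,2) show ?thesis unfolding ptime3_def by blast
qed

section \<open>The verifier\<close>

declare bin.simps [simp del]

abbreviation (input) "OUT \<equiv> 0 :: nat"
abbreviation (input) "P2 \<equiv> 3 :: nat"
abbreviation (input) "P1 \<equiv> 4 :: nat"
abbreviation (input) "CODE \<equiv> 5 :: nat"
abbreviation (input) "XW \<equiv> 6 :: nat"
abbreviation (input) "IN \<equiv> 7 :: nat"
abbreviation (input) "VS \<equiv> 8 :: nat"
abbreviation (input) "RES \<equiv> 9 :: nat"
abbreviation (input) "U \<equiv> 10 :: nat"
abbreviation (input) "PW \<equiv> 11 :: nat"
abbreviation (input) "T1 \<equiv> 12 :: nat"
abbreviation (input) "T2 \<equiv> 13 :: nat"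
abbreviation (input) "BIT \<equiv> 14 :: nat"
abbreviation (input) "GO \<equiv> 15 :: nat"
abbreviation (input) "CNT \<equiv> 16 :: nat"
abbreviation (input) "NN \<equiv> 17 :: nat"

lemma funpow_fixed: "f s = s \<Longrightarrow> (f ^^ m) s = s"
  by (induction m) auto

lemma funpow_Suc_apply: "(f ^^ Suc m) s = (f ^^ m) (f s)"
  by (simp add: funpow_swap1)

definition drain :: "nat \<Rightarrow> cmd \<Rightarrow> cmd \<Rightarrow> cmd" where
  "drain i z u = Loop (Case i Nop z u)"

text \<open>\<open>n\<close> rounds exhaust a stack of at most \<open>n\<close> bits and then idle.
  The stack can be emptied in advance because the bodies do not use it.\<close>

lemma sem_drain:
  assumes "i \<notin> uses z" "i \<notin> uses u" "length (s i) \<le> n"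
  shows "sem n (drain i z u) s = fold (\<lambda>b. sem n (if b then u else z)) (s i) (s(i := []))"
proof -
  let ?f = "sem n (Case i Nop z u)"
  have "(?f ^^ m) s = fold (\<lambda>b. sem n (if b then u else z)) (s i) (s(i := []))"
    if "length (s i) \<le> m" for m
    using that
  proof (induction "s i" arbitrary: s m)
    case Nil
    then have "s(i := []) = s" by (metis fun_upd_triv)
    moreover have "?f s = s" by (simp flip: Nil(1))
    ultimately show ?case by (simp add: funpow_fixed flip: Nil(1))
  next
    case (Cons b r)
    then obtain k where m: "m = Suc k" "length r \<le> k" by (cases m) (auto simp flip: Cons(2))
    let ?c = "if b then u else z"
    have fs: "?f s = sem n ?c (s(i := r))" by (simp flip: Cons(2))
    have ni: "i \<notin> uses ?c" using assms(1,2) by simp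
    have "?f s i = r" unfolding fs sem_other[OF ni] by simp
    then have "(?f ^^ k) (?f s) = fold (\<lambda>b. sem n (if b then u else z)) r ((?f s)(i := []))"
      using Cons(1)[of "?f s" k] m(2) by simp
    also have "(?f s)(i := []) = sem n ?c (s(i := []))"
      unfolding fs by (simp only: sem_upd[OF ni, symmetric] fun_upd_upd)
    also have "fold (\<lambda>b. sem n (if b then u else z)) r (sem n ?c (s(i := []))) =
        fold (\<lambda>b. sem n (if b then u else z)) (s i) (s(i := []))"
      by (simp only: Cons(2)[symmetric] fold_simps)
    finally show ?case unfolding m(1) funpow_Suc_apply .
  qed
  from this[of n] assms(3) show ?thesis by (simp add: drain_def)
qed

lemma sem_drain_unary:
  assumes "i \<notin> uses c" "s i = replicate m True" "m \<le> n"
  shows "sem n (drain i c c) s = (sem n c ^^ m) (s(i := []))"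
proof -
  have "fold (\<lambda>b. f) (replicate m True) t = (f ^^ m) t" for f and t :: store
    by (induction m arbitrary: t) (auto simp: funpow_swap1)
  then show ?thesis using sem_drain[of i c c s n] assms by simp
qed

definition "move i j = drain i (Put j False) (Put j True)"
definition "move2 i j k = drain i (Put j False ;; Put k False) (Put j True ;; Put k True)"
definition "clear i = drain i Nop Nop"
definition "copy i j = move i T1 ;; move2 T1 i j"
definition "pop i j = Case i Nop (Put j False) (Put j True)"

lemma sem_move:
  assumes "i \<noteq> j" "length (s i) \<le> n"
  shows "sem n (move i j) s = s(i := [], j := rev (s i) @ s j)"
proof -
  have "fold (\<lambda>b. sem n (if b then Put j True else Put j False)) xs t = t(j := rev xs @ t j)" for xs t
    by (induction xs arbitrary: t) (auto simp: fun_eq_iff fun_upd_apply)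
  then show ?thesis using assms by (simp add: move_def sem_drain)
qed

lemma sem_move2:
  assumes "i \<noteq> j" "i \<noteq> k" "j \<noteq> k" "length (s i) \<le> n"
  shows "sem n (move2 i j k) s = s(i := [], j := rev (s i) @ s j, k := rev (s i) @ s k)"
proof -
  have "fold (\<lambda>b. sem n (if b then Put j True ;; Put k True else Put j False ;; Put k False)) xs t =
    t(j := rev xs @ t j, k := rev xs @ t k)" for xs t
    using assms(3) by (induction xs arbitrary: t) (auto simp: fun_eq_iff fun_upd_apply)
  then show ?thesis using assms by (simp add: move2_def sem_drain)
qed

lemma sem_clear: "length (s i) \<le> n \<Longrightarrow> sem n (clear i) s = s(i := [])"
proof -
  have "fold (\<lambda>b. sem n (if b then Nop else Nop)) xs t = t" for xs t
    by (induction xs arbitrary: t) auto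
  then show "length (s i) \<le> n \<Longrightarrow> sem n (clear i) s = s(i := [])" by (simp add: clear_def sem_drain)
qed

lemma sem_copy:
  assumes "i \<noteq> j" "i \<noteq> T1" "j \<noteq> T1" "s T1 = []" "length (s i) \<le> n"
  shows "sem n (copy i j) s = s(j := s i @ s j)"
  using assms by (auto simp: copy_def sem_move sem_move2 fun_eq_iff fun_upd_apply)

lemma funpow_pop:
  assumes "i \<noteq> j"
  shows "(sem n (pop i j) ^^ m) s = s(i := drop m (s i), j := rev (take m (s i)) @ s j)"
proof (induction m arbitrary: s)
  case (Suc m)
  show ?case
  proof (cases "s i")
    case Nil
    then have "sem n (pop i j) s = s" by (simp add: pop_def)
    then show ?thesis using Nil by (simp add: funpow_fixed fun_eq_iff fun_upd_apply del: funpow.simps)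
  next
    case (Cons b r)
    then have "sem n (pop i j) s = s(i := r, j := b # s j)" using assms by (simp add: pop_def)
    then show ?thesis unfolding funpow_Suc_apply
      using Suc Cons assms by (auto simp: fun_eq_iff fun_upd_apply)
  qed
qed (simp add: fun_eq_iff fun_upd_apply)

lemmas sem_pop = funpow_pop[where m = 1, simplified]

definition "take_to i j = copy NN CNT ;; drain CNT (pop i j) (pop i j)"

lemma uses_pop [simp]: "uses (pop i j) = {i, j}"
  by (auto simp: pop_def)

lemma sem_take_to:
  assumes "i \<noteq> j" "i \<notin> {NN, CNT, T1}" "j \<notin> {NN, CNT, T1}" "s T1 = []" "s CNT = []"
    "s NN = replicate N True" "N \<le> n"
  shows "sem n (take_to i j) s = s(i := drop N (s i), j := rev (take N (s i)) @ s j)"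
  using assms sem_drain_unary[of CNT "pop i j" "s(CNT := replicate N True)" N n]
  by (simp add: take_to_def sem_copy funpow_pop fun_eq_iff fun_upd_apply)

subsection \<open>Reading numbers\<close>

definition "double = move PW T1 ;; drain T1 (Put PW True ;; Put PW True) (Put PW True ;; Put PW True)"
definition "digit b = (if b then copy PW U else Nop) ;; double"
text \<open>Numbers are turned into unary in \<open>U\<close>. Digits come least significant first,
  so \<open>PW\<close> holds the current power of two in unary and doubles; \<open>GO\<close> is
  emptied by the closing pair \<open>01\<close>, after which rounds idle.\<close>

definition "read_step =
  Case GO Nop Nop (Case XW Nop
    (Case XW Nop (digit False ;; Put GO True) Nop)
    (Case XW Nop Nop (digit True ;; Put GO True)))"
definition "readnum = Put PW True ;; Put GO True ;; Loop read_step ;; clear PW"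

definition quiet :: "store \<Rightarrow> bool" where
  "quiet s \<longleftrightarrow> s T1 = [] \<and> s PW = [] \<and> s GO = [] \<and> s U = []"

lemma sem_digit:
  assumes "s PW = replicate w True" "s T1 = []" "w \<le> n"
  shows "sem n (digit b) s =
    s(PW := replicate (2 * w) True, U := (if b then replicate w True @ s U else s U))"
proof -
  have "(sem n (Put PW True ;; Put PW True) ^^ m) t = t(PW := replicate (2 * m) True @ t PW)" for m t
    by (induction m) (auto simp: fun_eq_iff fun_upd_apply)
  then have "sem n double t = t(PW := replicate (2 * w) True)"
    if "t PW = replicate w True" "t T1 = []" for t
    using that assms(3) by (simp add: double_def sem_move sem_drain_unary fun_eq_iff fun_upd_apply)
  then show ?thesis using assms by (simp add: digit_def sem_copy fun_eq_iff fun_upd_apply)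
qed

lemma num_bin: "num (bin m) = m"
  by (induction m rule: bin.induct) (subst bin.simps, auto)

text \<open>Bounds the last value of \<open>PW\<close>, which is one doubling beyond the leading
  digit, so that the unary powers stay within \<open>n\<close>.\<close>

lemma two_power_length_bin: "m \<noteq> 0 \<Longrightarrow> 2 ^ length (bin m) \<le> 2 * m"
proof (induction m rule: bin.induct)
  case (1 m)
  show ?case
  proof (cases "m = 1")
    case True
    then show ?thesis by (simp add: bin.simps[of "Suc 0"] bin.simps[of 0])
  next
    case False
    then have "2 ^ length (bin (m div 2)) \<le> 2 * (m div 2)" using 1 by simp
    then show ?thesis using 1(2) by (simp add: bin.simps[of m])
  qed
qed

lemma funpow_read_step:
  assumes "s XW = concat (map (\<lambda>b. [b, b]) ds) @ [False, True] @ rest" "s GO = [True]"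
    "s PW = replicate w True" "s U = replicate u True" "s T1 = []"
    "w * 2 ^ length ds \<le> n" "length ds < k"
  shows "(sem n read_step ^^ k) s = s(XW := rest, GO := [], PW := replicate (w * 2 ^ length ds) True,
    U := replicate (u + w * num ds) True)"
  using assms
proof (induction ds arbitrary: s w u k)
  case Nil
  then obtain k' where k: "k = Suc k'" by (cases k) auto
  have 1: "sem n read_step s = s(XW := rest, GO := [])"
    using Nil by (simp add: read_step_def fun_eq_iff fun_upd_apply)
  have "sem n read_step (s(XW := rest, GO := [])) = s(XW := rest, GO := [])"
    by (simp add: read_step_def)
  then show ?case unfolding k funpow_Suc_apply 1
    using Nil by (simp add: funpow_fixed fun_eq_iff fun_upd_apply)
next
  case (Cons b ds)
  then obtain k' where k: "k = Suc k'" by (cases k) auto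
  let ?s = "s(XW := concat (map (\<lambda>b. [b, b]) ds) @ [False, True] @ rest,
    PW := replicate (2 * w) True, U := (if b then replicate w True @ s U else s U))"
  have "w * 1 \<le> w * 2 ^ length (b # ds)" by (intro mult_le_mono) auto
  then have w: "w \<le> n" using Cons.prems(6) by linarith
  have 1: "sem n read_step s = ?s"
    using Cons.prems w
    by (cases b) (auto simp: read_step_def sem_digit fun_eq_iff fun_upd_apply)
  have "(sem n read_step ^^ k') ?s = ?s(XW := rest, GO := [], PW := replicate (2 * w * 2 ^ length ds) True,
    U := replicate ((of_bool b * w + u) + 2 * w * num ds) True)"
    by (rule Cons.IH) (use Cons.prems k in \<open>auto simp: algebra_simps simp flip: replicate_add\<close>)
  then show ?case unfolding k funpow_Suc_apply 1
    by (simp add: fun_eq_iff fun_upd_apply algebra_simps)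
qed

lemma sem_readnum:
  assumes "quiet s" "s XW = enc_nat m @ rest" "2 * m + 1 \<le> n"
  shows "sem n readnum s = s(XW := rest, U := replicate m True)"
proof -
  let ?s = "s(PW := [True], GO := [True])"
  have le: "2 ^ length (bin m) \<le> n" using two_power_length_bin[of m] assms(3) by (cases "m = 0") (simp_all add: bin.simps[of 0])
  then have "length (bin m) < n" using less_exp[of "length (bin m)"] by linarith
  then have "(sem n read_step ^^ n) ?s = ?s(XW := rest, GO := [],
     PW := replicate (1 * 2 ^ length (bin m)) True, U := replicate (0 + 1 * num (bin m)) True)"
    using assms le by (intro funpow_read_step) (auto simp: quiet_def enc_nat_def)
  then show ?thesis using assms le
    by (simp add: readnum_def sem_clear num_bin quiet_def fun_eq_iff fun_upd_apply)
qed

subsection \<open>Evaluating circuits\<close>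

text \<open>Circuit inputs, gate values and outputs are kept with the last bit on top of the stack.\<close>

definition "lookup R = move R T1 ;; drain U (pop T1 R) (pop T1 R) ;;
  Case T1 Nop (Put R False ;; Put BIT False) (Put R True ;; Put BIT True) ;; move T1 R"

lemma sem_lookup:
  assumes "R \<notin> {U, T1, BIT}" "s R = rev vs" "s U = replicate j True" "j < length vs" "length vs \<le> n"
    "s T1 = []"
  shows "sem n (lookup R) s = s(U := [], BIT := vs ! j # s BIT)"
proof -
  let ?s1 = "s(R := rev (take j vs), T1 := drop j vs, U := [])"
  have "sem n (drain U (pop T1 R) (pop T1 R)) (s(R := [], T1 := vs)) = ?s1"
    using assms by (subst sem_drain_unary[of U _ _ j]) (auto simp: funpow_pop fun_eq_iff fun_upd_apply)
  then have 1: "sem n (lookup R) s = sem n (Case T1 Nop (Put R False ;; Put BIT False)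
      (Put R True ;; Put BIT True) ;; move T1 R) ?s1"
    using assms by (simp add: lookup_def sem_move)
  have d: "drop j vs = vs ! j # drop (Suc j) vs" using assms(4) by (simp add: Cons_nth_drop_Suc)
  have r: "rev (drop (Suc j) vs) @ vs ! j # rev (take j vs) = rev vs"
    using arg_cong[OF id_take_nth_drop[OF assms(4)], of rev] by simp
  show ?thesis unfolding 1 using assms r
    by (cases "vs ! j") (auto simp: d sem_move fun_eq_iff fun_upd_apply)
qed

definition "arg R = readnum ;; lookup R"

lemma sem_arg:
  assumes "quiet s" "s XW = enc_nat j @ rest" "R \<notin> {XW, U, T1, BIT}" "s R = rev vs" "j < length vs"
    "2 * length vs \<le> n"
  shows "sem n (arg R) s = s(XW := rest, BIT := vs ! j # s BIT)"
proof -
  have "sem n readnum s = s(XW := rest, U := replicate j True)"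
    using assms by (intro sem_readnum) auto
  then show ?thesis using assms sem_lookup[of R "s(XW := rest, U := replicate j True)" vs j n]
    by (simp add: arg_def quiet_def; simp add: fun_eq_iff fun_upd_apply)
qed

text \<open>The opcode is in unary in \<open>U\<close>; each nested case takes off one bit, and its
  two nonempty branches coincide. The second operand is popped first, which is harmless as both
  connectives are symmetric.\<close>

definition "gate = readnum ;;
  (let un = (\<lambda>z u. Case BIT Nop (Put VS z) (Put VS u));
       bin = (\<lambda>ff ft tt. Case BIT Nop (Case BIT Nop (Put VS ff) (Put VS ft)) (Case BIT Nop (Put VS ft) (Put VS tt)));
       g4 = arg VS ;; arg VS ;; bin False True True;
       g3 = arg VS ;; arg VS ;; bin False False True;
       d3 = Case U g3 g4 g4;
       d2 = Case U (arg VS ;; un True False) d3 d3;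
       d1 = Case U (readnum ;; Case U (Put VS False) (Put VS True) (Put VS True)) d2 d2
   in Case U (arg IN ;; un False True) d1 d1)"

text \<open>The bound 9 is \<open>2 * 4 + 1\<close>, the requirement of \<open>sem_readnum\<close>
  for the largest opcode; the others serve operands and lookups.\<close>

lemma sem_gate:
  assumes q: "quiet s" and XW: "s XW = enc_gate g @ rest" and IN: "s IN = rev x" and VS: "s VS = rev vs"
    and BIT: "s BIT = []" and wf: "gate_wf (length x) (length vs) g"
    and n: "2 * length x \<le> n" "2 * length vs \<le> n" "9 \<le> n"
  shows "sem n gate s = s(XW := rest, VS := gate_val x vs g # rev vs)"
proof -
  have rd: "sem n readnum s = s(XW := r, U := replicate m True)" if "s XW = enc_nat m @ r" "m \<le> 4" for m r
    using sem_readnum[OF q that(1)] that(2) n(3) by simp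
  have q': "quiet t" if "\<And>i. i \<in> {T1, PW, GO, U} \<Longrightarrow> t i = []" for t
    using that by (auto simp: quiet_def)
  note upd = fun_eq_iff fun_upd_apply
  note q0 = q[unfolded quiet_def]
  show ?thesis
  proof (cases g)
    case (GInput j)
    let ?s = "s(XW := enc_nat j @ rest, U := [])"
    have "sem n (arg IN) ?s = ?s(XW := rest, BIT := x ! j # ?s BIT)"
      using GInput wf n q0 IN by (intro sem_arg) (auto simp: gate_wf_def quiet_def)
    then show ?thesis using rd[of 0 "enc_nat j @ rest"] XW GInput BIT VS q0
      by (simp add: gate_def gate_val_def Let_def) (auto simp: upd)
  next
    case (GConst b)
    let ?s = "s(XW := enc_nat (if b then 1 else 0) @ rest, U := [])"
    have "sem n readnum ?s = ?s(XW := rest, U := replicate (if b then 1 else 0) True)"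
      using n q0 by (intro sem_readnum) (auto simp: quiet_def)
    then show ?thesis using rd[of 1 "enc_nat (if b then 1 else 0) @ rest"] XW GConst BIT VS q0
      by (cases b) (simp_all add: gate_def gate_val_def Let_def, auto simp: upd)
  next
    case (GNot j)
    let ?s = "s(XW := enc_nat j @ rest, U := [])"
    have "sem n (arg VS) ?s = ?s(XW := rest, BIT := vs ! j # ?s BIT)"
      using GNot wf n q0 VS by (intro sem_arg) (auto simp: gate_wf_def quiet_def)
    then show ?thesis using rd[of 2 "enc_nat j @ rest"] XW GNot BIT VS q0
      by (simp add: gate_def gate_val_def Let_def numeral_eq_Suc) (auto simp: upd)
  next
    case (GAnd j k)
    let ?s = "s(XW := enc_nat j @ enc_nat k @ rest, U := [])"
    let ?s' = "s(XW := enc_nat k @ rest, U := [], BIT := [vs ! j])"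
    have "sem n (arg VS) ?s = ?s(XW := enc_nat k @ rest, BIT := vs ! j # ?s BIT)"
      using GAnd wf n q0 VS by (intro sem_arg) (auto simp: gate_wf_def quiet_def)
    also have "\<dots> = ?s'" using BIT by (auto simp: upd)
    finally have "sem n (arg VS) ?s = ?s'" .
    moreover have "sem n (arg VS) ?s' = ?s'(XW := rest, BIT := vs ! k # ?s' BIT)"
      using GAnd wf n q0 VS by (intro sem_arg) (auto simp: gate_wf_def quiet_def)
    ultimately show ?thesis using rd[of 3 "enc_nat j @ enc_nat k @ rest"] XW GAnd BIT VS q0
      by (simp add: gate_def gate_val_def Let_def numeral_eq_Suc) (auto simp: upd)
  next
    case (GOr j k)
    let ?s = "s(XW := enc_nat j @ enc_nat k @ rest, U := [])"
    let ?s' = "s(XW := enc_nat k @ rest, U := [], BIT := [vs ! j])"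
    have "sem n (arg VS) ?s = ?s(XW := enc_nat k @ rest, BIT := vs ! j # ?s BIT)"
      using GOr wf n q0 VS by (intro sem_arg) (auto simp: gate_wf_def quiet_def)
    also have "\<dots> = ?s'" using BIT by (auto simp: upd)
    finally have "sem n (arg VS) ?s = ?s'" .
    moreover have "sem n (arg VS) ?s' = ?s'(XW := rest, BIT := vs ! k # ?s' BIT)"
      using GOr wf n q0 VS by (intro sem_arg) (auto simp: gate_wf_def quiet_def)
    ultimately show ?thesis using rd[of 4 "enc_nat j @ enc_nat k @ rest"] XW GOr BIT VS q0
      by (simp add: gate_def gate_val_def Let_def numeral_eq_Suc) (auto simp: upd)
  qed
qed

abbreviation (input) "DEP \<equiv> 18 :: nat"
abbreviation (input) "TP \<equiv> 19 :: nat"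
abbreviation (input) "MODE \<equiv> 20 :: nat"
abbreviation (input) "Y \<equiv> 21 :: nat"
abbreviation (input) "XP \<equiv> 22 :: nat"
abbreviation (input) "W \<equiv> 23 :: nat"
abbreviation (input) "NEQ \<equiv> 24 :: nat"
abbreviation (input) "LT \<equiv> 25 :: nat"
abbreviation (input) "SV \<equiv> 26 :: nat"
abbreviation (input) "REF \<equiv> 27 :: nat"
abbreviation (input) "Z \<equiv> 28 :: nat"

lemma funpow_gate:
  assumes "quiet s" "s XW = concat (map enc_gate gs) @ rest" "s IN = rev x" "s VS = rev vs" "s BIT = []"
    "\<forall>i<length gs. gate_wf (length x) (length vs + i) (gs ! i)"
    "2 * length x \<le> n" "2 * (length vs + length gs) \<le> n" "9 \<le> n"
  shows "(sem n gate ^^ length gs) s =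
    s(XW := rest, VS := rev (foldl (\<lambda>vs g. vs @ [gate_val x vs g]) vs gs))"
  using assms
proof (induction gs arbitrary: s vs)
  case Nil
  then show ?case by (simp add: fun_eq_iff fun_upd_apply)
next
  case (Cons g gs)
  let ?s = "s(XW := concat (map enc_gate gs) @ rest, VS := rev (vs @ [gate_val x vs g]))"
  have "sem n gate s = s(XW := concat (map enc_gate gs) @ rest, VS := gate_val x vs g # rev vs)"
  proof (rule sem_gate)
    show "gate_wf (length x) (length vs) g" using Cons.prems(6) by force
  qed (use Cons.prems in auto)
  then have 1: "sem n gate s = ?s" by simp
  have "(sem n gate ^^ length gs) ?s = ?s(XW := rest,
      VS := rev (foldl (\<lambda>vs g. vs @ [gate_val x vs g]) (vs @ [gate_val x vs g]) gs))"
  proof (rule Cons.IH)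
    show "\<forall>i<length gs. gate_wf (length x) (length (vs @ [gate_val x vs g]) + i) (gs ! i)"
      using Cons.prems(6) by force
  qed (use Cons.prems in \<open>auto simp: quiet_def\<close>)
  then show ?case by (simp add: funpow_swap1 1; simp add: fun_eq_iff fun_upd_apply)
qed

definition "outbit = arg VS ;; pop BIT RES"

lemma funpow_outbit:
  assumes "quiet s" "s XW = concat (map enc_nat os) @ rest" "s VS = rev vs" "s BIT = []"
    "\<forall>j\<in>set os. j < length vs" "2 * length vs \<le> n"
  shows "(sem n outbit ^^ length os) s = s(XW := rest, RES := rev (map ((!) vs) os) @ s RES)"
  using assms
proof (induction os arbitrary: s)
  case Nil
  then show ?case by (simp add: fun_eq_iff fun_upd_apply)
next
  case (Cons j os)
  let ?s = "s(XW := concat (map enc_nat os) @ rest, RES := vs ! j # s RES)"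
  have "sem n (arg VS) s = s(XW := concat (map enc_nat os) @ rest, BIT := vs ! j # s BIT)"
    by (rule sem_arg) (use Cons.prems in auto)
  then have 1: "sem n outbit s = ?s" using Cons.prems(4)
    by (simp add: outbit_def sem_pop; simp add: fun_eq_iff fun_upd_apply)
  have "(sem n outbit ^^ length os) ?s = ?s(XW := rest, RES := rev (map ((!) vs) os) @ ?s RES)"
    by (rule Cons.IH) (use Cons.prems in \<open>auto simp: quiet_def\<close>)
  then show ?case by (simp add: funpow_swap1 1; simp add: fun_eq_iff fun_upd_apply)
qed

definition "eval_circuit = copy CODE XW ;; readnum ;; clear U ;; readnum ;; move U CNT ;;
  drain CNT gate gate ;; readnum ;; move U CNT ;; drain CNT outbit outbit ;; clear VS ;; clear IN"

definition calm :: "store \<Rightarrow> bool" where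
  "calm s \<longleftrightarrow> quiet s \<and> (\<forall>i\<in>{BIT, XW, VS, RES, CNT, T2}. s i = [])"

lemma length_enc_nat: "2 \<le> length (enc_nat m)"
  by (simp add: enc_nat_def)

lemma length_enc_gate: "2 \<le> length (enc_gate g)"
  using length_enc_nat by (cases g) (auto intro: trans_le_add1)

text \<open>Every number costs at least the two bits of its terminator. Hence gate indices and
  counts are at most linear in the code length, and unary arithmetic is affordable.\<close>

lemma length_enc_circuit:
  "2 * length (c_gates C) + 2 * length (c_outputs C) + 6 \<le> length (enc_circuit C)"
proof -
  have "2 * length xs \<le> length (concat (map f xs))" if "\<And>x. 2 \<le> length (f x)" for f :: "'b \<Rightarrow> bool list" and xs
  proof (induction xs)
    case (Cons x xs)
    then show ?case using that[of x] by simp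
  qed simp
  from this[of enc_gate, OF length_enc_gate, of "c_gates C"] this[of enc_nat, OF length_enc_nat, of "c_outputs C"]
  show ?thesis
    using length_enc_nat[of "c_inputs C"] length_enc_nat[of "length (c_gates C)"]
      length_enc_nat[of "length (c_outputs C)"] by (simp add: enc_circuit_def)
qed

lemma length_gate_vals: "length (gate_vals x gs) = length gs"
proof -
  have "length (foldl (\<lambda>vs g. vs @ [gate_val x vs g]) vs gs) = length vs + length gs" for vs
    by (induction gs arbitrary: vs) auto
  then show ?thesis by (simp add: gate_vals_def)
qed

lemma uses_move [simp]: "uses (move i j) = {i, j}" and uses_drain [simp]: "uses (drain i z u) = {i} \<union> uses z \<union> uses u"
  by (auto simp: move_def drain_def)

lemma uses_basic [simp]: "uses (clear i) = {i}" "uses (copy i j) = {i, j, T1}"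
  by (auto simp: clear_def copy_def move2_def)

lemma uses_readnum [simp]: "uses readnum = {PW, GO, XW, T1, U}"
  by (auto simp: readnum_def read_step_def digit_def double_def)

lemma uses_arg [simp]: "uses (arg R) = {PW, GO, XW, T1, U, BIT, R}"
  by (auto simp: arg_def lookup_def)

lemma uses_gate [simp]: "uses gate = {PW, GO, XW, T1, U, BIT, VS, IN}"
  by (auto simp: gate_def Let_def)

lemma uses_outbit [simp]: "uses outbit = {PW, GO, XW, T1, U, BIT, VS, RES}"
  by (auto simp: outbit_def)

lemma sem_eval_circuit:
  assumes calm: "calm s" and CODE: "s CODE = enc_circuit C" and IN: "s IN = rev x"
    and wf: "circuit_wf C" "c_inputs C = length x" "2 * length x = length (c_outputs C)"
    and n: "3 * length (enc_circuit C) \<le> n"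
  shows "sem n eval_circuit s = s(IN := [], RES := rev (circuit_eval C x))"
proof -
  let ?gs = "c_gates C" and ?os = "c_outputs C" and ?vs = "gate_vals x (c_gates C)"
  have len: "2 * length ?gs + 2 * length ?os + 6 \<le> length (enc_circuit C)" by (rule length_enc_circuit)
  note c = calm[unfolded calm_def quiet_def, simplified]
  \<comment> \<open>The suffixes of the code that remain after each reading phase.\<close>
  define r4 where "r4 = concat (map enc_nat ?os)"
  define r3 where "r3 = enc_nat (length ?os) @ r4"
  define r2 where "r2 = concat (map enc_gate ?gs) @ r3"
  define r1 where "r1 = enc_nat (length ?gs) @ r2"
  have enc: "enc_circuit C = enc_nat (length x) @ r1"
    by (simp add: enc_circuit_def r1_def r2_def r3_def r4_def wf)
  have rd: "sem n readnum t = t(XW := r, U := replicate m True)"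
    if "quiet t" "t XW = enc_nat m @ r" "2 * m + 1 \<le> n" for t m r
    using that by (rule sem_readnum)
  have 1: "sem n (copy CODE XW) s = s(XW := enc_circuit C)"
    using c n by (simp add: sem_copy CODE)
  have 2: "sem n readnum (s(XW := enc_circuit C)) = s(XW := r1, U := replicate (length x) True)"
    using rd[of "s(XW := enc_circuit C)" "length x" r1] c len n enc wf(3) by (simp add: quiet_def)
  have 3: "sem n (clear U) (s(XW := r1, U := replicate (length x) True)) = s(XW := r1)"
    using c len n wf(3) by (simp add: sem_clear; simp add: fun_eq_iff fun_upd_apply)
  have 4: "sem n readnum (s(XW := r1)) = s(XW := r2, U := replicate (length ?gs) True)"
    using rd[of "s(XW := r1)" "length ?gs" r2] c len n by (simp add: quiet_def r1_def)
  have 5: "sem n (move U CNT) (s(XW := r2, U := replicate (length ?gs) True)) =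
      s(XW := r2, CNT := replicate (length ?gs) True)"
    using c len n by (simp add: sem_move; simp add: fun_eq_iff fun_upd_apply)
  have g: "(sem n gate ^^ length ?gs) (s(XW := r2)) = s(XW := r3, VS := rev ?vs)"
    using c len n wf funpow_gate[of "s(XW := r2)" ?gs r3 x "[]" n] IN
    by (simp add: r2_def quiet_def circuit_wf_def gate_vals_def)
  have 6: "sem n (drain CNT gate gate) (s(XW := r2, CNT := replicate (length ?gs) True)) =
      s(XW := r3, VS := rev ?vs)"
    using c len n sem_drain_unary[of CNT gate "s(XW := r2, CNT := replicate (length ?gs) True)" "length ?gs" n]
    by (simp add: fun_upd_idem g)
  have 7: "sem n readnum (s(XW := r3, VS := rev ?vs)) =
      s(XW := r4, VS := rev ?vs, U := replicate (length ?os) True)"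
    using rd[of "s(XW := r3, VS := rev ?vs)" "length ?os" r4] c len n
    by (simp add: quiet_def r3_def; simp add: fun_eq_iff fun_upd_apply)
  have 8: "sem n (move U CNT) (s(XW := r4, VS := rev ?vs, U := replicate (length ?os) True)) =
      s(XW := r4, VS := rev ?vs, CNT := replicate (length ?os) True)"
    using c len n by (simp add: sem_move; simp add: fun_eq_iff fun_upd_apply)
  have o: "(sem n outbit ^^ length ?os) (s(XW := r4, VS := rev ?vs)) =
      s(VS := rev ?vs, RES := rev (circuit_eval C x))"
    using c len n wf funpow_outbit[of "s(XW := r4, VS := rev ?vs)" ?os "[]" ?vs n]
    by (simp add: r4_def quiet_def circuit_wf_def length_gate_vals circuit_eval_def; simp add: fun_eq_iff fun_upd_apply)
  have "s(XW := r4, VS := rev ?vs, CNT := []) = s(XW := r4, VS := rev ?vs)"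
    using c by (simp add: fun_eq_iff fun_upd_apply)
  then have 9: "sem n (drain CNT outbit outbit) (s(XW := r4, VS := rev ?vs, CNT := replicate (length ?os) True)) =
      s(VS := rev ?vs, RES := rev (circuit_eval C x))"
    using c len n o sem_drain_unary[of CNT outbit "s(XW := r4, VS := rev ?vs, CNT := replicate (length ?os) True)"
        "length ?os" n] by simp
  have "sem n (clear VS ;; clear IN) (s(VS := rev ?vs, RES := rev (circuit_eval C x))) =
      s(IN := [], RES := rev (circuit_eval C x))"
    using c len n wf IN by (simp add: sem_clear length_gate_vals; simp add: fun_eq_iff fun_upd_apply)
  then show ?thesis unfolding eval_circuit_def sem.simps 1 2 3 4 5 6 7 8 9 .
qed

subsection \<open>Comparisons\<close>

text \<open>Popping first keeps the flag at one bit, however often it is set.\<close>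

definition "set_flag f = Case f Nop Nop Nop ;; Put f True"
definition "neq i j f = drain i (Case j (set_flag f) Nop (set_flag f)) (Case j (set_flag f) (set_flag f) Nop)"
text \<open>The least significant bit is on top, so each difference overrides the earlier ones and
  equal bits keep the verdict so far.\<close>

definition "smaller i j f = drain i (Case j Nop Nop (set_flag f)) (Case j Nop (Case f Nop Nop Nop) Nop)"

lemma uses_compare [simp]: "uses (neq i j f) = {i, j, f}" "uses (smaller i j f) = {i, j, f}"
  by (auto simp: neq_def smaller_def set_flag_def)

lemma sem_set_flag: "s f \<in> {[], [True]} \<Longrightarrow> sem n (set_flag f) s = s(f := [True])"
  by (auto simp: set_flag_def)

lemma sem_neq:
  assumes "length (s i) = length (s j)" "length (s i) \<le> n" "i \<noteq> j" "i \<noteq> f" "j \<noteq> f" "s f \<in> {[], [True]}"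
  shows "sem n (neq i j f) s = s(i := [], j := [], f := if s i = s j then s f else [True])"
proof -
  let ?step = "\<lambda>b. sem n (if b then Case j (set_flag f) (set_flag f) Nop else Case j (set_flag f) Nop (set_flag f))"
  have "fold ?step xs t = t(j := [], f := if xs = ys then t f else [True])"
    if "length xs = length ys" "t j = ys" "t f \<in> {[], [True]}" for xs ys t
    using that
  proof (induction xs ys arbitrary: t rule: list_induct2)
    case Nil
    then show ?case by (simp add: fun_eq_iff fun_upd_apply)
  next
    case (Cons x xs y ys)
    have 1: "?step x t = t(j := ys, f := if x = y then t f else [True])"
      using Cons.prems assms(5)
      by (cases x; cases y) (auto simp: sem_set_flag fun_eq_iff fun_upd_apply)
    have "fold ?step xs (?step x t) = (?step x t)(j := [], f := if xs = ys then ?step x t f else [True])"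
      unfolding 1 by (rule Cons.IH) (use Cons.prems assms(5) in auto)
    then show ?case unfolding fold_simps 1
      using assms(5) by (simp add: fun_eq_iff fun_upd_apply)
  qed
  from this[of "s i" "s j" "s(i := [])"]
  have "fold ?step (s i) (s(i := [])) = s(i := [], j := [], f := if s i = s j then s f else [True])"
    using assms by (auto simp: fun_eq_iff fun_upd_apply)
  moreover have "sem n (neq i j f) s = fold ?step (s i) (s(i := []))"
    unfolding neq_def using assms by (intro sem_drain) (auto simp: set_flag_def)
  ultimately show ?thesis by simp
qed

lemma sem_smaller:
  assumes "length (s i) = length (s j)" "length (s i) \<le> n" "i \<noteq> j" "i \<noteq> f" "j \<noteq> f" "s f = []"
  shows "sem n (smaller i j f) s = s(i := [], j := [], f := if num (s i) < num (s j) then [True] else [])"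
proof -
  let ?step = "\<lambda>b. sem n (if b then Case j Nop (Case f Nop Nop Nop) Nop else Case j Nop Nop (set_flag f))"
  have "fold ?step xs t = t(j := [], f := if xs = ys then t f else if num xs < num ys then [True] else [])"
    if "length xs = length ys" "t j = ys" "t f \<in> {[], [True]}" for xs ys t
    using that
  proof (induction xs ys arbitrary: t rule: list_induct2)
    case Nil
    then show ?case by (simp add: fun_eq_iff fun_upd_apply)
  next
    case (Cons x xs y ys)
    have 1: "?step x t = t(j := ys, f := if x = y then t f else if y then [True] else [])"
      using Cons.prems assms(5)
      by (cases x; cases y) (auto simp: sem_set_flag fun_eq_iff fun_upd_apply)
    have 2: "fold ?step xs (?step x t) =
        (?step x t)(j := [], f := if xs = ys then ?step x t f else if num xs < num ys then [True] else [])"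
      unfolding 1 by (rule Cons.IH) (use Cons.prems assms(5) in auto)
    have "num xs \<noteq> num ys" if "xs \<noteq> ys" using num_inj[OF Cons.hyps] that by blast
    then have 3: "num (x # xs) < num (y # ys) \<longleftrightarrow> (if xs = ys then \<not> x \<and> y else num xs < num ys)"
      by (cases x; cases y) auto
    show ?case unfolding fold_simps 2 unfolding 1 3
      using assms(5) by (auto simp: fun_eq_iff fun_upd_apply)
  qed
  from this[of "s i" "s j" "s(i := [])"]
  have "fold ?step (s i) (s(i := [])) = s(i := [], j := [], f := if num (s i) < num (s j) then [True] else [])"
    using assms by (auto simp: fun_eq_iff fun_upd_apply)
  moreover have "sem n (smaller i j f) s = fold ?step (s i) (s(i := []))"
    unfolding smaller_def using assms by (intro sem_drain) (auto simp: set_flag_def)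
  ultimately show ?thesis by simp
qed

text \<open>\<open>MODE\<close> is empty as long as the walk is on the certified path; it contains \<open>True\<close> in a subtree whose root has a
claimed label, the current label being in \<open>IN\<close>, and \<open>False\<close> to the right of the path, where nothing is
claimed. \<open>DEP\<close> is the height of the current node in unary.\<close>

definition "get_half b = take_to RES T2 ;;
  (if b then clear RES ;; move T2 IN else clear T2 ;; move RES T2 ;; move T2 IN)"

definition "inside b = eval_circuit ;; get_half b ;; Put MODE True"
definition "ended b = copy Y RES ;; get_half b ;; Put MODE True"
text \<open>The label field is always consumed into \<open>IN\<close>. It is kept only when the walk
  goes left where the certified path goes right, the one case in which it is a claimed
  label.\<close>

definition "branch b =
  (let fin = (\<lambda>u. take_to P1 IN ;; (if b = u then clear IN else if u then Put MODE True
                                   else clear IN ;; Put MODE False))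
   in Case P1 Nop (fin False) (fin True))"
definition "on_path b = Case P1 (ended b) (ended b) (branch b)"
definition "descend b = (let c = Put TP b ;; Case MODE (on_path b) (Put MODE False) (inside b) in Case DEP Nop c c)"
definition "walk_step = Case P2 Nop (Case P2 Nop Nop Nop) (Case P2 Nop (descend False) (descend True))"

text \<open>\<open>RES\<close> holds the claimed content. At a leaf it is compared with the path. A
  preimage \<open>x'\<close> of it counts only if \<open>LT\<close> is set: always at the end of the
  certified path, and otherwise if \<open>x'\<close> is smaller than the claimed label.\<close>

definition "check = Case DEP (copy RES W ;; neq W TP REF) Nop Nop ;; move RES W ;;
  move XP T2 ;; move T2 IN ;; eval_circuit ;; move RES Z ;; neq W Z NEQ ;;
  Case NEQ (Case LT Nop Nop (Put REF True)) Nop Nop"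
definition "check_inside = copy IN SV ;; copy XP W ;; smaller W SV LT ;; eval_circuit ;; check"
definition "check_end = copy Y RES ;; Put LT True ;; check"
text \<open>A case pops what it tests, hence \<open>Put DEP True\<close> to restore the height. A
  walk that stops on the unfinished certified path, or where nothing is claimed, refutes
  nothing.\<close>

definition "finish = (let c = Put DEP True ;; Case P1 check_end check_end Nop
   in Case MODE (Case DEP check_end c c) Nop check_inside) ;; Case REF (copy Y OUT) Nop Nop"

definition "setup = copy CODE XW ;; readnum ;; clear XW ;; move U NN ;; copy NN DEP ;; copy NN DEP ;;
  take_to P1 Y ;; take_to P1 Y ;; take_to P2 XP"

definition "verifier = setup ;; Loop walk_step ;; finish"

text \<open>The refuter's path is padded with pairs that start with \<open>False\<close>, so that all refuters have the same length.\<close>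

fun path :: "bool list \<Rightarrow> bool list" where
  "path (True # b # r) = b # path r"
| "path (False # b # r) = path r"
| "path _ = []"

section \<open>Correctness of the verifier on codes of circuits\<close>

locale avoid =
  fixes C :: circuit and n :: nat
  assumes wf: "circuit_wf C" and outputs: "length (c_outputs C) = 2 * c_inputs C"
    and inputs: "1 \<le> c_inputs C" and n: "3 * length (enc_circuit C) \<le> n"
begin

abbreviation "N \<equiv> c_inputs C"

sublocale stretch "c_inputs C" "circuit_eval C"
  by standard (use inputs outputs in \<open>auto simp: circuit_eval_def\<close>)

lemma N_le: "12 * N + 18 \<le> n"
  using length_enc_circuit[of C] outputs n by simp

text \<open>The stores between two rounds. All scratch stacks are empty; strings are kept reversed,
  except for the certificate and the path, which are still to be read.\<close>

definition st :: "nat \<Rightarrow> bool list \<Rightarrow> bool list \<Rightarrow> bool list \<Rightarrow> bool list \<Rightarrow> bool list \<Rightarrow> bool list \<Rightarrow> bool list \<Rightarrow> store" where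
  "st d q p p2 mode cur y x' = (\<lambda>_. [])(CODE := enc_circuit C, NN := replicate N True,
     DEP := replicate d True, TP := rev q, P1 := p, P2 := p2, MODE := mode, IN := rev cur,
     Y := rev y, XP := rev x')"

lemma sem_get_half:
  assumes "s RES = rev y" "length y = 2 * N" "s IN = []" "s T1 = []" "s T2 = []" "s CNT = []"
    "s NN = replicate N True"
  shows "sem n (get_half b) s = s(RES := [], IN := rev (half b y))"
  using assms N_le
  by (cases b) (simp_all add: get_half_def sem_take_to sem_clear sem_move half_def take_rev drop_rev,
      simp_all add: fun_eq_iff fun_upd_apply)

lemma sem_eval:
  assumes "calm s" "s CODE = enc_circuit C" "s IN = rev x" "length x = N"
  shows "sem n eval_circuit s = s(IN := [], RES := rev (circuit_eval C x))"
  by (rule sem_eval_circuit) (use assms wf outputs n in auto)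

lemma sem_inside:
  assumes "length cur = N"
  shows "sem n (inside b) (st d q p p2 [] cur y x') =
    st d q p p2 [True] (half b (circuit_eval C cur)) y x'"
proof -
  have "sem n eval_circuit (st d q p p2 [] cur y x') =
    (st d q p p2 [] cur y x')(IN := [], RES := rev (circuit_eval C cur))"
    by (rule sem_eval) (use assms in \<open>simp_all add: calm_def quiet_def st_def\<close>)
  then show ?thesis
    using assms by (simp add: inside_def sem_get_half length_F st_def; simp add: fun_eq_iff fun_upd_apply)
qed

lemma sem_ended:
  assumes "length y = 2 * N"
  shows "sem n (ended b) (st d q p p2 [] [] y x') = st d q p p2 [True] (half b y) y x'"
  using assms N_le
  by (simp add: ended_def sem_copy sem_get_half st_def; simp add: fun_eq_iff fun_upd_apply)

lemma st_simps [simp]: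
  "st d q p p2 mode cur y x' P1 = p" "st d q p p2 mode cur y x' P2 = p2"
  "st d q p p2 mode cur y x' MODE = mode" "st d q p p2 mode cur y x' DEP = replicate d True"
  "st d q p p2 mode cur y x' TP = rev q" "st d q p p2 mode cur y x' Y = rev y"
  "st d q p p2 mode cur y x' OUT = []" "st d q p p2 mode cur y x' T1 = []" "st d q p p2 mode cur y x' REF = []"
  "(st d q p p2 mode cur y x')(P1 := p') = st d q p' p2 mode cur y x'"
  "(st d q p p2 mode cur y x')(P2 := p2') = st d q p p2' mode cur y x'"
  "(st d q p p2 mode cur y x')(MODE := mode') = st d q p p2 mode' cur y x'"
  "(st d q p p2 mode cur y x')(DEP := replicate d' True) = st d' q p p2 mode cur y x'"
  "(st d q p p2 mode cur y x')(DEP := True # replicate d' True) = st (Suc d') q p p2 mode cur y x'"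
  "(st d q p p2 mode cur y x')(TP := b # rev q) = st d (q @ [b]) p p2 mode cur y x'"
  by (simp_all add: st_def fun_eq_iff fun_upd_apply)

lemma sem_branch:
  assumes "p \<noteq> []" "length p \<ge> N + 1"
  shows "sem n (branch b) (st d q p p2 [] [] y x') =
    (if b = hd p then st d q (drop (N + 1) p) p2 [] [] y x'
     else if hd p then st d q (drop (N + 1) p) p2 [True] (take N (tl p)) y x'
     else st d q (drop (N + 1) p) p2 [False] [] y x')"
proof -
  obtain u p' where p: "p = u # p'" using assms(1) by (cases p) auto
  have t: "sem n (take_to P1 IN) (st d q p' p2 [] [] y x') = st d q (drop N p') p2 [] (take N p') y x'"
    using N_le by (simp add: sem_take_to st_def; simp add: fun_eq_iff fun_upd_apply)
  have cl: "sem n (clear IN) (st d q (drop N p') p2 [] (take N p') y x') = st d q (drop N p') p2 [] [] y x'"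
    using N_le by (simp add: sem_clear st_def; simp add: fun_eq_iff fun_upd_apply)
  show ?thesis unfolding p by (cases u; cases b) (simp_all add: branch_def Let_def t cl)
qed

lemma walk_step_skip:
  "sem n walk_step (st d q p [] mode cur y x') = st d q p [] mode cur y x'"
  "sem n walk_step (st d q p [b] mode cur y x') = st d q p [] mode cur y x'"
  "sem n walk_step (st d q p (False # b # p2) mode cur y x') = st d q p p2 mode cur y x'"
  "sem n walk_step (st 0 q p (True # b # p2) mode cur y x') = st 0 q p p2 mode cur y x'"
  by (cases b; simp add: walk_step_def descend_def Let_def)+

lemma walk_step_descend:
  "sem n walk_step (st (Suc d) q p (True # b # p2) mode cur y x') =
     sem n (Case MODE (on_path b) (Put MODE False) (inside b)) (st d (q @ [b]) p p2 mode cur y x')"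
  by (cases b; cases mode) (simp_all add: walk_step_def descend_def Let_def)

lemma sem_check:
  assumes "s RES = rev z" "length z = 2 * N" "s DEP = replicate d True" "s TP = rev q" "length q + d = 2 * N"
    "s XP = rev x'" "length x' = N" "calm (s(RES := []))" "s CODE = enc_circuit C" "s IN = []"
    "s W = []" "s NEQ = []" "s Z = []" "s REF = []" "s LT = (if lt then [True] else [])"
  shows "(sem n check s REF = [] \<longleftrightarrow> \<not> ((circuit_eval C x' = z \<and> lt) \<or> (d = 0 \<and> z \<noteq> q))) \<and>
    sem n check s Y = s Y \<and> sem n check s OUT = s OUT \<and> sem n check s T1 = []"
proof -
  note c = assms(8)[unfolded calm_def quiet_def, simplified]
  define v where "v = (if d = 0 \<and> z \<noteq> q then [True] else [])"
  define s1 where "s1 = s(DEP := tl (s DEP), TP := if d = 0 then [] else s TP, REF := v)"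
  have 1: "sem n (Case DEP (copy RES W ;; neq W TP REF) Nop Nop) s = s1"
  proof (cases d)
    case 0
    then have "sem n (Case DEP (copy RES W ;; neq W TP REF) Nop Nop) s =
        s(W := [], TP := [], REF := if rev z = rev q then [] else [True])"
      using assms N_le c by (simp add: sem_copy sem_neq; simp add: fun_eq_iff fun_upd_apply)
    then show ?thesis using 0 assms by (simp add: s1_def v_def fun_eq_iff fun_upd_apply)
  next
    case (Suc d')
    then show ?thesis using assms by (simp add: s1_def v_def; simp add: fun_eq_iff fun_upd_apply)
  qed
  define s2 where "s2 = s1(RES := [], W := z, XP := [], IN := rev x')"
  have 2: "sem n (move RES W ;; move XP T2 ;; move T2 IN) s1 = s2"
    using assms N_le c by (simp add: s1_def s2_def sem_move; simp add: fun_eq_iff fun_upd_apply)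
  have 3: "sem n eval_circuit s2 = s2(IN := [], RES := rev (circuit_eval C x'))"
    by (rule sem_eval) (use assms c in \<open>simp_all add: s1_def s2_def calm_def quiet_def\<close>)
  have len: "length (circuit_eval C x') = 2 * N" using assms by (simp add: length_F)
  define s3 where "s3 = s2(IN := [], W := [], NEQ := if z = circuit_eval C x' then [] else [True])"
  have 4: "sem n (move RES Z ;; neq W Z NEQ) (s2(IN := [], RES := rev (circuit_eval C x'))) = s3"
    using assms N_le c len
    by (simp add: s1_def s2_def s3_def sem_move sem_neq; simp add: fun_eq_iff fun_upd_apply)
  have "sem n check s = sem n (Case NEQ (Case LT Nop Nop (Put REF True)) Nop Nop) s3"
    unfolding check_def using 1 2 3 4 by simp
  then show ?thesis using assms c
    by (auto simp: s1_def s2_def s3_def v_def)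
qed

lemma sem_report:
  assumes "s REF = [] \<longleftrightarrow> \<not> r" "s Y = rev y" "s OUT = []" "s T1 = []" "length y = 2 * N"
  shows "sem n (Case REF (copy Y OUT) Nop Nop) s OUT = (if r then [] else rev y)"
  using assms N_le by (cases "s REF") (auto simp: sem_copy)

lemma finish_inside:
  assumes "length cur = N" "length q + d = 2 * N" "length x' = N" "length y = 2 * N"
  shows "sem n finish (st d q p p2 [True] cur y x') OUT =
    (if (circuit_eval C x' = circuit_eval C cur \<and> num (rev x') < num (rev cur)) \<or>
        (d = 0 \<and> circuit_eval C cur \<noteq> q) then [] else rev y)"
proof -
  let ?lt = "num (rev x') < num (rev cur)"
  let ?s = "(st d q p p2 [] cur y x')(LT := if ?lt then [True] else [])"
  let ?s' = "?s(IN := [], RES := rev (circuit_eval C cur))"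
  have 1: "sem n (copy IN SV ;; copy XP W ;; smaller W SV LT) (st d q p p2 [] cur y x') = ?s"
    using assms N_le by (simp add: sem_copy sem_smaller st_def; simp add: fun_eq_iff fun_upd_apply)
  have 2: "sem n eval_circuit ?s = ?s'"
    by (rule sem_eval) (use assms in \<open>simp_all add: calm_def quiet_def st_def\<close>)
  have 3: "sem n finish (st d q p p2 [True] cur y x') =
      sem n (Case REF (copy Y OUT) Nop Nop) (sem n check ?s')"
    using 1 2 by (simp add: finish_def check_inside_def Let_def)
  have 4: "(sem n check ?s' REF = [] \<longleftrightarrow> \<not> ((circuit_eval C x' = circuit_eval C cur \<and> ?lt) \<or> (d = 0 \<and> circuit_eval C cur \<noteq> q))) \<and>
    sem n check ?s' Y = ?s' Y \<and> sem n check ?s' OUT = ?s' OUT \<and> sem n check ?s' T1 = []"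
    by (rule sem_check) (use assms in \<open>simp_all add: length_F calm_def quiet_def st_def\<close>)
  show ?thesis unfolding 3 by (rule sem_report) (use 4 assms in \<open>simp_all add: st_def\<close>)
qed

lemma finish_end:
  assumes "length q + d = 2 * N" "length x' = N" "length y = 2 * N"
    and stop: "d = 0 \<or> p = [] \<or> \<not> hd p"
  shows "sem n finish (st d q p p2 [] [] y x') OUT =
    (if circuit_eval C x' = y \<or> (d = 0 \<and> y \<noteq> q) then [] else rev y)"
proof -
  define p' where "p' = (if d = 0 then p else tl p)"
  let ?s = "(st d q p' p2 [] [] y x')(RES := rev y, LT := [True])"
  have 1: "sem n (copy Y RES ;; Put LT True) (st d q p' p2 [] [] y x') = ?s"
    using assms N_le by (simp add: sem_copy st_def; simp add: fun_eq_iff fun_upd_apply)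
  have 2: "sem n finish (st d q p p2 [] [] y x') =
      sem n (Case REF (copy Y OUT) Nop Nop) (sem n check ?s)"
  proof (cases d)
    case 0
    then show ?thesis using 1 by (simp add: finish_def check_end_def Let_def p'_def)
  next
    case (Suc d')
    then show ?thesis using 1 stop
      by (cases p) (auto simp: finish_def check_end_def Let_def p'_def)
  qed
  have 4: "(sem n check ?s REF = [] \<longleftrightarrow> \<not> ((circuit_eval C x' = y \<and> True) \<or> (d = 0 \<and> y \<noteq> q))) \<and>
    sem n check ?s Y = ?s Y \<and> sem n check ?s OUT = ?s OUT \<and> sem n check ?s T1 = []"
    by (rule sem_check) (use assms in \<open>simp_all add: calm_def quiet_def st_def\<close>)
  show ?thesis unfolding 2 by (rule sem_report) (use 4 assms in \<open>simp_all add: st_def\<close>)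
qed

lemma finish_unfinished:
  assumes "length y = 2 * N" "hd p" "p \<noteq> []"
  shows "sem n finish (st (Suc d) q p p2 [] [] y x') OUT = rev y"
  using assms sem_report[of "st (Suc d) q (tl p) p2 [] [] y x'" False y]
  by (cases p) (simp_all add: finish_def Let_def)

lemma finish_dead:
  assumes "length y = 2 * N" shows "sem n finish (st d q p p2 [False] cur y x') OUT = rev y"
  using assms sem_report[of "st d q p p2 [] cur y x'" False y]
  by (simp add: finish_def Let_def)

lemma walk_dead:
  "length y = 2 * N \<Longrightarrow> sem n finish ((sem n walk_step ^^ k) (st d q p p2 [False] cur y x')) OUT = rev y"
proof (induction k arbitrary: d q p2)
  case 0
  then show ?case by (simp add: finish_dead)
next
  case (Suc k)
  have "\<exists>d' q' p2'. sem n walk_step (st d q p p2 [False] cur y x') = st d' q' p p2' [False] cur y x'"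
    by (cases p2 rule: path.cases; cases d; simp add: walk_step_skip walk_step_descend; blast)
  then show ?case unfolding funpow_Suc_apply using Suc by auto
qed

text \<open>The loop version of \<open>refin\<close>. Rounds after the end of \<open>p2\<close>
  idle, and at height 0 pairs are consumed without effect, just as \<open>refin\<close> ignores the
  rest of the path there.\<close>

lemma walk_inside:
  assumes "length p2 \<le> k" "length cur = N" "length q + d = 2 * N" "length x' = N" "length y = 2 * N"
  shows "sem n finish ((sem n walk_step ^^ k) (st d q p p2 [True] cur y x')) OUT =
    (if refin d q cur (path p2) x' then [] else rev y)"
proof -
  \<comment> \<open>A lone last bit is no pair; one round drops it and the walk stays where it
    is.\<close>
  have single: "sem n finish ((sem n walk_step ^^ k) (st d q p [v] [True] cur y x')) OUT =
      (if refin d q cur (path [v]) x' then [] else rev y)"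
    if a: "length [v] \<le> k" "length cur = N" "length q + d = 2 * N" "length x' = N" "length y = 2 * N"
    for v d q cur k
  proof -
    obtain k' where k: "k = Suc k'" using a by (cases k) auto
    show ?thesis
      using a unfolding k by (cases d; cases v)
        (simp_all add: funpow_Suc_apply funpow_fixed walk_step_skip finish_inside del: funpow.simps)
  qed
  show ?thesis using assms
proof (induction p2 arbitrary: d q cur k rule: path.induct)
  case (1 b r)
  then obtain k' where k: "k = Suc k'" "length r \<le> k'" by (cases k) auto
  show ?case
  proof (cases d)
    case 0
    then show ?thesis using 1 k
      by (simp add: funpow_Suc_apply walk_step_skip del: funpow.simps)
  next
    case (Suc d')
    then show ?thesis using 1 k
      by (simp add: funpow_Suc_apply walk_step_descend sem_inside half_F del: funpow.simps)
  qed
next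
  case (2 b r)
  then obtain k' where k: "k = Suc k'" "length r \<le> k'" by (cases k) auto
  then show ?case using 2 by (simp add: funpow_Suc_apply walk_step_skip del: funpow.simps)
next
  case "3_1"
  then show ?case by (cases d) (simp_all add: funpow_fixed walk_step_skip finish_inside)
next
  case "3_2"
  then show ?case by (rule single)
next
  case "3_3"
  then show ?case by (rule single)
qed
qed

text \<open>The loop version of \<open>ref\<close>. A walk that leaves the certified path is handed
  over to \<open>walk_inside\<close> or \<open>walk_dead\<close>; the bound on
  \<open>length p\<close> ensures that a label taken from a record has \<open>N\<close>
  bits.\<close>

lemma walk_on_path:
  assumes "length p2 \<le> k" "length q + d = 2 * N" "length x' = N" "length y = 2 * N" "d * (N + 2) \<le> length p"
  shows "sem n finish ((sem n walk_step ^^ k) (st d q p p2 [] [] y x')) OUT =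
    (if ref d q p y (path p2) x' then [] else rev y)"
proof -
  have end_state: "sem n finish (st d q p [] [] [] y x') OUT = (if ref d q p y [] x' then [] else rev y)"
    if "length q + d = 2 * N" "length x' = N" "length y = 2 * N" "d * (N + 2) \<le> length p" for d q p
    using that by (cases d; cases "p = [] \<or> \<not> hd p") (auto simp: finish_end finish_unfinished)
  have single: "sem n finish ((sem n walk_step ^^ k) (st d q p [v] [] [] y x')) OUT =
      (if ref d q p y (path [v]) x' then [] else rev y)"
    if a: "length [v] \<le> k" "length q + d = 2 * N" "length x' = N" "length y = 2 * N"
      "d * (N + 2) \<le> length p" for v d q p k
  proof -
    obtain k' where k: "k = Suc k'" using a by (cases k) auto
    show ?thesis using end_state[OF a(2-5)] unfolding k
      by (cases v) (simp_all add: funpow_Suc_apply funpow_fixed walk_step_skip del: funpow.simps)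
  qed
  show ?thesis using assms
proof (induction p2 arbitrary: d q p k rule: path.induct)
  case (1 b r)
  then obtain k' where k: "k = Suc k'" "length r \<le> k'" by (cases k) auto
  show ?case
  proof (cases d)
    case 0
    then show ?thesis using 1 k by (simp add: funpow_Suc_apply walk_step_skip del: funpow.simps)
  next
    case (Suc d')
    show ?thesis
    proof (cases "p = [] \<or> \<not> hd p")
      case True
      then have "sem n (on_path b) (st d' (q @ [b]) p r [] [] y x') =
          st d' (q @ [b]) (tl p) r [True] (half b y) y x'"
        using 1 by (cases p) (simp_all add: on_path_def sem_ended)
      moreover have "length (half b y) = N" using 1 by (simp add: half_def)
      ultimately show ?thesis using True 1 k Suc
        by (simp add: funpow_Suc_apply walk_step_descend walk_inside del: funpow.simps)
    next
      case False
      then obtain u p' where p: "p = True # u # p'" using 1 Suc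
        by (cases p; cases "tl p") auto
      have "sem n (on_path b) (st d' (q @ [b]) p r [] [] y x') = sem n (branch b) (st d' (q @ [b]) (u # p') r [] [] y x')"
        by (simp add: on_path_def p)
      also have "\<dots> = (if b = u then st d' (q @ [b]) (drop N p') r [] [] y x'
         else if u then st d' (q @ [b]) (drop N p') r [True] (take N p') y x'
         else st d' (q @ [b]) (drop N p') r [False] [] y x')"
        using sem_branch[of "u # p'"] 1 Suc by (simp add: p)
      finally have step: "sem n (on_path b) (st d' (q @ [b]) p r [] [] y x') = \<dots>" .
      have "length (take N p') = N" using 1 Suc by (simp add: p)
      with 1 k Suc show ?thesis
        by (simp add: p funpow_Suc_apply walk_step_descend step[unfolded p] walk_inside walk_dead del: funpow.simps)
    qed
  qed
next
  case (2 b r)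
  then obtain k' where k: "k = Suc k'" "length r \<le> k'" by (cases k) auto
  then show ?case using 2 by (simp add: funpow_Suc_apply walk_step_skip del: funpow.simps)
next
  case "3_1"
  then have "sem n finish (st d q p [] [] [] y x') OUT = (if ref d q p y [] x' then [] else rev y)"
    by (intro end_state)
  then show ?case by (simp add: funpow_fixed walk_step_skip)
next
  case "3_2"
  then show ?case by (rule single)
next
  case "3_3"
  then show ?case by (rule single)
qed
qed

lemma sem_setup:
  assumes "2 * N \<le> length a" "N \<le> length b"
  shows "sem n setup (input (enc_circuit C) a b) =
    st (2 * N) [] (drop (2 * N) a) (drop N b) [] [] (take (2 * N) a) (take N b)"
proof -
  let ?s = "input (enc_circuit C) a b"
  define rest where "rest = enc_nat (length (c_gates C)) @ concat (map enc_gate (c_gates C)) @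
    enc_nat (length (c_outputs C)) @ concat (map enc_nat (c_outputs C))"
  have enc: "enc_circuit C = enc_nat N @ rest" by (simp add: enc_circuit_def rest_def)
  have 1: "sem n (copy CODE XW) ?s = ?s(XW := enc_circuit C)"
    using n by (simp add: sem_copy input_def)
  have 2: "sem n readnum (?s(XW := enc_circuit C)) = ?s(XW := rest, U := replicate N True)"
    using sem_readnum[of "?s(XW := enc_circuit C)" N rest n] N_le enc by (simp add: quiet_def input_def)
  have "length rest \<le> n" using n enc by simp
  then have 3: "sem n (clear XW ;; move U NN ;; copy NN DEP ;; copy NN DEP) (?s(XW := rest, U := replicate N True)) =
      ?s(NN := replicate N True, DEP := replicate (2 * N) True)"
    using N_le by (simp add: sem_clear sem_move sem_copy input_def; simp add: fun_eq_iff fun_upd_apply mult_2 replicate_add)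
  have 4: "rev (take N (drop N a)) @ rev (take N a) = rev (take (2 * N) a)"
    by (simp add: mult_2 take_add)
  have 5: "sem n (take_to P1 Y ;; take_to P1 Y ;; take_to P2 XP)
      (?s(NN := replicate N True, DEP := replicate (2 * N) True)) =
    st (2 * N) [] (drop (2 * N) a) (drop N b) [] [] (take (2 * N) a) (take N b)"
    using N_le 4 by (simp add: sem_take_to input_def st_def; simp add: fun_eq_iff fun_upd_apply mult_2)
  show ?thesis using 1 2 3 5 by (simp add: setup_def)
qed

theorem sem_verifier:
  assumes "2 * N + 2 * N * (N + 2) \<le> length a" "N \<le> length b" "length b \<le> n"
  shows "sem n verifier (input (enc_circuit C) a b) OUT =
    (if ref (2 * N) [] (drop (2 * N) a) (take (2 * N) a) (path (drop N b)) (take N b)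
     then [] else rev (take (2 * N) a))"
  using assms walk_on_path[of "drop N b" n "[]" "2 * N" "take N b" "take (2 * N) a" "drop (2 * N) a"]
  by (simp add: verifier_def sem_setup)

end

section \<open>The output under the two quantifiers\<close>

lemma uses_verifier: "uses verifier \<subseteq> {..<29}"
  by (simp add: verifier_def setup_def walk_step_def descend_def Let_def on_path_def branch_def ended_def
      inside_def finish_def check_inside_def check_end_def check_def eval_circuit_def get_half_def
      take_to_def)

definition verdict :: "bool list \<Rightarrow> bool list \<Rightarrow> bool list \<Rightarrow> bool list option" where
  "verdict x a b = (let s = sem (length x + length a + length b) verifier (input x a b)
     in if s 0 = [] then None else Some (rev (s 0)))"

text \<open>Padding bits form skipped pairs, and an odd one left over contributes nothing, so the
  parity of \<open>k\<close> is irrelevant.\<close>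

lemma path_steps: "path (concat (map (\<lambda>b. [True, b]) t) @ replicate k False) = t"
proof -
  have "path (replicate k False) = []"
  proof (induction k rule: less_induct)
    case (less k)
    show ?case
    proof (cases k)
      case (Suc k')
      then show ?thesis using less[of "k' - 1"] by (cases k') auto
    qed simp
  qed
  then show ?thesis by (induction t) auto
qed

lemma fs2p_outputs_avoid:
  assumes "circuit_wf C" "1 \<le> c_inputs C" "length (c_outputs C) = 2 * c_inputs C"
  shows "\<exists>y. fs2p_outputs (\<lambda>m. m * m) verdict (enc_circuit C) y \<and>
    length y = 2 * c_inputs C \<and> y \<notin> circuit_image C"
proof -
  define m where "m = length (enc_circuit C)"
  define l where "l = m * m"
  have m: "4 * c_inputs C \<le> m" "1 \<le> m" using length_enc_circuit[of C] assms(3) by (simp_all add: m_def)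
  have "m \<le> l" using m(2) by (simp add: l_def)
  then have "3 * m \<le> m + l + l" by simp
  then interpret avoid C "m + l + l"
    by unfold_locales (use assms in \<open>simp_all add: m_def\<close>)
  \<comment> \<open>The \<open>2 * N\<close> outputs take two bits each, hence
    \<open>4 * N \<le> m\<close>. The square then has room for \<open>y\<close> with
    \<open>2 * N\<close> records, and for the \<open>5 * N\<close> bits of \<open>x'\<close> and a
    path of \<open>2 * N\<close> pairs.\<close>
  have "(4 * N) * (4 * N) \<le> l" unfolding l_def by (intro mult_le_mono m)
  then have "16 * (N * N) \<le> l" by (simp add: mult.left_commute)
  moreover have "N \<le> N * N" using inputs by simp
  moreover have "2 * N + 2 * N * (N + 2) = 6 * N + 2 * (N * N)" by (simp add: algebra_simps)
  ultimately have l: "2 * N + 2 * N * (N + 2) \<le> l" "5 * N \<le> l" by linarith+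
  have verdict: "verdict (enc_circuit C) a b =
    (if ref (2 * N) [] (drop (2 * N) a) (take (2 * N) a) (path (drop N b)) (take N b)
     then None else Some (take (2 * N) a))" if "length a = l" "length b = l" for a b
  proof -
    \<comment> \<open>An empty output stack means bottom, so the claimed string must be nonempty to
      be reported.\<close>
    have "a \<noteq> []" using that l inputs by auto
    then show ?thesis using sem_verifier[of a b] that l inputs by (simp add: verdict_def m_def[symmetric])
  qed
  define y where "y = gap (2 * N) []"
  have y: "length y = 2 * N" "\<forall>x. length x = N \<longrightarrow> circuit_eval C x \<noteq> y"
    using gap_avoid[OF lab_root] by (simp_all add: y_def)
  have "\<exists>a. length a = l \<and> (\<forall>b. length b = l \<longrightarrow> verdict (enc_circuit C) a b = Some y)"
  proof -
    obtain p where p: "length p = 2 * N * (N + 2)"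
      "\<And>t x' z. length x' = N \<Longrightarrow> \<not> ref (2 * N) [] (p @ z) y t x'"
      using ex_not_ref[OF lab_root] by (auto simp: y_def)
    let ?a = "y @ p @ replicate (l - (2 * N + 2 * N * (N + 2))) False"
    have a: "length ?a = l" using l y p by simp
    have "verdict (enc_circuit C) ?a b = Some y" if "length b = l" for b
      using verdict[OF a that] p(2)[of "take N b"] y(1) l that by simp
    with a show ?thesis by blast
  qed
  moreover have "\<exists>b. length b = l \<and> verdict (enc_circuit C) a b \<in> {Some y, None}" if a: "length a = l" for a
  proof (rule ccontr)
    \<comment> \<open>A certificate without a refuter claims \<open>y\<close> by soundness, but then
      it yields \<open>Some y\<close> for every \<open>b\<close>.\<close>
    assume none: "\<not> ?thesis"
    then have not_ref: "\<not> ref (2 * N) [] (drop (2 * N) a) (take (2 * N) a) (path (drop N b)) (take N b)"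
      if "length b = l" for b
      using verdict[OF a that] that by auto
    have "lab (2 * N) [] = None \<and> take (2 * N) a = gap (2 * N) []"
    proof (rule gap_if_not_ref)
      show "length (take (2 * N) a) = 2 * N" "2 * N * (N + 2) \<le> length (drop (2 * N) a)" using a l by auto
      fix t x' :: "bool list" assume t: "length t \<le> 2 * N" "length x' = N"
      let ?b = "x' @ concat (map (\<lambda>b. [True, b]) t) @ replicate (l - (N + 2 * length t)) False"
      have "length (concat (map (\<lambda>b. [True, b]) t)) = 2 * length t" by (induction t) auto
      then have "length ?b = l" using t l(2) by simp
      from not_ref[OF this] show "\<not> ref (2 * N) [] (drop (2 * N) a) (take (2 * N) a) t x'"
        using t(2) by (simp add: path_steps)
    qed
    then have "take (2 * N) a = y" by (simp add: y_def)
    moreover have b: "length (replicate l False) = l" by simp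
    ultimately have "verdict (enc_circuit C) a (replicate l False) = Some y"
      using verdict[OF a b] not_ref[OF b] by simp
    with none b show False by blast
  qed
  ultimately have "fs2p_outputs (\<lambda>m. m * m) verdict (enc_circuit C) y"
    by (simp add: fs2p_outputs_def m_def[symmetric] l_def[symmetric])
  with y show ?thesis by (auto simp: circuit_image_def)
qed

theorem mainTheorem11:
  shows "\<exists>l V. poly_fun l \<and> ptime3 V \<and>
     (\<forall>n \<ge> 1. \<forall>C. circuit_wf C \<and> c_inputs C = n \<and> length (c_outputs C) = 2 * n \<longrightarrow>
        (\<exists>y. fs2p_outputs l V (enc_circuit C) y \<and>
             length y = 2 * n \<and> y \<notin> circuit_image C))"
proof -
  have "ptime3 verdict"
    using ptime3_sem[OF uses_verifier] unfolding verdict_def[abs_def] by simp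
  moreover have "poly_fun (\<lambda>m. m * m)" by (intro poly_fun_intros)
  ultimately show ?thesis
    using fs2p_outputs_avoid by (intro exI[of _ "\<lambda>m. m * m"] exI[of _ verdict]) blast
qed

end
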